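(* Assume $p\geq 13$ and $p\not\equiv 11 \pmod{12}$. There is a finite subset $\mathcal{F}\subset\overline{R}$ with the following property: for any non-singular pair $a,b\in R$ such that the reduction mod $p$ of the $j$-invariant $j(a,b)=1728\cdot\frac{4a^3}{4a^3+27b^2}$ does not lie in $\mathcal{F}$, there exists a Frobenius lift $\phi$ on $\widehat{E^*_{ab}}$ which is Lie invariant mod $p^2$ (with some eigenvalue $\lambda\in R$).
   Context: $p$ is a prime, $p\neq 2,3$. $R$ is a complete discrete valuation ring with maximal ideal generated by $p$ and algebraically closed residue field $\overline{R}=R/pR$; $\phi$ also denotes the unique Frobenius lift on $R$. For $a,b\in R$ put $f(x)=x^3+ax+b$ and $E^*_{ab}=\mathrm{Spec}\, R[x,y,y^{-1}]/(y^2-f(x))$ (the affine elliptic curve $y^2=f(x)$ with its three $2$-torsion points removed); $\widehat{E^*_{ab}}$ is its $p$-adic completion. The pair $a,b$ is non-singular if $4a^3+27b^2\in R^\times$. A Frobenius lift on $\widehat{E^*_{ab}}$ is an endomorphism of $\widehat{\mathcal{O}(E^*_{ab})}$ compatible with $\phi$ on $R$ whose reduction mod $p$ is the $p$-power Frobenius. With $\Omega_{\widehat{E^*_{ab}}/R}:=\varprojlim_n\Omega_{(E^*_{ab}\otimes R/p^nR)/(R/p^nR)}$ and $\omega=dx/y$, $\phi$ is Lie invariant mod $p^m$ with eigenvalue $\lambda\in R$ if $\frac{1}{p}\phi^*\omega\equiv\lambda\omega\pmod{p^m}$, and Lie invariant mod $p^m$ if this holds for some $\lambda\in R$. *)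

theory Defs
  imports "HOL-Algebra.Algebra" "HOL-Number_Theory.Cong"
begin

abbreviation nat_elem :: "('a, 'm) ring_scheme \<Rightarrow> nat \<Rightarrow> 'a"
  where "nat_elem A n \<equiv> add_pow A n \<one>\<^bsub>A\<^esub>"

text \<open>The map on cosets induced by \<open>f\<close>; for the maps below the cosets in the union all
  coincide.\<close>

definition coset_map :: "('b, 'n) ring_scheme \<Rightarrow> 'b set \<Rightarrow> ('a \<Rightarrow> 'b) \<Rightarrow> 'a set \<Rightarrow> 'b set"
  where "coset_map M N f C = (\<Union>c\<in>C. N +>\<^bsub>M\<^esub> f c)"


section \<open>Discrete valuation rings and p-adic completion\<close>

definition discrete_valuation_ring :: "('a, 'm) ring_scheme \<Rightarrow> bool"
  where "discrete_valuation_ring R \<longleftrightarrow>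
    principal_domain R \<and> (\<exists>!M. maximalideal M R) \<and> \<not> field R"

definition padic_ideal :: "nat \<Rightarrow> ('a, 'm) ring_scheme \<Rightarrow> nat \<Rightarrow> 'a set"
  where "padic_ideal p A n = PIdl\<^bsub>A\<^esub> (nat_elem A (p ^ n))"

definition padic_quot :: "nat \<Rightarrow> ('a, 'm) ring_scheme \<Rightarrow> nat \<Rightarrow> 'a set ring"
  where "padic_quot p A n = A Quot (padic_ideal p A n)"

definition padic_transition :: "nat \<Rightarrow> ('a, 'm) ring_scheme \<Rightarrow> nat \<Rightarrow> 'a set \<Rightarrow> 'a set"
  where "padic_transition p A n = coset_map A (padic_ideal p A n) (\<lambda>x. x)"

text \<open>The inverse limit of the rings \<open>A / p\<^sup>n A\<close>, as compatible sequences; the projection to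
  \<open>A / p\<^sup>n A\<close> is evaluation at \<open>n\<close>.\<close>

definition padic_completion :: "nat \<Rightarrow> ('a, 'm) ring_scheme \<Rightarrow> (nat \<Rightarrow> 'a set) ring"
  where "padic_completion p A =
    \<lparr>carrier = {s. (\<forall>n. s n \<in> carrier (padic_quot p A n)) \<and>
                   (\<forall>n. padic_transition p A n (s (Suc n)) = s n)},
     monoid.mult = (\<lambda>s t n. s n \<otimes>\<^bsub>padic_quot p A n\<^esub> t n),
     one = (\<lambda>n. \<one>\<^bsub>padic_quot p A n\<^esub>),
     ring.zero = (\<lambda>n. \<zero>\<^bsub>padic_quot p A n\<^esub>),
     add = (\<lambda>s t n. s n \<oplus>\<^bsub>padic_quot p A n\<^esub> t n)\<rparr>"

definition padic_embed :: "nat \<Rightarrow> ('a, 'm) ring_scheme \<Rightarrow> 'a \<Rightarrow> nat \<Rightarrow> 'a set"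
  where "padic_embed p A x = (\<lambda>n. padic_ideal p A n +>\<^bsub>A\<^esub> x)"

definition padically_complete :: "nat \<Rightarrow> ('a, 'm) ring_scheme \<Rightarrow> bool"
  where "padically_complete p A \<longleftrightarrow>
    bij_betw (padic_embed p A) (carrier A) (carrier (padic_completion p A))"

definition frobenius_lift :: "nat \<Rightarrow> ('a, 'm) ring_scheme \<Rightarrow> ('a \<Rightarrow> 'a) \<Rightarrow> bool"
  where "frobenius_lift p A \<phi> \<longleftrightarrow>
    \<phi> \<in> ring_hom A A \<and>
    (\<forall>x\<in>carrier A. \<phi> x \<ominus>\<^bsub>A\<^esub> x [^]\<^bsub>A\<^esub> p \<in> PIdl\<^bsub>A\<^esub> (nat_elem A p))"


section \<open>Kaehler differentials\<close>

text \<open>In the module records below the ring fields \<open>mult\<close> and \<open>one\<close> carry no meaning.\<close>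

definition free_module :: "('a, 'm) ring_scheme \<Rightarrow> 'i set \<Rightarrow> ('a, 'i \<Rightarrow> 'a) module"
  where "free_module A I =
    \<lparr>carrier = {g. (\<forall>i\<in>I. g i \<in> carrier A) \<and> (\<forall>i. i \<notin> I \<longrightarrow> g i = \<zero>\<^bsub>A\<^esub>) \<and>
                   finite {i. g i \<noteq> \<zero>\<^bsub>A\<^esub>}},
     monoid.mult = undefined, one = undefined,
     ring.zero = (\<lambda>i. \<zero>\<^bsub>A\<^esub>),
     add = (\<lambda>g h i. g i \<oplus>\<^bsub>A\<^esub> h i),
     smult = (\<lambda>c g i. c \<otimes>\<^bsub>A\<^esub> g i)\<rparr>"

definition free_gen :: "('a, 'm) ring_scheme \<Rightarrow> 'i \<Rightarrow> 'i \<Rightarrow> 'a"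
  where "free_gen A i = (\<lambda>k. if k = i then \<one>\<^bsub>A\<^esub> else \<zero>\<^bsub>A\<^esub>)"

text \<open>The \<open>u\<close>-semilinear map \<open>A\<^sup>(\<^sup>A\<^sup>) \<rightarrow> A'\<^sup>(\<^sup>A\<^sup>'\<^sup>)\<close> sending \<open>c[x]\<close> to \<open>u(c)[u(x)]\<close>.\<close>

definition free_push ::
  "('a, 'm) ring_scheme \<Rightarrow> ('b, 'n) ring_scheme \<Rightarrow> ('a \<Rightarrow> 'b) \<Rightarrow> ('a \<Rightarrow> 'a) \<Rightarrow> 'b \<Rightarrow> 'b"
  where "free_push A A' u g =
    (\<lambda>k. \<Oplus>\<^bsub>A'\<^esub>x\<in>{x \<in> carrier A. g x \<noteq> \<zero>\<^bsub>A\<^esub> \<and> u x = k}. u (g x))"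

definition submodule_span ::
  "('a, 'm) ring_scheme \<Rightarrow> ('a, 'b, 'n) module_scheme \<Rightarrow> 'b set \<Rightarrow> 'b set"
  where "submodule_span A M S = \<Inter>{H. submodule H A M \<and> S \<subseteq> H}"

definition quot_module :: "('a, 'b, 'n) module_scheme \<Rightarrow> 'b set \<Rightarrow> ('a, 'b set) module"
  where "quot_module M N =
    \<lparr>carrier = a_rcosets\<^bsub>M\<^esub> N,
     monoid.mult = undefined, one = undefined,
     ring.zero = N,
     add = set_add M,
     smult = (\<lambda>c. coset_map M N (\<lambda>x. c \<odot>\<^bsub>M\<^esub> x))\<rparr>"

definition kaehler_free :: "('a, 'm) ring_scheme \<Rightarrow> ('a, 'a \<Rightarrow> 'a) module"
  where "kaehler_free A = free_module A (carrier A)"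

definition kaehler_relations ::
  "('b, 'n) ring_scheme \<Rightarrow> ('b \<Rightarrow> 'a) \<Rightarrow> ('a, 'm) ring_scheme \<Rightarrow> ('a \<Rightarrow> 'a) set"
  where "kaehler_relations B \<iota> A =
    (let F = kaehler_free A; e = free_gen A in
      submodule_span A F
       ({e (x \<oplus>\<^bsub>A\<^esub> y) \<ominus>\<^bsub>F\<^esub> (e x \<oplus>\<^bsub>F\<^esub> e y) | x y. x \<in> carrier A \<and> y \<in> carrier A} \<union>
        {e (x \<otimes>\<^bsub>A\<^esub> y) \<ominus>\<^bsub>F\<^esub> (x \<odot>\<^bsub>F\<^esub> e y \<oplus>\<^bsub>F\<^esub> y \<odot>\<^bsub>F\<^esub> e x) | x y. x \<in> carrier A \<and> y \<in> carrier A} \<union>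
        {e (\<iota> r) | r. r \<in> carrier B}))"

text \<open>Differentials of \<open>A\<close> over \<open>B\<close>, for the \<open>B\<close>-algebra structure \<open>\<iota> : B \<rightarrow> A\<close>.\<close>

definition kaehler ::
  "('b, 'n) ring_scheme \<Rightarrow> ('b \<Rightarrow> 'a) \<Rightarrow> ('a, 'm) ring_scheme \<Rightarrow> ('a, ('a \<Rightarrow> 'a) set) module"
  where "kaehler B \<iota> A = quot_module (kaehler_free A) (kaehler_relations B \<iota> A)"

definition kaehler_d ::
  "('b, 'n) ring_scheme \<Rightarrow> ('b \<Rightarrow> 'a) \<Rightarrow> ('a, 'm) ring_scheme \<Rightarrow> 'a \<Rightarrow> ('a \<Rightarrow> 'a) set"
  where "kaehler_d B \<iota> A x = kaehler_relations B \<iota> A +>\<^bsub>kaehler_free A\<^esub> free_gen A x"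

text \<open>The map \<open>c dx \<mapsto> u(c) d(u(x))\<close> to the differentials of \<open>A'\<close> over \<open>B'\<close>, for a ring
  homomorphism \<open>u : A \<rightarrow> A'\<close> carrying the image of the base of \<open>A\<close> into the image of \<open>B'\<close>.\<close>

definition kaehler_map ::
  "('b, 'n) ring_scheme \<Rightarrow> ('b \<Rightarrow> 'c) \<Rightarrow> ('a, 'm) ring_scheme \<Rightarrow> ('c, 'k) ring_scheme \<Rightarrow>
   ('a \<Rightarrow> 'c) \<Rightarrow> ('a \<Rightarrow> 'a) set \<Rightarrow> ('c \<Rightarrow> 'c) set"
  where "kaehler_map B' \<iota>' A A' u =
    coset_map (kaehler_free A') (kaehler_relations B' \<iota>' A') (free_push A A' u)"


section \<open>Differentials on the p-adic completion of an R-algebra\<close>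

text \<open>The structure map \<open>R / p\<^sup>n R \<rightarrow> A / p\<^sup>n A\<close>.\<close>

definition padic_structure ::
  "nat \<Rightarrow> ('r \<Rightarrow> 'a) \<Rightarrow> ('a, 'm) ring_scheme \<Rightarrow> nat \<Rightarrow> 'r set \<Rightarrow> 'a set"
  where "padic_structure p \<iota> A n = coset_map A (padic_ideal p A n) \<iota>"

definition omega_level ::
  "nat \<Rightarrow> ('r, 'n) ring_scheme \<Rightarrow> ('r \<Rightarrow> 'a) \<Rightarrow> ('a, 'm) ring_scheme \<Rightarrow> nat \<Rightarrow>
   ('a set, ('a set \<Rightarrow> 'a set) set) module"
  where "omega_level p R \<iota> A n =
    kaehler (padic_quot p R n) (padic_structure p \<iota> A n) (padic_quot p A n)"

definition omega_transition ::
  "nat \<Rightarrow> ('r, 'n) ring_scheme \<Rightarrow> ('r \<Rightarrow> 'a) \<Rightarrow> ('a, 'm) ring_scheme \<Rightarrow> nat \<Rightarrow>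
   ('a set \<Rightarrow> 'a set) set \<Rightarrow> ('a set \<Rightarrow> 'a set) set"
  where "omega_transition p R \<iota> A n =
    kaehler_map (padic_quot p R n) (padic_structure p \<iota> A n)
      (padic_quot p A (Suc n)) (padic_quot p A n) (padic_transition p A n)"

text \<open>The inverse limit of the differentials of \<open>A / p\<^sup>n A\<close> over \<open>R / p\<^sup>n R\<close>, a module over
  the completion of \<open>A\<close>.\<close>

definition omega_completed ::
  "nat \<Rightarrow> ('r, 'n) ring_scheme \<Rightarrow> ('r \<Rightarrow> 'a) \<Rightarrow> ('a, 'm) ring_scheme \<Rightarrow>
   (nat \<Rightarrow> 'a set, nat \<Rightarrow> ('a set \<Rightarrow> 'a set) set) module"
  where "omega_completed p R \<iota> A =
    \<lparr>carrier = {w. (\<forall>n. w n \<in> carrier (omega_level p R \<iota> A n)) \<and>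
                   (\<forall>n. omega_transition p R \<iota> A n (w (Suc n)) = w n)},
     monoid.mult = undefined, one = undefined,
     ring.zero = (\<lambda>n. \<zero>\<^bsub>omega_level p R \<iota> A n\<^esub>),
     add = (\<lambda>v w n. v n \<oplus>\<^bsub>omega_level p R \<iota> A n\<^esub> w n),
     smult = (\<lambda>s w n. s n \<odot>\<^bsub>omega_level p R \<iota> A n\<^esub> w n)\<rparr>"

text \<open>The endomorphism of \<open>A / p\<^sup>n A\<close> induced by an endomorphism \<open>\<phi>\<close> of the completion: lift to
  the completion, apply \<open>\<phi>\<close> and project. The choice of lift does not matter.\<close>

definition endo_level ::
  "nat \<Rightarrow> ('a, 'm) ring_scheme \<Rightarrow> ((nat \<Rightarrow> 'a set) \<Rightarrow> (nat \<Rightarrow> 'a set)) \<Rightarrow> nat \<Rightarrow> 'a set \<Rightarrow> 'a set"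
  where "endo_level p A \<phi> n C = \<phi> (SOME s. s \<in> carrier (padic_completion p A) \<and> s n = C) n"

definition omega_pullback ::
  "nat \<Rightarrow> ('r, 'n) ring_scheme \<Rightarrow> ('r \<Rightarrow> 'a) \<Rightarrow> ('a, 'm) ring_scheme \<Rightarrow>
   ((nat \<Rightarrow> 'a set) \<Rightarrow> (nat \<Rightarrow> 'a set)) \<Rightarrow>
   (nat \<Rightarrow> ('a set \<Rightarrow> 'a set) set) \<Rightarrow> (nat \<Rightarrow> ('a set \<Rightarrow> 'a set) set)"
  where "omega_pullback p R \<iota> A \<phi> w =
    (\<lambda>n. kaehler_map (padic_quot p R n) (padic_structure p \<iota> A n)
           (padic_quot p A n) (padic_quot p A n) (endo_level p A \<phi> n) (w n))"


section \<open>The curve\<close>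

definition disc :: "('r, 'm) ring_scheme \<Rightarrow> 'r \<Rightarrow> 'r \<Rightarrow> 'r"
  where "disc R a b =
    add_pow R (4::nat) (a [^]\<^bsub>R\<^esub> (3::nat)) \<oplus>\<^bsub>R\<^esub> add_pow R (27::nat) (b [^]\<^bsub>R\<^esub> (2::nat))"

definition nonsingular :: "('r, 'm) ring_scheme \<Rightarrow> 'r \<Rightarrow> 'r \<Rightarrow> bool"
  where "nonsingular R a b \<longleftrightarrow> disc R a b \<in> Units R"

definition j_invariant :: "('r, 'm) ring_scheme \<Rightarrow> 'r \<Rightarrow> 'r \<Rightarrow> 'r"
  where "j_invariant R a b =
    add_pow R (1728::nat) ((add_pow R (4::nat) (a [^]\<^bsub>R\<^esub> (3::nat))) \<otimes>\<^bsub>R\<^esub> inv\<^bsub>R\<^esub> (disc R a b))"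

text \<open>\<open>R[x,y,y\<^sup>-\<^sup>1]\<close> is presented as \<open>R[x][y][z]\<close> with \<open>yz = 1\<close>.\<close>

type_synonym 'r poly3 = "nat \<Rightarrow> nat \<Rightarrow> nat \<Rightarrow> 'r"

definition poly3_ring :: "('r, 'm) ring_scheme \<Rightarrow> (nat \<Rightarrow> nat \<Rightarrow> 'r, 'r poly3) up_ring"
  where "poly3_ring R = UP (UP (UP R))"

definition poly3_const :: "('r, 'm) ring_scheme \<Rightarrow> 'r \<Rightarrow> 'r poly3"
  where "poly3_const R r = monom (poly3_ring R) (monom (UP (UP R)) (monom (UP R) r 0) 0) 0"

definition poly3_x :: "('r, 'm) ring_scheme \<Rightarrow> 'r poly3"
  where "poly3_x R = monom (poly3_ring R) (monom (UP (UP R)) (monom (UP R) \<one>\<^bsub>R\<^esub> 1) 0) 0"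

definition poly3_y :: "('r, 'm) ring_scheme \<Rightarrow> 'r poly3"
  where "poly3_y R = monom (poly3_ring R) (monom (UP (UP R)) \<one>\<^bsub>UP R\<^esub> 1) 0"

definition poly3_z :: "('r, 'm) ring_scheme \<Rightarrow> 'r poly3"
  where "poly3_z R = monom (poly3_ring R) \<one>\<^bsub>UP (UP R)\<^esub> 1"

definition curve_ideal :: "('r, 'm) ring_scheme \<Rightarrow> 'r \<Rightarrow> 'r \<Rightarrow> 'r poly3 set"
  where "curve_ideal R a b =
    (let P = poly3_ring R; x = poly3_x R; y = poly3_y R; z = poly3_z R in
      Idl\<^bsub>P\<^esub> {y [^]\<^bsub>P\<^esub> (2::nat) \<ominus>\<^bsub>P\<^esub>
               (x [^]\<^bsub>P\<^esub> (3::nat) \<oplus>\<^bsub>P\<^esub> poly3_const R a \<otimes>\<^bsub>P\<^esub> x \<oplus>\<^bsub>P\<^esub> poly3_const R b),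
              y \<otimes>\<^bsub>P\<^esub> z \<ominus>\<^bsub>P\<^esub> \<one>\<^bsub>P\<^esub>})"

definition curve_ring :: "('r, 'm) ring_scheme \<Rightarrow> 'r \<Rightarrow> 'r \<Rightarrow> 'r poly3 set ring"
  where "curve_ring R a b = poly3_ring R Quot curve_ideal R a b"

definition curve_class :: "('r, 'm) ring_scheme \<Rightarrow> 'r \<Rightarrow> 'r \<Rightarrow> 'r poly3 \<Rightarrow> 'r poly3 set"
  where "curve_class R a b f = curve_ideal R a b +>\<^bsub>poly3_ring R\<^esub> f"

definition curve_scalar :: "('r, 'm) ring_scheme \<Rightarrow> 'r \<Rightarrow> 'r \<Rightarrow> 'r \<Rightarrow> 'r poly3 set"
  where "curve_scalar R a b r = curve_class R a b (poly3_const R r)"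

definition curve_completion ::
  "nat \<Rightarrow> ('r, 'm) ring_scheme \<Rightarrow> 'r \<Rightarrow> 'r \<Rightarrow> (nat \<Rightarrow> 'r poly3 set set) ring"
  where "curve_completion p R a b = padic_completion p (curve_ring R a b)"

definition completion_scalar ::
  "nat \<Rightarrow> ('r, 'm) ring_scheme \<Rightarrow> 'r \<Rightarrow> 'r \<Rightarrow> 'r \<Rightarrow> nat \<Rightarrow> 'r poly3 set set"
  where "completion_scalar p R a b r = padic_embed p (curve_ring R a b) (curve_scalar R a b r)"

definition curve_frobenius_lift ::
  "nat \<Rightarrow> ('r, 'm) ring_scheme \<Rightarrow> ('r \<Rightarrow> 'r) \<Rightarrow> 'r \<Rightarrow> 'r \<Rightarrow>
   ((nat \<Rightarrow> 'r poly3 set set) \<Rightarrow> (nat \<Rightarrow> 'r poly3 set set)) \<Rightarrow> bool"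
  where "curve_frobenius_lift p R \<phi>\<^sub>R a b \<phi> \<longleftrightarrow>
    frobenius_lift p (curve_completion p R a b) \<phi> \<and>
    (\<forall>r\<in>carrier R. \<phi> (completion_scalar p R a b r) = completion_scalar p R a b (\<phi>\<^sub>R r))"

definition curve_omega ::
  "nat \<Rightarrow> ('r, 'm) ring_scheme \<Rightarrow> 'r \<Rightarrow> 'r \<Rightarrow>
   (nat \<Rightarrow> 'r poly3 set set, nat \<Rightarrow> ('r poly3 set set \<Rightarrow> 'r poly3 set set) set) module"
  where "curve_omega p R a b = omega_completed p R (curve_scalar R a b) (curve_ring R a b)"

text \<open>The form \<open>dx/y\<close>.\<close>

definition invariant_form ::
  "nat \<Rightarrow> ('r, 'm) ring_scheme \<Rightarrow> 'r \<Rightarrow> 'r \<Rightarrow>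
   nat \<Rightarrow> ('r poly3 set set \<Rightarrow> 'r poly3 set set) set"
  where "invariant_form p R a b =
    (let A = curve_ring R a b; \<iota> = curve_scalar R a b;
         x = padic_embed p A (curve_class R a b (poly3_x R));
         yinv = padic_embed p A (curve_class R a b (poly3_z R))
     in (\<lambda>n. yinv n \<odot>\<^bsub>omega_level p R \<iota> A n\<^esub>
               kaehler_d (padic_quot p R n) (padic_structure p \<iota> A n) (padic_quot p A n) (x n)))"

text \<open>Below, \<open>\<eta>\<close> is \<open>(1/p) \<phi>\<^sup>* (dx/y)\<close>. It is unique: the completed differentials are free
  of rank one over the completed coordinate ring, hence without p-torsion.\<close>

definition lie_invariant_eigen ::
  "nat \<Rightarrow> ('r, 'm) ring_scheme \<Rightarrow> 'r \<Rightarrow> 'r \<Rightarrow>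
   ((nat \<Rightarrow> 'r poly3 set set) \<Rightarrow> (nat \<Rightarrow> 'r poly3 set set)) \<Rightarrow> nat \<Rightarrow> 'r \<Rightarrow> bool"
  where "lie_invariant_eigen p R a b \<phi> m lam \<longleftrightarrow>
    (let \<Omega> = curve_omega p R a b; \<omega> = invariant_form p R a b in
      \<exists>\<eta>\<in>carrier \<Omega>.
        add_pow \<Omega> p \<eta> = omega_pullback p R (curve_scalar R a b) (curve_ring R a b) \<phi> \<omega> \<and>
        (\<exists>\<theta>\<in>carrier \<Omega>.
          \<eta> = completion_scalar p R a b lam \<odot>\<^bsub>\<Omega>\<^esub> \<omega> \<oplus>\<^bsub>\<Omega>\<^esub> add_pow \<Omega> (p ^ m) \<theta>))"

definition lie_invariant ::
  "nat \<Rightarrow> ('r, 'm) ring_scheme \<Rightarrow> 'r \<Rightarrow> 'r \<Rightarrow>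
   ((nat \<Rightarrow> 'r poly3 set set) \<Rightarrow> (nat \<Rightarrow> 'r poly3 set set)) \<Rightarrow> nat \<Rightarrow> bool"
  where "lie_invariant p R a b \<phi> m \<longleftrightarrow>
    (\<exists>lam\<in>carrier R. lie_invariant_eigen p R a b \<phi> m lam)"

end

theory Submission
  imports Defs "HOL-Computational_Algebra.Polynomial"
begin

text \<open>
  A Frobenius lift is determined by \<open>\<phi>(x) = x\<^sup>p + p u\<close>, since \<open>\<phi>(y)\<close> is the square root of
  \<open>f\<^sup>\<phi>(\<phi>(x))\<close> congruent to \<open>y\<^sup>p\<close>. Let \<open>H\<close> be the coefficient of \<open>x\<^sup>p\<^sup>-\<^sup>1\<close> in \<open>f\<^sup>(\<^sup>p\<^sup>-\<^sup>1\<^sup>)\<^sup>/\<^sup>2\<close> and assume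
  that it is a unit. Put \<open>u = u\<^sub>0 + v\<^sup>p + p u\<^sub>1\<close>, where \<open>u\<^sub>0\<close> is the polynomial with
  \<open>du\<^sub>0 = (H\<^sup>-\<^sup>1 f\<^sup>(\<^sup>p\<^sup>-\<^sup>1\<^sup>)\<^sup>/\<^sup>2 - x\<^sup>p\<^sup>-\<^sup>1) dx\<close>; this solves the equation modulo \<open>p\<close>. Modulo \<open>p\<^sup>2\<close> there remains
  an equation for \<open>du\<^sub>1\<close> modulo \<open>p\<close>, solvable if the Cartier image of its right hand side vanishes.
  That condition reads \<open>d(v/y) = (c f + Q) dx/y\<^sup>3\<close> with a polynomial \<open>Q\<close> of degree at most 3 and a
  constant \<open>c\<close> that can be prescribed through the eigenvalue. By degree reasons
  \<open>(c f + Q) f\<^sup>(\<^sup>p\<^sup>-\<^sup>3\<^sup>)\<^sup>/\<^sup>2\<close> has an antiderivative as soon as its coefficient at \<open>x\<^sup>p\<^sup>-\<^sup>1\<close> vanishes, and \<open>c\<close> is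
  chosen so that it does. Finally \<open>H\<close> vanishes modulo \<open>p\<close> only for finitely many \<open>j\<close>: up to a
  monomial factor it is a form in \<open>4a\<^sup>3\<close> and \<open>27b\<^sup>2\<close>, and if \<open>p\<close> is \<open>1\<close> modulo \<open>4\<close> or modulo \<open>3\<close> then one
  of its extreme coefficients is a binomial coefficient prime to \<open>p\<close>.
\<close>


section \<open>Divided Frobenius defect\<close>

text \<open>Write f^\<phi>(\<phi>(x)) = f^p (1 + p G). Since d(x^p + p u) = p (x^(p-1) dx + du) and
  \<phi>(y) = y^p (1 + p G)^(1/2), Lie invariance modulo p^2 reads x^(p-1) + u' = lam y^(p-1) (1 + p
  G/2), where du = u' dx. Modulo p a form is exact if and only if its Cartier image vanishes. At
  first order this forces lam H = 1. At second order v^p is what moves the obstruction: d(v^p)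
  vanishes modulo p but contributes p v^(p-1) dv, whose Cartier image is dv. The same v enters G
  through f'(x)^p v^p; this yields the linear term v f'/(2f), hence the derivative of v/y.
  Integrating a form of low degree costs one linear condition, at x^(p-1), and the second digit of
  lam meets it because H is a unit. The square root exists only after completion, so the lift is
  built on each A/p^n and glued. Differentials are handled through the relation dg = g' dx, required
  at all levels at once, and the algebra takes place in a type that maps onto the ring, where
  polynomials and ring normalisation are at hand.\<close>

definition frob_defect :: "nat \<Rightarrow> 'a::comm_ring_1 \<Rightarrow> 'a \<Rightarrow> 'a"
  where "frob_defect p x y = (\<Sum>k\<in>{1..<p}. of_nat ((p choose k) div p) * x ^ k * y ^ (p - k))"

lemma sum_binomial_middle:
  fixes g :: "nat \<Rightarrow> 'a::comm_ring_1"
  assumes "0 < p"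
  shows "(\<Sum>k\<le>p. g k) = g 0 + (\<Sum>k\<in>{1..<p}. g k) + g p"
proof -
  have "{..p} = insert 0 (insert p {1..<p})"
    using assms by auto
  then show ?thesis
    using assms by (simp add: add_ac)
qed

lemma frob_defect:
  fixes x y :: "'a::comm_ring_1"
  assumes "Factorial_Ring.prime p"
  shows "(x + y) ^ p = x ^ p + y ^ p + of_nat p * frob_defect p x y"
proof -
  have "p > 0"
    using assms by (simp add: prime_gt_0_nat)
  have "of_nat p * frob_defect p x y = (\<Sum>k\<in>{1..<p}. of_nat (p choose k) * x ^ k * y ^ (p - k))"
    unfolding frob_defect_def sum_distrib_left
  proof (intro sum.cong refl)
    fix k assume "k \<in> {1..<p}"
    then have "p dvd (p choose k)"
      using assms \<open>p > 0\<close> by (intro dvd_choose_prime) auto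
    then have "of_nat (p choose k) = (of_nat p * of_nat ((p choose k) div p) :: 'a)"
      by (metis dvd_mult_div_cancel of_nat_mult)
    then show "of_nat p * (of_nat ((p choose k) div p) * x ^ k * y ^ (p - k))
      = of_nat (p choose k) * x ^ k * y ^ (p - k)"
      by (simp add: mult.assoc)
  qed
  then show ?thesis
    using \<open>p > 0\<close> unfolding binomial_ring
    by (subst sum_binomial_middle) simp_all
qed

text \<open>Absorption for binomial coefficients with the factor p cancelled over the naturals: p
  may be a zero divisor in the target ring, so the division has to precede the coercion. These are
  the coefficients in the derivative of \<open>frob_defect\<close>.\<close>

lemma choose_div_prime_mult:
  assumes "Factorial_Ring.prime p" "0 < k" "k < p"
  shows "((p choose k) div p) * k = (p - 1) choose (k - 1)"
    and "((p choose k) div p) * (p - k) = (p - 1) choose k"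
proof -
  have "p > 0" using assms by simp
  have "p dvd (p choose k)"
    using assms by (intro dvd_choose_prime) auto
  then obtain c where c: "(p choose k) = p * c"
    by (elim dvdE)
  have "k * (p choose k) = p * ((p - 1) choose (k - 1))"
    using assms binomial_absorption[of "k - 1" "p"] by simp
  then show "((p choose k) div p) * k = (p - 1) choose (k - 1)"
    using \<open>p > 0\<close> unfolding c by (simp add: mult.commute mult.left_commute)
  have "(p - k) * (p choose k) = p * ((p - 1) choose k)"
    by (intro binomial_absorb_comp)
  then show "((p choose k) div p) * (p - k) = (p - 1) choose k"
    using \<open>p > 0\<close> unfolding c by (simp add: mult.commute mult.left_commute)
qed

section \<open>Solving the Lie invariance equation modulo p squared\<close>

text \<open>The curve ring is presented as a type in which the elements of \<open>I\<close> count as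
  zero. \<open>C\<close> stands for the constants, \<xi>, \<eta>, \<zeta> for x, y, 1/y, and
  \<open>der g g'\<close> for dg = g' dx. \<open>C_inverse\<close> and \<open>C_root\<close> say
  that integers prime to p are units and that the residue field of the constants is perfect.
  \<open>half\<close> is an inverse of 2 and lets y be treated as a square root of the
  cubic.\<close>

locale frobenius_setup =
  fixes p :: nat and I C :: "'a::comm_ring_1 set" and der :: "'a \<Rightarrow> 'a \<Rightarrow> bool"
    and \<xi> \<eta> \<zeta> a b half :: 'a
  assumes p_prime: "Factorial_Ring.prime p" and p_ge: "p \<ge> 5"
    and I_zero: "0 \<in> I"
    and I_add: "\<And>x y. x \<in> I \<Longrightarrow> y \<in> I \<Longrightarrow> x + y \<in> I"
    and I_mult: "\<And>x t. x \<in> I \<Longrightarrow> t * x \<in> I"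
    and C_one: "1 \<in> C"
    and C_add: "\<And>x y. x \<in> C \<Longrightarrow> y \<in> C \<Longrightarrow> x + y \<in> C"
    and C_mult: "\<And>x y. x \<in> C \<Longrightarrow> y \<in> C \<Longrightarrow> x * y \<in> C"
    and C_uminus: "\<And>x. x \<in> C \<Longrightarrow> - x \<in> C"
    and C_inverse: "\<And>n. \<not> p dvd n \<Longrightarrow> \<exists>r\<in>C. of_nat n * r - 1 \<in> I"
    and C_root: "\<And>c. c \<in> C \<Longrightarrow> \<exists>r\<in>C. \<exists>t. c - r ^ p - of_nat p * t \<in> I"
    and der_add: "\<And>g h g' h'. der g g' \<Longrightarrow> der h h' \<Longrightarrow> der (g + h) (g' + h')"
    and der_mult: "\<And>g h g' h'. der g g' \<Longrightarrow> der h h' \<Longrightarrow> der (g * h) (g * h' + h * g')"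
    and der_const: "\<And>c. c \<in> C \<Longrightarrow> der c 0"
    and der_xi: "der \<xi> 1"
    and der_cong: "\<And>g g' h'. der g g' \<Longrightarrow> g' - h' \<in> I \<Longrightarrow> der g h'"
    and der_ex: "\<And>g. \<exists>g'. der g g'"
    and a_C: "a \<in> C" and b_C: "b \<in> C" and half_C: "half \<in> C" and half: "2 * half - 1 \<in> I"
    and eta_zeta: "\<eta> * \<zeta> - 1 \<in> I"
    and eta_sq: "\<eta> ^ 2 - (\<xi> ^ 3 + a * \<xi> + b) \<in> I"
    and der_zeta: "der \<zeta> (- (half * \<zeta> ^ 3 * (3 * \<xi> ^ 2 + a)))"
begin

section \<open>Congruences modulo \<open>I\<close> and powers of p\<close>

definition cg :: "nat \<Rightarrow> 'a \<Rightarrow> 'a \<Rightarrow> bool"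
  where "cg n x y \<longleftrightarrow> (\<exists>t. x - y - of_nat p ^ n * t \<in> I)"

lemma p_pos: "p > 0"
  using p_ge by simp

lemma p_odd: "odd p"
  using p_prime p_ge prime_odd_nat by simp

lemma cg_refl [simp, intro]: "cg n x x"
  unfolding cg_def by (rule exI[of _ 0]) (simp add: I_zero)

lemma I_uminus: "x \<in> I \<Longrightarrow> - x \<in> I"
  using I_mult[of x "- 1"] by simp

lemma cg_I: "x - y \<in> I \<Longrightarrow> cg n x y"
  unfolding cg_def by (rule exI[of _ 0]) simp

lemma cg_pI: "x = y + of_nat p ^ n * t \<Longrightarrow> cg n x y"
  unfolding cg_def by (rule exI[of _ t]) (simp add: I_zero)

lemma cg_add: "cg n x y \<Longrightarrow> cg n x' y' \<Longrightarrow> cg n (x + x') (y + y')"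
  unfolding cg_def
proof (elim exE)
  fix t t' assume "x - y - of_nat p ^ n * t \<in> I" "x' - y' - of_nat p ^ n * t' \<in> I"
  from I_add[OF this] show "\<exists>t. x + x' - (y + y') - of_nat p ^ n * t \<in> I"
    by (intro exI[of _ "t + t'"]) (simp add: algebra_simps)
qed

lemma cg_scale: "cg n x y \<Longrightarrow> cg n (c * x) (c * y)"
  unfolding cg_def
proof (elim exE)
  fix t assume "x - y - of_nat p ^ n * t \<in> I"
  from I_mult[OF this, of c] show "\<exists>t. c * x - c * y - of_nat p ^ n * t \<in> I"
    by (intro exI[of _ "c * t"]) (simp add: algebra_simps)
qed

lemma cg_uminus: "cg n x y \<Longrightarrow> cg n (- x) (- y)"
  using cg_scale[of n x y "- 1"] by simp

lemma cg_sym: "cg n x y \<Longrightarrow> cg n y x"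
  using cg_add[OF cg_uminus, of n x y "x + y" "x + y"] by simp

lemma cg_trans [trans]: "cg n x y \<Longrightarrow> cg n y z \<Longrightarrow> cg n x z"
  using cg_add[of n x y "y" z] cg_add[of n "x + y" "y + z" "- y" "- y"] by simp

lemma cg_diff: "cg n x y \<Longrightarrow> cg n x' y' \<Longrightarrow> cg n (x - x') (y - y')"
  using cg_add[OF _ cg_uminus, of n x y x' y'] by simp

lemma cg_mult: "cg n x y \<Longrightarrow> cg n x' y' \<Longrightarrow> cg n (x * x') (y * y')"
  using cg_scale[of n x' y' x] cg_scale[of n x y y'] by (metis cg_trans mult.commute)

lemma cg_power: "cg n x y \<Longrightarrow> cg n (x ^ k) (y ^ k)"
  by (induction k) (auto intro: cg_mult)

lemma cg_times_p: "cg n x y \<Longrightarrow> cg (Suc n) (of_nat p * x) (of_nat p * y)"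
  unfolding cg_def
proof (elim exE)
  fix t assume "x - y - of_nat p ^ n * t \<in> I"
  from I_mult[OF this, of "of_nat p"]
  show "\<exists>t. of_nat p * x - of_nat p * y - of_nat p ^ Suc n * t \<in> I"
    by (intro exI[of _ t]) (simp add: algebra_simps)
qed

lemma cg_le: "cg n x y \<Longrightarrow> k \<le> n \<Longrightarrow> cg k x y"
  unfolding cg_def
proof (elim exE)
  fix t assume k: "k \<le> n" and "x - y - of_nat p ^ n * t \<in> I"
  then have "x - y - of_nat p ^ k * (of_nat p ^ (n - k) * t) \<in> I"
    by (metis le_add_diff_inverse mult.assoc power_add)
  then show "\<exists>t. x - y - of_nat p ^ k * t \<in> I" ..
qed

lemma cg_frob_add: "cg 1 ((x + y) ^ p) (x ^ p + y ^ p)"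
  by (rule cg_pI[where t = "frob_defect p x y"]) (simp add: frob_defect[OF p_prime])

section \<open>Constants and rules of differentiation\<close>

lemma C_zero: "0 \<in> C"
  using C_add[OF C_one C_uminus[OF C_one]] by simp

lemma C_of_nat: "of_nat n \<in> C"
  by (induction n) (auto intro: C_add C_one C_zero)

lemma C_diff: "x \<in> C \<Longrightarrow> y \<in> C \<Longrightarrow> x - y \<in> C"
  using C_add[of x "- y"] C_uminus by simp

lemma C_power: "x \<in> C \<Longrightarrow> x ^ n \<in> C"
  by (induction n) (auto intro: C_mult C_one)

lemma C_sum: "(\<And>i. i \<in> S \<Longrightarrow> g i \<in> C) \<Longrightarrow> sum g S \<in> C"
  by (induction S rule: infinite_finite_induct) (auto intro: C_add C_zero)

lemma der_scale: "c \<in> C \<Longrightarrow> der g g' \<Longrightarrow> der (c * g) (c * g')"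
  using der_mult[OF der_const, of c g g'] by simp

lemma der_of_nat: "der g g' \<Longrightarrow> der (of_nat n * g) (of_nat n * g')"
  using der_scale[OF C_of_nat] by simp

lemma der_sum: "(\<And>i. i \<in> S \<Longrightarrow> der (g i) (g' i)) \<Longrightarrow> der (sum g S) (sum g' S)"
  by (induction S rule: infinite_finite_induct) (auto intro: der_add der_const C_zero)

lemma der_power: "der g g' \<Longrightarrow> der (g ^ n) (of_nat n * g ^ (n - 1) * g')"
proof (induction n)
  case (Suc n)
  from der_mult[OF Suc.prems Suc.IH[OF Suc.prems]]
  have "der (g * g ^ n) (g * (of_nat n * g ^ (n - 1) * g') + g ^ n * g')" .
  moreover have "g * (of_nat n * g ^ (n - 1) * g') + g ^ n * g' = of_nat (Suc n) * g ^ n * g'"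
    by (cases n) (simp_all add: algebra_simps)
  ultimately show ?case by simp
qed (auto intro: der_const C_one)

text \<open>Formally d((x + y)^p - x^p - y^p) divided by p; the division is done term by term
  because p cannot be cancelled. It makes v^(p-1) dv additive in v up to an exact form.\<close>

lemma der_frob_defect:
  assumes x: "der x x'" and y: "der y y'"
  shows "der (frob_defect p x y)
    ((x + y) ^ (p - 1) * (x' + y') - x ^ (p - 1) * x' - y ^ (p - 1) * y')"
proof -
  define c where "c k = (p choose k) div p" for k
  define E where "E k = x ^ k * (of_nat (p - k) * y ^ (p - k - 1) * y')
    + y ^ (p - k) * (of_nat k * x ^ (k - 1) * x')" for k
  have "der (of_nat (c k) * (x ^ k * y ^ (p - k))) (of_nat (c k) * E k)" for k
    unfolding E_def by (intro der_of_nat der_mult der_power x y)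
  then have D: "der (frob_defect p x y) (\<Sum>k\<in>{1..<p}. of_nat (c k) * E k)"
    unfolding frob_defect_def c_def mult.assoc by (intro der_sum)
  have "(\<Sum>k\<in>{1..<p}. of_nat (c k) * E k)
    = (\<Sum>k\<in>{1..<p}. of_nat ((p - 1) choose k) * x ^ k * y ^ (p - 1 - k) * y'
       + of_nat ((p - 1) choose (k - 1)) * x ^ (k - 1) * y ^ (p - k) * x')"
  proof (intro sum.cong refl)
    fix k assume "k \<in> {1..<p}"
    then have k: "0 < k" "k < p" by auto
    have "of_nat (c k) * of_nat k = (of_nat ((p - 1) choose (k - 1)) :: 'a)"
      "of_nat (c k) * of_nat (p - k) = (of_nat ((p - 1) choose k) :: 'a)"
      using choose_div_prime_mult[OF p_prime k] unfolding c_def by (metis of_nat_mult)+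
    moreover have "of_nat (c k) * E k = of_nat (c k) * of_nat (p - k) * x ^ k * y ^ (p - 1 - k) * y'
      + of_nat (c k) * of_nat k * x ^ (k - 1) * y ^ (p - k) * x'"
      unfolding E_def by (simp add: algebra_simps)
    ultimately show "of_nat (c k) * E k = of_nat ((p - 1) choose k) * x ^ k * y ^ (p - 1 - k) * y'
       + of_nat ((p - 1) choose (k - 1)) * x ^ (k - 1) * y ^ (p - k) * x'"
      by metis
  qed
  also have "\<dots> = (\<Sum>k\<in>{1..<p}. of_nat ((p - 1) choose k) * x ^ k * y ^ (p - 1 - k)) * y'
     + (\<Sum>k\<in>{1..<p}. of_nat ((p - 1) choose (k - 1)) * x ^ (k - 1) * y ^ (p - k)) * x'"
    by (simp add: sum.distrib sum_distrib_right)
  also have "(\<Sum>k\<in>{1..<p}. of_nat ((p - 1) choose k) * x ^ k * y ^ (p - 1 - k))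
    = (x + y) ^ (p - 1) - y ^ (p - 1)"
  proof -
    have "{..p - 1} = insert 0 {1..<p}" using p_pos by auto
    then show ?thesis by (simp add: binomial_ring)
  qed
  \<comment> \<open>After the shift the range ends at p - 2, so the missing term is the top one,
    x^(p-1); the sum before lacks the bottom one, y^(p-1).\<close>
  also have "(\<Sum>k\<in>{1..<p}. of_nat ((p - 1) choose (k - 1)) * x ^ (k - 1) * y ^ (p - k))
    = (\<Sum>k\<in>{0..<p - 1}. of_nat ((p - 1) choose k) * x ^ k * y ^ (p - 1 - k))"
    by (rule sum.reindex_bij_witness[of _ "\<lambda>k. k + 1" "\<lambda>k. k - 1"]) auto
  also have "\<dots> = (x + y) ^ (p - 1) - x ^ (p - 1)"
  proof -
    have "{..p - 1} = insert (p - 1) {0..<p - 1}" by auto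
    then show ?thesis by (simp add: binomial_ring)
  qed
  finally have "(\<Sum>k\<in>{1..<p}. of_nat (c k) * E k)
    = (x + y) ^ (p - 1) * (x' + y') - x ^ (p - 1) * x' - y ^ (p - 1) * y'"
    by (simp add: algebra_simps)
  with D show ?thesis by simp
qed

text \<open>Congruence modulo \<open>p\<close> and exact differentials, i.e. equality of Cartier images.\<close>

definition sim :: "'a \<Rightarrow> 'a \<Rightarrow> bool"
  where "sim g h \<longleftrightarrow> (\<exists>s s'. der s s' \<and> cg 1 g (h + s'))"

lemma sim_cg: "cg 1 g h \<Longrightarrow> sim g h"
  unfolding sim_def using der_const[OF C_zero] by (metis add.right_neutral)

lemma sim_refl [simp, intro]: "sim g g"
  by (simp add: sim_cg)

lemma sim_der: "der s s' \<Longrightarrow> sim (h + s') h"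
  unfolding sim_def by blast

lemma sim_add: "sim g h \<Longrightarrow> sim g' h' \<Longrightarrow> sim (g + g') (h + h')"
  unfolding sim_def
proof (elim exE conjE)
  fix s s' t t' assume "der s s'" "cg 1 g (h + s')" "der t t'" "cg 1 g' (h' + t')"
  then have "der (s + t) (s' + t')" "cg 1 (g + g') (h + s' + (h' + t'))"
    by (auto intro: der_add cg_add)
  then show "\<exists>s s'. der s s' \<and> cg 1 (g + g') (h + h' + s')"
    by (metis add.assoc add.left_commute)
qed

lemma sim_scale: "c \<in> C \<Longrightarrow> sim g h \<Longrightarrow> sim (c * g) (c * h)"
  unfolding sim_def
proof (elim exE conjE)
  fix s s' assume "c \<in> C" "der s s'" "cg 1 g (h + s')"
  then have "der (c * s) (c * s')" "cg 1 (c * g) (c * (h + s'))"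
    by (auto intro: der_scale cg_scale)
  then show "\<exists>s s'. der s s' \<and> cg 1 (c * g) (c * h + s')"
    by (metis distrib_left)
qed

lemma sim_uminus: "sim g h \<Longrightarrow> sim (- g) (- h)"
  using sim_scale[OF C_uminus[OF C_one]] by simp

lemma sim_sym: "sim g h \<Longrightarrow> sim h g"
  using sim_add[OF sim_uminus, of g h "g + h" "g + h"] by simp

lemma sim_trans [trans]: "sim g h \<Longrightarrow> sim h k \<Longrightarrow> sim g k"
  using sim_add[of g h h k] sim_add[of "g + h" "h + k" "- h" "- h"] by simp

lemma sim_cg_trans [trans]: "sim g h \<Longrightarrow> cg 1 h k \<Longrightarrow> sim g k"
  using sim_cg sim_trans by blast

lemma cg_sim_trans [trans]: "cg 1 g h \<Longrightarrow> sim h k \<Longrightarrow> sim g k"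
  using sim_cg sim_trans by blast

text \<open>Modulo p a p-th power behaves as a constant: d(q^p s) = q^p ds + p s q^(p-1) dq. This is
  the semilinearity of the Cartier operator, expressed on exact forms.\<close>

lemma sim_frob_scale:
  assumes "sim g h"
  shows "sim (q ^ p * g) (q ^ p * h)"
proof -
  from assms obtain s s' where s: "der s s'" and g: "cg 1 g (h + s')"
    unfolding sim_def by blast
  obtain q' where "der q q'" using der_ex by blast
  from der_mult[OF der_power[OF this, of p] s]
  have d: "der (q ^ p * s) (q ^ p * s' + s * (of_nat p * q ^ (p - 1) * q'))" .
  have "cg 1 (q ^ p * g) (q ^ p * (h + s'))"
    using g by (rule cg_scale)
  also have "cg 1 \<dots> (q ^ p * h + (q ^ p * s' + s * (of_nat p * q ^ (p - 1) * q')))"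
    by (rule cg_pI[where t = "- (s * q ^ (p - 1) * q')"]) (simp add: algebra_simps)
  finally show ?thesis
    using d unfolding sim_def by blast
qed

subsection \<open>Differentials of p-th powers\<close>

text \<open>Cartier's identity for v: the image of v^(p-1) dv is dv. The form x^(p-1) g^p dx serves
  as the standard representative of the Cartier image g dx, so that the operator itself never has to
  be defined.\<close>

definition frob_compatible :: "'a \<Rightarrow> 'a \<Rightarrow> bool"
  where "frob_compatible v v' \<longleftrightarrow> der v v' \<and> sim (v ^ (p - 1) * v') (\<xi> ^ (p - 1) * v' ^ p)"

lemma frob_compatible_const: "c \<in> C \<Longrightarrow> frob_compatible c 0"
  unfolding frob_compatible_def using p_pos by (simp add: der_const zero_power)

lemma frob_compatible_xi: "frob_compatible \<xi> 1"
  unfolding frob_compatible_def by (simp add: der_xi)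

text \<open>The cross terms of (v + w)^(p-1) d(v + w) are the differential of
  \<open>frob_defect p v w\<close>, hence exact.\<close>

lemma frob_compatible_add:
  assumes "frob_compatible v v'" "frob_compatible w w'"
  shows "frob_compatible (v + w) (v' + w')"
proof -
  have d: "der v v'" "der w w'"
    using assms unfolding frob_compatible_def by auto
  have "(v + w) ^ (p - 1) * (v' + w') = v ^ (p - 1) * v' + w ^ (p - 1) * w'
    + ((v + w) ^ (p - 1) * (v' + w') - v ^ (p - 1) * v' - w ^ (p - 1) * w')"
    by simp
  then have "sim ((v + w) ^ (p - 1) * (v' + w')) (v ^ (p - 1) * v' + w ^ (p - 1) * w')"
    using sim_der[OF der_frob_defect[OF d]] by metis
  also have "sim \<dots> (\<xi> ^ (p - 1) * v' ^ p + \<xi> ^ (p - 1) * w' ^ p)"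
    using assms unfolding frob_compatible_def by (intro sim_add) auto
  also have "\<dots> = \<xi> ^ (p - 1) * (v' ^ p + w' ^ p)"
    by (simp add: algebra_simps)
  also have "cg 1 \<dots> (\<xi> ^ (p - 1) * (v' + w') ^ p)"
    by (intro cg_scale cg_sym[OF cg_frob_add])
  finally show ?thesis
    unfolding frob_compatible_def using d by (auto intro: der_add)
qed

lemma power_split_p: "x * x ^ (p - 1) = (x :: 'a) ^ p"
  using power_minus_mult[OF p_pos, of x] by (simp only: mult.commute)

text \<open>Leibniz splits (v w)^(p-1) d(v w) into v^p times w^(p-1) dw and w^p times v^(p-1) dv,
  and p-th powers pass through \<open>sim\<close>.\<close>

lemma frob_compatible_mult:
  assumes "frob_compatible v v'" "frob_compatible w w'"
  shows "frob_compatible (v * w) (v * w' + w * v')"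
proof -
  have d: "der v v'" "der w w'"
    using assms unfolding frob_compatible_def by auto
  have "(v * w) ^ (p - 1) * (v * w' + w * v')
      = (v * v ^ (p - 1)) * (w ^ (p - 1) * w') + (w * w ^ (p - 1)) * (v ^ (p - 1) * v')"
    by (simp add: algebra_simps power_mult_distrib)
  also have "\<dots> = v ^ p * (w ^ (p - 1) * w') + w ^ p * (v ^ (p - 1) * v')"
    by (simp only: power_split_p)
  also have "sim \<dots> (v ^ p * (\<xi> ^ (p - 1) * w' ^ p) + w ^ p * (\<xi> ^ (p - 1) * v' ^ p))"
    using assms unfolding frob_compatible_def by (intro sim_add sim_frob_scale) auto
  also have "\<dots> = \<xi> ^ (p - 1) * ((v * w') ^ p + (w * v') ^ p)"
    by (simp add: algebra_simps power_mult_distrib)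
  also have "cg 1 \<dots> (\<xi> ^ (p - 1) * (v * w' + w * v') ^ p)"
    by (intro cg_scale cg_sym[OF cg_frob_add])
  finally show ?thesis
    unfolding frob_compatible_def using d by (auto intro: der_mult)
qed

lemma frob_compatible_power:
  assumes "frob_compatible v v'"
  shows "frob_compatible (v ^ n) (of_nat n * v ^ (n - 1) * v')"
proof (induction n)
  case (Suc n)
  from frob_compatible_mult[OF assms Suc]
  have "frob_compatible (v * v ^ n) (v * (of_nat n * v ^ (n - 1) * v') + v ^ n * v')" .
  moreover have "v * (of_nat n * v ^ (n - 1) * v') + v ^ n * v' = of_nat (Suc n) * v ^ n * v'"
    by (cases n) (simp_all add: algebra_simps)
  ultimately show ?case by simp
qed (auto intro: frob_compatible_const C_one)

lemma frob_compatible_cong: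
  assumes "frob_compatible v v'" "v' - w' \<in> I"
  shows "frob_compatible v w'"
proof -
  have c: "cg 1 v' w'"
    using assms(2) by (rule cg_I)
  have "cg 1 (v ^ (p - 1) * w') (v ^ (p - 1) * v')"
    by (intro cg_scale cg_sym[OF c])
  also have "sim \<dots> (\<xi> ^ (p - 1) * v' ^ p)"
    using assms unfolding frob_compatible_def by blast
  also have "cg 1 \<dots> (\<xi> ^ (p - 1) * w' ^ p)"
    by (intro cg_scale cg_power c)
  finally show ?thesis
    using assms der_cong unfolding frob_compatible_def by blast
qed

lemma frob_compatible_sum:
  "(\<And>i. i \<in> S \<Longrightarrow> frob_compatible (g i) (g' i)) \<Longrightarrow> frob_compatible (sum g S) (sum g' S)"
  by (induction S rule: infinite_finite_induct)
    (auto intro: frob_compatible_add frob_compatible_const C_zero)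

text \<open>The integer n satisfies n^p = n modulo p by induction, and its inverse r inherits this.
  It is what lets \<open>half\<close> be moved under a p-th power.\<close>

lemma fermat_const:
  assumes "of_nat n * r - 1 \<in> I"
  shows "cg 1 (r ^ p) r"
proof -
  have n: "cg 1 (of_nat n ^ p) (of_nat n)"
  proof (induction n)
    case 0
    then show ?case using p_pos by (simp add: zero_power)
  next
    case (Suc n)
    from cg_frob_add[of 1 "of_nat n"] cg_add[OF cg_refl[of 1 1] Suc] show ?case
      using cg_trans by simp
  qed
  have nr: "cg 1 (of_nat n * r) 1"
    using assms by (rule cg_I)
  have "cg 1 (r ^ p) (of_nat n * r * r ^ p)"
    using cg_mult[OF cg_sym[OF nr] cg_refl[of 1 "r ^ p"]] by simp
  also have "\<dots> = of_nat n * r ^ p * r" by (simp add: algebra_simps)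
  also have "cg 1 \<dots> (of_nat n ^ p * r ^ p * r)"
    by (intro cg_mult cg_refl cg_sym[OF n])
  also have "of_nat n ^ p * r ^ p * r = (of_nat n * r) ^ p * r"
    by (simp add: power_mult_distrib)
  also have "cg 1 \<dots> (1 ^ p * r)"
    by (intro cg_mult cg_refl cg_power nr)
  finally show ?thesis by simp
qed

subsection \<open>Polynomials with constant coefficients\<close>

definition cpoly :: "'a poly \<Rightarrow> bool"
  where "cpoly q \<longleftrightarrow> (\<forall>i. poly.coeff q i \<in> C)"

lemma cpoly_add: "cpoly q \<Longrightarrow> cpoly r \<Longrightarrow> cpoly (q + r)"
  by (simp add: cpoly_def C_add)

lemma cpoly_diff: "cpoly q \<Longrightarrow> cpoly r \<Longrightarrow> cpoly (q - r)"
  by (simp add: cpoly_def C_diff)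

lemma cpoly_mult: "cpoly q \<Longrightarrow> cpoly r \<Longrightarrow> cpoly (q * r)"
  by (simp add: cpoly_def coeff_mult C_sum C_mult)

lemma cpoly_smult: "c \<in> C \<Longrightarrow> cpoly q \<Longrightarrow> cpoly (Polynomial.smult c q)"
  by (simp add: cpoly_def C_mult)

lemma cpoly_monom: "c \<in> C \<Longrightarrow> cpoly (Polynomial.monom c n)"
  by (simp add: cpoly_def C_zero)

lemma cpoly_zero: "cpoly 0"
  by (simp add: cpoly_def C_zero)

lemma cpoly_pCons: "c \<in> C \<Longrightarrow> cpoly q \<Longrightarrow> cpoly (pCons c q)"
  by (simp add: cpoly_def coeff_pCons split: nat.split)

lemma cpoly_one: "cpoly 1"
  using cpoly_monom[OF C_one, of 0] by simp

lemma cpoly_power: "cpoly q \<Longrightarrow> cpoly (q ^ n)"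
  by (induction n) (auto intro: cpoly_mult cpoly_one)

lemma cpoly_sum: "(\<And>i. i \<in> S \<Longrightarrow> cpoly (g i)) \<Longrightarrow> cpoly (sum g S)"
  by (induction S rule: infinite_finite_induct) (auto intro: cpoly_add cpoly_zero)

lemma cpoly_of_nat: "cpoly (of_nat n)"
  by (induction n) (auto intro: cpoly_add cpoly_one cpoly_zero)

lemma poly_eq_sum_le:
  assumes "Polynomial.degree q \<le> N"
  shows "poly q x = (\<Sum>i\<le>N. poly.coeff q i * (x :: 'a) ^ i)"
  unfolding poly_altdef using assms
  by (intro sum.mono_neutral_left) (auto intro: le_degree)

text \<open>Termwise integration. Exponents i + 1 stay below 2p, so the only one divisible by p is i
  + 1 = p, and that term is zero by assumption. The other denominators are invertible, hence the
  antiderivative is exact modulo \<open>I\<close> and not merely modulo p. Being a polynomial in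
  \<xi> with constant coefficients, it satisfies Cartier's identity.\<close>

lemma antiderivative:
  assumes q: "cpoly q" "Polynomial.degree q \<le> N" "N + 1 < 2 * p"
    and z: "poly.coeff q (p - 1) \<in> I"
  shows "\<exists>K. cpoly K \<and> Polynomial.degree K \<le> N + 1 \<and> frob_compatible (poly K \<xi>) (poly q \<xi>)"
proof -
  have "\<exists>k\<in>C. frob_compatible (k * \<xi> ^ (i + 1)) (poly.coeff q i * \<xi> ^ i)" if "i \<le> N" for i
  proof (cases "i = p - 1")
    case True
    have "frob_compatible 0 (poly.coeff q i * \<xi> ^ i)"
      using frob_compatible_cong[OF frob_compatible_const[OF C_zero]]
        I_uminus[OF I_mult[OF z, of "\<xi> ^ i"]] True by (simp add: mult.commute)
    then show ?thesis
      using C_zero by (intro bexI[of _ 0]) auto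
  next
    case False
    have "\<not> p dvd i + 1"
    proof
      assume "p dvd i + 1"
      then obtain k where k: "i + 1 = p * k" by (elim dvdE)
      have "p * k < p * 2" using k that q(3) by linarith
      then have "k < 2" by (simp only: mult_less_cancel1)
      moreover have "k \<noteq> 0" using k by (cases k) auto
      ultimately have "k = 1" by simp
      then show False using k False by simp
    qed
    then obtain r where r: "r \<in> C" "of_nat (i + 1) * r - 1 \<in> I"
      using C_inverse by blast
    define k where "k = poly.coeff q i * r"
    have kC: "k \<in> C"
      using q(1) r(1) unfolding k_def cpoly_def by (auto intro: C_mult)
    have "frob_compatible (k * \<xi> ^ (i + 1))
      (k * (of_nat (i + 1) * \<xi> ^ (i + 1 - 1) * 1) + \<xi> ^ (i + 1) * 0)"
      by (intro frob_compatible_mult frob_compatible_const kC frob_compatible_power frob_compatible_xi)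
    moreover have "k * (of_nat (i + 1) * \<xi> ^ (i + 1 - 1) * 1) + \<xi> ^ (i + 1) * 0
      - poly.coeff q i * \<xi> ^ i
      = poly.coeff q i * \<xi> ^ i * (of_nat (i + 1) * r - 1)"
      unfolding k_def by (simp add: algebra_simps)
    ultimately show ?thesis
      using kC I_mult[OF r(2)] frob_compatible_cong by metis
  qed
  then obtain k where k: "\<And>i. i \<le> N \<Longrightarrow> k i \<in> C"
    "\<And>i. i \<le> N \<Longrightarrow> frob_compatible (k i * \<xi> ^ (i + 1)) (poly.coeff q i * \<xi> ^ i)"
    by metis
  define K where "K = (\<Sum>i\<le>N. Polynomial.monom (k i) (i + 1))"
  have "cpoly K"
    unfolding K_def using k by (intro cpoly_sum cpoly_monom) auto
  moreover have "Polynomial.degree K \<le> N + 1"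
    unfolding K_def
  proof (rule degree_sum_le)
    fix i assume "i \<in> {..N}"
    then show "Polynomial.degree (Polynomial.monom (k i) (i + 1)) \<le> N + 1"
      using degree_monom_le[of "k i" "i + 1"] by simp
  qed simp
  moreover have "poly K \<xi> = (\<Sum>i\<le>N. k i * \<xi> ^ (i + 1))"
    unfolding K_def by (simp add: poly_sum poly_monom)
  moreover have "frob_compatible (\<Sum>i\<le>N. k i * \<xi> ^ (i + 1)) (poly q \<xi>)"
    unfolding poly_eq_sum_le[OF q(2)] using k by (intro frob_compatible_sum) auto
  ultimately show ?thesis by metis
qed

text \<open>Computes the Cartier image of a polynomial form. A term x^i with i + 1 prime to p is
  exact; for i = p - 1 + j p the term gives x^j times a p-th root of its coefficient. The degree
  bound says p (j + 1) < (k + 2) p, that is j \<le> k.\<close>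

lemma cartier_reduction:
  assumes q: "cpoly q" "Polynomial.degree q + 1 < (k + 2) * p"
  shows "\<exists>Q. cpoly Q \<and> Polynomial.degree Q \<le> k \<and> sim (poly q \<xi>) (\<xi> ^ (p - 1) * poly Q \<xi> ^ p)"
proof -
  let ?P = "\<lambda>g. \<exists>Q. cpoly Q \<and> Polynomial.degree Q \<le> k \<and> sim g (\<xi> ^ (p - 1) * poly Q \<xi> ^ p)"
  have zero: "?P g" if "sim g 0" for g
    using that p_pos by (intro exI[of _ 0]) (auto simp: zero_power intro: cpoly_zero)
  have add: "?P (g + h)" if "?P g" "?P h" for g h
  proof -
    from that obtain Q S where Q: "cpoly Q" "Polynomial.degree Q \<le> k"
        "sim g (\<xi> ^ (p - 1) * poly Q \<xi> ^ p)"
      and S: "cpoly S" "Polynomial.degree S \<le> k" "sim h (\<xi> ^ (p - 1) * poly S \<xi> ^ p)"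
      by blast
    have "sim (g + h) (\<xi> ^ (p - 1) * poly Q \<xi> ^ p + \<xi> ^ (p - 1) * poly S \<xi> ^ p)"
      using Q S by (intro sim_add)
    also have "\<dots> = \<xi> ^ (p - 1) * (poly Q \<xi> ^ p + poly S \<xi> ^ p)"
      by (simp add: algebra_simps)
    also have "cg 1 \<dots> (\<xi> ^ (p - 1) * (poly Q \<xi> + poly S \<xi>) ^ p)"
      by (intro cg_scale cg_sym[OF cg_frob_add])
    finally show ?thesis
      using Q S by (intro exI[of _ "Q + S"]) (auto intro: cpoly_add degree_add_le)
  qed
  have mon: "?P (poly.coeff q i * \<xi> ^ i)" if "i \<le> Polynomial.degree q" for i
  proof (cases "p dvd i + 1")
    case False
    then obtain r where r: "r \<in> C" "of_nat (i + 1) * r - 1 \<in> I"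
      using C_inverse by blast
    have qi: "poly.coeff q i * r \<in> C"
      using q(1) r(1) unfolding cpoly_def by (auto intro: C_mult)
    have "der (poly.coeff q i * r * \<xi> ^ (i + 1))
      (poly.coeff q i * r * (of_nat (i + 1) * \<xi> ^ (i + 1 - 1) * 1))"
      by (intro der_scale qi der_power der_xi)
    moreover have "poly.coeff q i * r * (of_nat (i + 1) * \<xi> ^ (i + 1 - 1) * 1)
      - poly.coeff q i * \<xi> ^ i
      = poly.coeff q i * \<xi> ^ i * (of_nat (i + 1) * r - 1)"
      by (simp add: algebra_simps)
    ultimately have "der (poly.coeff q i * r * \<xi> ^ (i + 1)) (poly.coeff q i * \<xi> ^ i)"
      using I_mult[OF r(2)] der_cong by metis
    from sim_der[OF this, of 0] show ?thesis
      by (intro zero) simp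
  next
    case True
    then obtain j' where j': "i + 1 = p * j'" by (elim dvdE)
    then obtain j where j: "j' = Suc j" by (cases j') auto
    have "p * j' < p * (k + 2)"
      using j' that q(2) by (simp add: mult.commute)
    then have "j' < k + 2" by (simp only: mult_less_cancel1)
    then have "j \<le> k" using j by simp
    have ij: "i = (p - 1) + j * p"
      using j' j p_pos by (simp add: algebra_simps)
    \<comment> \<open>Perfectness of the residue field enters here: the coefficient is a p-th power
      modulo p.\<close>
    obtain r where r: "r \<in> C" "cg 1 (poly.coeff q i) (r ^ p)"
      using C_root q(1) unfolding cpoly_def cg_def power_one_right by metis
    have "cg 1 (poly.coeff q i * \<xi> ^ i) (r ^ p * \<xi> ^ i)"
      by (intro cg_mult r cg_refl)
    also have "r ^ p * \<xi> ^ i = \<xi> ^ (p - 1) * poly (Polynomial.monom r j) \<xi> ^ p"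
      unfolding ij by (simp add: poly_monom power_add power_mult power_mult_distrib)
    finally have "sim (poly.coeff q i * \<xi> ^ i)
        (\<xi> ^ (p - 1) * poly (Polynomial.monom r j) \<xi> ^ p)"
      by (rule sim_cg)
    moreover have "Polynomial.degree (Polynomial.monom r j) \<le> k"
      using \<open>j \<le> k\<close> degree_monom_le order.trans by blast
    ultimately show ?thesis
      using cpoly_monom[OF r(1)] by blast
  qed
  have "?P (\<Sum>i\<in>S. poly.coeff q i * \<xi> ^ i)" if "finite S" "S \<subseteq> {..Polynomial.degree q}" for S
    using that
  proof (induction S)
    case empty
    show ?case
      using zero[of 0] by simp
  next
    case (insert i S)
    then have "?P (poly.coeff q i * \<xi> ^ i + (\<Sum>i\<in>S. poly.coeff q i * \<xi> ^ i))"
      by (intro add mon) auto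
    with insert show ?case
      by simp
  qed
  from this[of "{..Polynomial.degree q}"] show ?thesis
    unfolding poly_altdef by simp
qed

lemma cpoly_frob_defect: "cpoly q \<Longrightarrow> cpoly r \<Longrightarrow> cpoly (frob_defect p q r)"
  unfolding frob_defect_def by (intro cpoly_sum cpoly_mult cpoly_of_nat cpoly_power)

lemma degree_frob_defect_le:
  assumes "Polynomial.degree q \<le> d" "Polynomial.degree r \<le> d"
  shows "Polynomial.degree (frob_defect p q r :: 'a poly) \<le> d * p"
  unfolding frob_defect_def
proof (rule degree_sum_le)
  fix k assume k: "k \<in> {1..<p}"
  have "Polynomial.degree (of_nat ((p choose k) div p) * q ^ k * r ^ (p - k))
    \<le> Polynomial.degree (of_nat ((p choose k) div p) :: 'a poly) + Polynomial.degree (q ^ k)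
      + Polynomial.degree (r ^ (p - k))"
    by (rule order.trans[OF degree_mult_le]) (intro add_right_mono degree_mult_le)
  also have "\<dots> \<le> 0 + d * k + d * (p - k)"
  proof (intro add_mono)
    show "Polynomial.degree (q ^ k) \<le> d * k"
      using assms(1) by (meson degree_power_le mult_le_mono1 order.trans)
    show "Polynomial.degree (r ^ (p - k)) \<le> d * (p - k)"
      using assms(2) by (meson degree_power_le mult_le_mono1 order.trans)
  qed simp
  also have "\<dots> = d * (k + (p - k))"
    by (simp add: distrib_left)
  also have "\<dots> = d * p"
    using k by simp
  finally show "Polynomial.degree (of_nat ((p choose k) div p) * q ^ k * r ^ (p - k)) \<le> d * p" .
qed simp

lemma poly_frob_defect: "poly (frob_defect p q r) x = frob_defect p (poly q x) (poly r x)"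
  unfolding frob_defect_def by (simp add: poly_sum)

end

section \<open>The first and second order equations on the curve\<close>

context frobenius_setup
begin

definition f :: 'a
  where "f = \<xi> ^ 3 + a * \<xi> + b"

definition f' :: 'a
  where "f' = 3 * \<xi> ^ 2 + a"

definition f_poly :: "'a poly"
  where "f_poly = [:b, a, 0, 1:]"

lemma poly_f_poly: "poly f_poly \<xi> = f"
  by (simp add: f_poly_def f_def algebra_simps power3_eq_cube)

lemma cpoly_f_poly: "cpoly f_poly"
  unfolding f_poly_def by (intro cpoly_pCons cpoly_zero a_C b_C C_zero C_one)

lemma degree_f_poly_power: "Polynomial.degree (f_poly ^ n) \<le> 3 * n"
proof -
  have "Polynomial.degree f_poly = 3"
    by (simp add: f_poly_def)
  then show ?thesis
    using degree_power_le[of f_poly n] by simp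
qed

lemma I_power_diff: "x - y \<in> I \<Longrightarrow> x ^ n - y ^ n \<in> I"
proof (induction n)
  case (Suc n)
  have "x ^ Suc n - y ^ Suc n = x * (x ^ n - y ^ n) + y ^ n * (x - y)"
    by (simp add: algebra_simps)
  with Suc show ?case
    by (metis I_add I_mult)
qed (simp add: I_zero)

lemma f_zeta: "f * \<zeta> ^ 2 - 1 \<in> I"
proof -
  have "f * \<zeta> ^ 2 - 1 = - (\<zeta> ^ 2) * (\<eta> ^ 2 - f) + (\<eta> * \<zeta> + 1) * (\<eta> * \<zeta> - 1)"
    by (simp add: algebra_simps power2_eq_square)
  then show ?thesis
    using I_add[OF I_mult[OF eta_sq, of "- (\<zeta> ^ 2)"] I_mult[OF eta_zeta, of "\<eta> * \<zeta> + 1"]]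
    unfolding f_def by simp
qed

lemma frob_compatible_f: "frob_compatible f f'"
proof -
  have "frob_compatible (\<xi> ^ 3 + a * \<xi> + b) ((of_nat 3 * \<xi> ^ (3 - 1) * 1) + (a * 1 + \<xi> * 0) + 0)"
    by (intro frob_compatible_add frob_compatible_mult frob_compatible_power frob_compatible_const
        frob_compatible_xi a_C b_C)
  then show ?thesis
    unfolding f_def f'_def by simp
qed

lemma half_pow: "cg 1 (half ^ p) half"
  by (rule fermat_const[of 2]) (simp add: half)

lemma minus_pow_p: "(- x) ^ p = - (x ^ p :: 'a)"
  using p_odd by (rule power_minus_odd)

text \<open>Transfers Cartier's identity from f to its inverse square root. Inserting (f
  \<zeta>^2)^(p-1), which is 1, turns \<zeta>^(p-1) d\<zeta> into a constant times (\<zeta>^3)^p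
  f^(p-1) df, and the p-th power can be pulled out.\<close>

lemma frob_compatible_zeta: "frob_compatible \<zeta> (- (half * \<zeta> ^ 3 * f'))"
proof -
  have "sim (f ^ (p - 1) * f') (\<xi> ^ (p - 1) * f' ^ p)"
    using frob_compatible_f unfolding frob_compatible_def by blast
  from sim_scale[OF C_uminus[OF half_C] sim_frob_scale[OF this, of "\<zeta> ^ 3"]]
  have 1: "sim (- half * ((\<zeta> ^ 3) ^ p * (f ^ (p - 1) * f')))
    (- half * ((\<zeta> ^ 3) ^ p * (\<xi> ^ (p - 1) * f' ^ p)))" .
  obtain k where k: "p = Suc k"
    using p_pos by (cases p) auto
  have e: "\<zeta> ^ (p - 1) * (- (half * \<zeta> ^ 3 * f')) * (f * \<zeta> ^ 2) ^ (p - 1)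
      = - half * ((\<zeta> ^ 3) ^ p * (f ^ (p - 1) * f'))"
    unfolding k by (simp add: algebra_simps power_mult_distrib power3_eq_cube power2_eq_square)
  have "cg 1 (\<zeta> ^ (p - 1) * (- (half * \<zeta> ^ 3 * f')) * (f * \<zeta> ^ 2) ^ (p - 1))
     (\<zeta> ^ (p - 1) * (- (half * \<zeta> ^ 3 * f')) * 1 ^ (p - 1))"
    by (intro cg_mult cg_refl cg_power cg_I[OF f_zeta])
  then have "cg 1 (\<zeta> ^ (p - 1) * (- (half * \<zeta> ^ 3 * f'))) (- half * ((\<zeta> ^ 3) ^ p * (f ^ (p - 1) * f')))"
    unfolding e by (simp add: cg_sym)
  also note 1
  also have "cg 1 (- half * ((\<zeta> ^ 3) ^ p * (\<xi> ^ (p - 1) * f' ^ p)))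
    (- (half ^ p) * ((\<zeta> ^ 3) ^ p * (\<xi> ^ (p - 1) * f' ^ p)))"
    by (intro cg_mult cg_refl cg_uminus cg_sym[OF half_pow])
  also have "- (half ^ p) * ((\<zeta> ^ 3) ^ p * (\<xi> ^ (p - 1) * f' ^ p))
    = \<xi> ^ (p - 1) * (- (half * \<zeta> ^ 3 * f')) ^ p"
    by (simp add: minus_pow_p power_mult_distrib algebra_simps)
  finally show ?thesis
    using der_zeta unfolding frob_compatible_def f'_def by blast
qed

definition m :: nat
  where "m = (p - 1) div 2"

lemma p_m: "p = 2 * m + 1"
  using p_odd unfolding m_def by (auto elim: oddE)

lemma m_ge: "m \<ge> 2"
  using p_ge p_m by simp

lemma cg2_times_p: "cg 1 x y \<Longrightarrow> cg 2 (of_nat p * x) (of_nat p * y)"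
  using cg_times_p[of 1 x y] by (simp add: numeral_2_eq_2)

text \<open>Here \<phi>(a) = a^p + p \<alpha> and \<phi>(b) = b^p + p \<beta>, so the first relation
  defines G by f^\<phi>(\<phi>(x)) = y^(2p) (1 + p G). Modulo p^2 the square root of 1 + p G is 1 +
  p \<open>half\<close> G, so the second relation is Lie invariance written without any square
  root.\<close>

lemma lie_solution:
  assumes lam0: "lam0 \<in> C" "lam0 * poly.coeff (f_poly ^ m) (p - 1) - 1 \<in> I"
    and \<alpha>: "\<alpha> \<in> C" and \<beta>: "\<beta> \<in> C"
  shows "\<exists>u u' G lam. lam \<in> C \<and> der u u' \<and>
    (\<xi> ^ p + of_nat p * u) ^ 3 + (a ^ p + of_nat p * \<alpha>) * (\<xi> ^ p + of_nat p * u) + (b ^ p + of_nat p * \<beta>)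
      - \<eta> ^ (2 * p) * (1 + of_nat p * G) \<in> I \<and>
    cg 2 (\<xi> ^ (p - 1) + u') (lam * \<eta> ^ (p - 1) * (1 + of_nat p * half * G))"
proof -
  let ?H = "poly.coeff (f_poly ^ m) (p - 1)"
  \<comment> \<open>The coefficient at p - 1 is \<open>lam0 * ?H - 1\<close>, an element of
    \<open>I\<close>; so the Hasse invariant being a unit is exactly what makes this
    integrable.\<close>
  let ?q0 = "Polynomial.smult lam0 (f_poly ^ m) - Polynomial.monom 1 (p - 1)"
  have "\<exists>K. cpoly K \<and> Polynomial.degree K \<le> 3 * m + 1 \<and> frob_compatible (poly K \<xi>) (poly ?q0 \<xi>)"
  proof (rule antiderivative)
    show "cpoly ?q0"
      by (intro cpoly_diff cpoly_smult cpoly_monom cpoly_power cpoly_f_poly lam0 C_one)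
    show "Polynomial.degree ?q0 \<le> 3 * m"
    proof (rule degree_diff_le)
      show "Polynomial.degree (Polynomial.smult lam0 (f_poly ^ m)) \<le> 3 * m"
        using degree_smult_le degree_f_poly_power order.trans by blast
      show "Polynomial.degree (Polynomial.monom (1::'a) (p - 1)) \<le> 3 * m"
        using p_m degree_monom_le[of "1::'a" "p - 1"] by simp
    qed
    show "3 * m + 1 < 2 * p"
      using p_m by simp
    show "poly.coeff ?q0 (p - 1) \<in> I"
      using lam0(2) by simp
  qed
  then obtain K0 where K0: "cpoly K0" "Polynomial.degree K0 \<le> 3 * m + 1"
    "frob_compatible (poly K0 \<xi>) (lam0 * f ^ m - \<xi> ^ (p - 1))"
    by (auto simp: poly_f_poly poly_monom)
  define u0 where "u0 = poly K0 \<xi>"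
  have der_u0: "der u0 (lam0 * f ^ m - \<xi> ^ (p - 1))"
    using K0 unfolding u0_def frob_compatible_def by blast
  from sim_der[OF this, of "\<xi> ^ (p - 1)"] have sim_fm: "sim (lam0 * f ^ m) (\<xi> ^ (p - 1))"
    by simp

  \<comment> \<open>\<delta> will be (f^\<phi>(x^p) - f^p) / p. The two defects come from raising f
    to the p-th power in two stages, first \<xi>^3 + (a \<xi> + b) and then a \<xi> + b.\<close>
  define dq where "dq = Polynomial.monom \<alpha> p + [:\<beta>:] - frob_defect p (Polynomial.monom 1 3) [:b, a:]
    - frob_defect p (Polynomial.monom a 1) [:b:]"
  have dq: "cpoly dq" "Polynomial.degree dq \<le> 3 * p"
  proof -
    show "cpoly dq"
      unfolding dq_def
      by (intro cpoly_add cpoly_diff cpoly_monom cpoly_pCons cpoly_frob_defect cpoly_zero \<alpha> \<beta> a_C b_C C_one)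
    have "Polynomial.degree (frob_defect p (Polynomial.monom 1 3) [:b, a:]) \<le> 3 * p"
      using degree_monom_le[of "1::'a" 3] by (intro degree_frob_defect_le) auto
    moreover have "Polynomial.degree (frob_defect p (Polynomial.monom a 1) [:b:]) \<le> 3 * p"
      using degree_monom_le[of "a" 1] by (intro degree_frob_defect_le) auto
    moreover have "Polynomial.degree (Polynomial.monom \<alpha> p) \<le> 3 * p"
      using degree_monom_le[of \<alpha> p] by simp
    ultimately show "Polynomial.degree dq \<le> 3 * p"
      unfolding dq_def by (intro degree_diff_le degree_add_le) auto
  qed
  define \<delta> where "\<delta> = poly dq \<xi>"
  have \<delta>: "(\<xi> ^ p) ^ 3 + (a ^ p + of_nat p * \<alpha>) * \<xi> ^ p + (b ^ p + of_nat p * \<beta>) = f ^ p + of_nat p * \<delta>"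
  proof -
    have "f ^ p = (\<xi> ^ 3) ^ p + (a * \<xi> + b) ^ p + of_nat p * frob_defect p (\<xi> ^ 3) (a * \<xi> + b)"
      unfolding f_def using frob_defect[OF p_prime, of "\<xi> ^ 3" "a * \<xi> + b"] by (simp add: add.assoc)
    moreover have "(a * \<xi> + b) ^ p = (a * \<xi>) ^ p + b ^ p + of_nat p * frob_defect p (a * \<xi>) b"
      by (rule frob_defect[OF p_prime])
    moreover have "\<delta> = \<alpha> * \<xi> ^ p + \<beta> - frob_defect p (\<xi> ^ 3) (a * \<xi> + b) - frob_defect p (a * \<xi>) b"
      unfolding \<delta>_def dq_def by (simp add: poly_frob_defect poly_monom algebra_simps)
    moreover have "(\<xi> ^ 3) ^ p = (\<xi> ^ p) ^ 3"
      by (simp flip: power_mult add: mult.commute)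
    ultimately show ?thesis
      by (simp only: power_mult_distrib) (simp add: algebra_simps)
  qed

  let ?pp = "[:a, 0, 3:]"
  have pp: "poly ?pp \<xi> = f'" "cpoly ?pp"
  proof -
    show "poly ?pp \<xi> = f'"
      by (simp add: f'_def algebra_simps power2_eq_square)
    have "(3::'a) \<in> C"
      using C_of_nat[of 3] by simp
    then show "cpoly ?pp"
      by (intro cpoly_pCons cpoly_zero a_C C_zero)
  qed
  \<comment> \<open>The part of the second order term that involves neither v nor the new digit of
    the eigenvalue. The factor (\<zeta>^2)^p is left out: it is a p-th power, and without it the
    form is polynomial in \<xi>.\<close>
  let ?qq = "Polynomial.smult (lam0 * half) ((dq + K0 * ?pp ^ p) * f_poly ^ m)"
  have "\<exists>Q. cpoly Q \<and> Polynomial.degree Q \<le> 3 \<and> sim (poly ?qq \<xi>) (\<xi> ^ (p - 1) * poly Q \<xi> ^ p)"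
  proof (rule cartier_reduction)
    show "cpoly ?qq"
      by (intro cpoly_smult cpoly_mult cpoly_add cpoly_power cpoly_f_poly C_mult lam0 half_C dq K0 pp)
    have "Polynomial.degree (?pp ^ p) \<le> 2 * p"
      by (rule order.trans[OF degree_power_le]) (auto intro: order.trans[OF degree_pCons_le])
    then have "Polynomial.degree (K0 * ?pp ^ p) \<le> (3 * m + 1) + 2 * p"
      using K0(2) by (intro order.trans[OF degree_mult_le] add_mono)
    then have "Polynomial.degree (dq + K0 * ?pp ^ p) \<le> (3 * m + 1) + 2 * p"
      using dq(2) p_m by (intro degree_add_le) auto
    then have "Polynomial.degree ((dq + K0 * ?pp ^ p) * f_poly ^ m) \<le> (3 * m + 1) + 2 * p + 3 * m"
      using degree_f_poly_power by (intro order.trans[OF degree_mult_le] add_mono)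
    then have "Polynomial.degree ?qq \<le> (3 * m + 1) + 2 * p + 3 * m"
      using degree_smult_le order.trans by blast
    \<comment> \<open>With p = 2m + 1 this is 10m + 4 < 10m + 5. The bound is tight, and it gives a
      polynomial Q of degree at most 3, the degree of f.\<close>
    then show "Polynomial.degree ?qq + 1 < (3 + 2) * p"
      using p_m by simp
  qed
  then obtain Q where Q: "cpoly Q" "Polynomial.degree Q \<le> 3"
    "sim (poly ?qq \<xi>) (\<xi> ^ (p - 1) * poly Q \<xi> ^ p)"
    by blast
  define Qv where "Qv = poly Q \<xi>"
  have sim_Q: "sim (lam0 * half * ((\<delta> + u0 * f' ^ p) * f ^ m)) (\<xi> ^ (p - 1) * Qv ^ p)"
    using Q(3) unfolding Qv_def \<delta>_def u0_def poly_smult poly_mult poly_add poly_power pp poly_f_poly .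

  \<comment> \<open>Solution of c \<open>?H\<close> + coefficient of
    \<open>Q * f_poly ^ (m - 1)\<close> at p - 1 equal to 0, with \<open>lam0\<close> as the inverse
    of \<open>?H\<close>.\<close>
  define c where "c = - lam0 * poly.coeff (Q * f_poly ^ (m - 1)) (p - 1)"
  have cC: "c \<in> C"
    using cpoly_mult[OF Q(1) cpoly_power[OF cpoly_f_poly]] lam0(1)
    unfolding c_def cpoly_def by (intro C_mult C_uminus) auto
  let ?h = "(Polynomial.smult c f_poly + Q) * f_poly ^ (m - 1)"
  have fm: "f_poly * f_poly ^ (m - 1) = f_poly ^ m"
    using m_ge power_minus_mult[of m f_poly] by (simp add: mult.commute)
  have "\<exists>K. cpoly K \<and> Polynomial.degree K \<le> 3 * m + 1 \<and> frob_compatible (poly K \<xi>) (poly ?h \<xi>)"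
  proof (rule antiderivative)
    show "cpoly ?h"
      by (intro cpoly_mult cpoly_add cpoly_smult cpoly_power cpoly_f_poly Q cC)
    have "Polynomial.degree (Polynomial.smult c f_poly + Q) \<le> 3"
      using degree_f_poly_power[of 1] Q(2) degree_smult_le[of c f_poly]
      by (intro degree_add_le) auto
    then have "Polynomial.degree ?h \<le> 3 + 3 * (m - 1)"
      using degree_f_poly_power by (intro order.trans[OF degree_mult_le] add_mono)
    then show "Polynomial.degree ?h \<le> 3 * m"
      using m_ge by simp
    show "3 * m + 1 < 2 * p"
      using p_m by simp
    have h: "?h = Polynomial.smult c (f_poly ^ m) + Q * f_poly ^ (m - 1)"
      by (simp only: distrib_right mult_smult_left fm)
    have "poly.coeff ?h (p - 1)
      = - poly.coeff (Q * f_poly ^ (m - 1)) (p - 1) * (lam0 * ?H - 1)"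
      unfolding h unfolding c_def by (simp add: algebra_simps)
    then show "poly.coeff ?h (p - 1) \<in> I"
      by (metis I_mult lam0(2))
  qed
  then obtain K where K: "frob_compatible (poly K \<xi>) (poly ?h \<xi>)"
    by blast
  define kv where "kv = poly K \<xi>"
  have fc_kv: "frob_compatible kv ((c * f + Qv) * f ^ (m - 1))"
    using K unfolding kv_def Qv_def by (simp add: poly_f_poly)

  \<comment> \<open>Modulo p the power y^p is constant for d, and v/y = kv / y^p. Hence d(v/y) =
    d(kv) / y^p = (c f + Qv) f^(m-1) / y^p dx, which is (c f + Qv) / y^3 dx because p = 2m +
    1.\<close>
  define v where "v = kv * \<zeta> ^ (p - 1)"
  define v' where "v' = kv * (of_nat (p - 1) * \<zeta> ^ (p - 1 - 1) * (- (half * \<zeta> ^ 3 * f')))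
    + \<zeta> ^ (p - 1) * ((c * f + Qv) * f ^ (m - 1))"
  have fc_v: "frob_compatible v v'"
    unfolding v_def v'_def
    by (intro frob_compatible_mult frob_compatible_power frob_compatible_zeta fc_kv)
  \<comment> \<open>Since p - 1 is -1 modulo p, the logarithmic derivative of \<zeta>^(p-1) becomes
    \<open>half * f' * \<zeta> ^ 2\<close>; in the other summand the factors f \<zeta>^2 reduce to
    1.\<close>
  have v'_cg: "cg 1 v' (c + half * (v * f' * \<zeta> ^ 2) + \<zeta> ^ 2 * Qv)"
  proof -
    have e1: "of_nat (p - 1) = (of_nat p - 1 :: 'a)"
      using p_pos by (simp add: of_nat_diff)
    have e2: "\<zeta> ^ (p - 1 - 1) * \<zeta> ^ 3 = \<zeta> ^ (p - 1) * \<zeta> ^ 2"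
      unfolding power_add[symmetric] using p_ge by simp
    have "kv * (of_nat (p - 1) * \<zeta> ^ (p - 1 - 1) * (- (half * \<zeta> ^ 3 * f')))
      = - (of_nat (p - 1) * kv * half * f' * (\<zeta> ^ (p - 1 - 1) * \<zeta> ^ 3))"
      by (simp add: algebra_simps)
    also have "\<dots> = half * (v * f' * \<zeta> ^ 2) + of_nat p ^ 1 * (- (half * (v * f' * \<zeta> ^ 2)))"
      unfolding v_def e1 e2 by (simp add: algebra_simps)
    finally have 1: "cg 1 (kv * (of_nat (p - 1) * \<zeta> ^ (p - 1 - 1) * (- (half * \<zeta> ^ 3 * f'))))
      (half * (v * f' * \<zeta> ^ 2))"
      by (rule cg_pI)
    have "p - 1 = 2 * (m - 1) + 2"
      using p_m m_ge by linarith
    then have "\<zeta> ^ (p - 1) = \<zeta> ^ (2 * (m - 1) + 2)"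
      by (rule arg_cong)
    also have "\<dots> = (\<zeta> ^ 2) ^ (m - 1) * \<zeta> ^ 2"
      by (simp only: power_add power_mult)
    finally have "\<zeta> ^ (p - 1) = (\<zeta> ^ 2) ^ (m - 1) * \<zeta> ^ 2" .
    then have "\<zeta> ^ (p - 1) * ((c * f + Qv) * f ^ (m - 1))
      = (f * \<zeta> ^ 2) ^ (m - 1) * (c * (f * \<zeta> ^ 2) + \<zeta> ^ 2 * Qv)"
      by (simp add: algebra_simps power_mult_distrib)
    also have "cg 1 \<dots> (1 ^ (m - 1) * (c * 1 + \<zeta> ^ 2 * Qv))"
      by (intro cg_mult cg_power cg_add cg_refl cg_I[OF f_zeta])
    finally have 2: "cg 1 (\<zeta> ^ (p - 1) * ((c * f + Qv) * f ^ (m - 1))) (c + \<zeta> ^ 2 * Qv)"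
      by simp
    show ?thesis
      using cg_add[OF 1 2] unfolding v'_def by (simp add: add_ac)
  qed

  \<comment> \<open>The p-th power compensates the semilinearity of the Cartier operator: lam1 f^m
    has Cartier image c because lam0 f^m has Cartier image 1.\<close>
  define lam1 where "lam1 = lam0 * c ^ p"
  \<comment> \<open>The coefficient of p in lam y^(p-1) (1 + p \<open>half\<close> G), with lam =
    lam0 + p lam1 and G reduced modulo p.\<close>
  define T where "T = lam1 * f ^ m + lam0 * half * (\<delta> + (u0 + v ^ p) * f' ^ p) * (\<zeta> ^ 2) ^ p * f ^ m"
  \<comment> \<open>T splits into three summands with Cartier images c,
    \<open>half * (v * f' * \<zeta> ^ 2)\<close> and \<open>\<zeta> ^ 2 * Qv\<close>. Their sum is
    v' modulo p, which is also the image of v^(p-1) dv; so the difference is exact and yields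
    u1.\<close>
  have "sim T (v ^ (p - 1) * v')"
  proof -
    have "T = c ^ p * (lam0 * f ^ m) + half * ((v * f' * \<zeta> ^ 2) ^ p * (lam0 * f ^ m))
      + (\<zeta> ^ 2) ^ p * (lam0 * half * ((\<delta> + u0 * f' ^ p) * f ^ m))"
      unfolding T_def lam1_def power_mult_distrib by (simp add: algebra_simps)
    also have "sim \<dots> (c ^ p * \<xi> ^ (p - 1) + half * ((v * f' * \<zeta> ^ 2) ^ p * \<xi> ^ (p - 1))
      + (\<zeta> ^ 2) ^ p * (\<xi> ^ (p - 1) * Qv ^ p))"
      by (intro sim_add sim_scale[OF half_C] sim_frob_scale sim_fm sim_Q)
    also have "\<dots> = \<xi> ^ (p - 1) * (c ^ p + half * (v * f' * \<zeta> ^ 2) ^ p + (\<zeta> ^ 2 * Qv) ^ p)"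
      by (simp add: algebra_simps power_mult_distrib)
    also have "cg 1 \<dots> (\<xi> ^ (p - 1) * v' ^ p)"
    proof (rule cg_scale)
      have "cg 1 (c ^ p + half * (v * f' * \<zeta> ^ 2) ^ p + (\<zeta> ^ 2 * Qv) ^ p)
        (c ^ p + half ^ p * (v * f' * \<zeta> ^ 2) ^ p + (\<zeta> ^ 2 * Qv) ^ p)"
        by (intro cg_add cg_mult cg_refl cg_sym[OF half_pow])
      also have "c ^ p + half ^ p * (v * f' * \<zeta> ^ 2) ^ p + (\<zeta> ^ 2 * Qv) ^ p
        = (c ^ p + (half * (v * f' * \<zeta> ^ 2)) ^ p) + (\<zeta> ^ 2 * Qv) ^ p"
        by (simp add: power_mult_distrib)
      also have "cg 1 \<dots> ((c + half * (v * f' * \<zeta> ^ 2)) ^ p + (\<zeta> ^ 2 * Qv) ^ p)"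
        by (intro cg_add cg_refl cg_sym[OF cg_frob_add])
      also have "cg 1 \<dots> ((c + half * (v * f' * \<zeta> ^ 2) + \<zeta> ^ 2 * Qv) ^ p)"
        by (rule cg_sym[OF cg_frob_add])
      also have "cg 1 \<dots> (v' ^ p)"
        by (intro cg_power cg_sym[OF v'_cg])
      finally show "cg 1 (c ^ p + half * (v * f' * \<zeta> ^ 2) ^ p + (\<zeta> ^ 2 * Qv) ^ p) (v' ^ p)" .
    qed
    also have "sim \<dots> (v ^ (p - 1) * v')"
      using fc_v unfolding frob_compatible_def by (blast intro: sim_sym)
    finally show ?thesis .
  qed
  then obtain u1 u1' where u1: "der u1 u1'" "cg 1 T (v ^ (p - 1) * v' + u1')"
    unfolding sim_def by blast

  define u where "u = u0 + v ^ p + of_nat p * u1"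
  define u' where "u' = lam0 * f ^ m - \<xi> ^ (p - 1) + of_nat p * v ^ (p - 1) * v' + of_nat p * u1'"
  have "der v v'"
    using fc_v unfolding frob_compatible_def by blast
  then have der_u: "der u u'"
    unfolding u_def u'_def by (intro der_add der_u0 der_power der_of_nat u1)
  have u'_cg: "cg 2 (\<xi> ^ (p - 1) + u') (lam0 * f ^ m + of_nat p * T)"
  proof -
    have "\<xi> ^ (p - 1) + u' = lam0 * f ^ m + of_nat p * (v ^ (p - 1) * v' + u1')"
      unfolding u'_def by (simp add: algebra_simps)
    then show ?thesis
      using cg_add[OF cg_refl[of 2 "lam0 * f ^ m"] cg2_times_p[OF cg_sym[OF u1(2)]]]
      by simp
  qed

  \<comment> \<open>The exact quotient (f^\<phi>(x^p + p u) - f^p) / p, expanded so that no division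
    by p occurs.\<close>
  define G0 where "G0 = \<delta> + 3 * (\<xi> ^ p) ^ 2 * u + 3 * of_nat p * \<xi> ^ p * u ^ 2 + of_nat p ^ 2 * u ^ 3
    + (a ^ p + of_nat p * \<alpha>) * u"
  define G where "G = G0 * (\<zeta> ^ 2) ^ p"
  have "(\<xi> ^ p + of_nat p * u) ^ 3 + (a ^ p + of_nat p * \<alpha>) * (\<xi> ^ p + of_nat p * u) + (b ^ p + of_nat p * \<beta>)
    = ((\<xi> ^ p) ^ 3 + (a ^ p + of_nat p * \<alpha>) * \<xi> ^ p + (b ^ p + of_nat p * \<beta>)) + of_nat p * (G0 - \<delta>)"
    unfolding G0_def by (simp add: algebra_simps power2_eq_square power3_eq_cube)
  also have "\<dots> = f ^ p + of_nat p * G0"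
    unfolding \<delta> by (simp add: algebra_simps)
  also have "\<dots> - \<eta> ^ (2 * p) * (1 + of_nat p * G)
    = of_nat p * G0 * (1 ^ (2 * p) - (\<eta> * \<zeta>) ^ (2 * p)) + (f ^ p - (\<eta> ^ 2) ^ p)"
    unfolding G_def power_mult power_mult_distrib by (simp add: algebra_simps)
  also have "\<dots> \<in> I"
  proof (intro I_add I_mult I_power_diff)
    show "1 - \<eta> * \<zeta> \<in> I"
      using I_uminus[OF eta_zeta] by simp
    show "f - \<eta> ^ 2 \<in> I"
      using I_uminus[OF eta_sq] by (simp add: f_def)
  qed
  finally have eqF: "(\<xi> ^ p + of_nat p * u) ^ 3 + (a ^ p + of_nat p * \<alpha>) * (\<xi> ^ p + of_nat p * u)
    + (b ^ p + of_nat p * \<beta>) - \<eta> ^ (2 * p) * (1 + of_nat p * G) \<in> I" .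

  \<comment> \<open>Modulo p the derivative of f^\<phi> at x^p is the p-th power of f'; this uses
    3^p = 3 modulo p.\<close>
  have f'_pow: "cg 1 (3 * (\<xi> ^ p) ^ 2 + a ^ p) (f' ^ p)"
  proof -
    have three: "cg 1 (3 ^ p) (3::'a)"
    proof -
      have "cg 1 ((2 + 1) ^ p) ((2::'a) ^ p + 1 ^ p)" "cg 1 ((1 + 1) ^ p) ((1::'a) ^ p + 1 ^ p)"
        by (rule cg_frob_add)+
      then have "cg 1 (3 ^ p) ((2::'a) ^ p + 1)" "cg 1 ((2::'a) ^ p) 2"
        by simp_all
      then show ?thesis
        using cg_trans cg_add[of 1 "2 ^ p" 2 1 1] by fastforce
    qed
    have "cg 1 (f' ^ p) ((3 * \<xi> ^ 2) ^ p + a ^ p)"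
      unfolding f'_def by (rule cg_frob_add)
    also have "(3 * \<xi> ^ 2) ^ p = 3 ^ p * (\<xi> ^ p) ^ 2"
      by (simp add: power_mult_distrib mult.commute flip: power_mult)
    also have "cg 1 (3 ^ p * (\<xi> ^ p) ^ 2 + a ^ p) (3 * (\<xi> ^ p) ^ 2 + a ^ p)"
      by (intro cg_add cg_mult cg_refl three)
    finally show ?thesis
      by (rule cg_sym)
  qed
  have G_cg: "cg 1 G ((\<delta> + (u0 + v ^ p) * f' ^ p) * (\<zeta> ^ 2) ^ p)"
  proof -
    have "G0 = \<delta> + u * (3 * (\<xi> ^ p) ^ 2 + a ^ p) + of_nat p ^ 1 *
      (3 * \<xi> ^ p * u ^ 2 + of_nat p * u ^ 3 + \<alpha> * u)"
      unfolding G0_def by (simp add: algebra_simps power2_eq_square)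
    then have "cg 1 G0 (\<delta> + u * (3 * (\<xi> ^ p) ^ 2 + a ^ p))"
      by (rule cg_pI)
    also have "cg 1 \<dots> (\<delta> + (u0 + v ^ p) * f' ^ p)"
    proof (intro cg_add cg_mult cg_refl f'_pow)
      show "cg 1 u (u0 + v ^ p)"
        unfolding u_def by (rule cg_pI[where t = u1]) simp
    qed
    finally show ?thesis
      unfolding G_def by (intro cg_mult cg_refl)
  qed

  define lam where "lam = lam0 + of_nat p * lam1"
  have lamC: "lam \<in> C"
    unfolding lam_def lam1_def by (intro C_add C_mult C_power C_of_nat lam0 cC)
  have "cg 2 (\<eta> ^ (p - 1)) (f ^ m)"
  proof (rule cg_I)
    have "p - 1 = 2 * m"
      using p_m by linarith
    then have "\<eta> ^ (p - 1) = (\<eta> ^ 2) ^ m"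
      by (simp only: power_mult)
    then show "\<eta> ^ (p - 1) - f ^ m \<in> I"
      using I_power_diff[OF eta_sq, of m] by (simp add: f_def)
  qed
  then have "cg 2 (lam * \<eta> ^ (p - 1) * (1 + of_nat p * half * G)) (lam * f ^ m * (1 + of_nat p * half * G))"
    by (intro cg_mult cg_refl)
  also have "cg 2 \<dots> (lam0 * f ^ m + of_nat p * (lam1 * f ^ m + lam0 * half * G * f ^ m))"
    unfolding lam_def
    by (rule cg_pI[where t = "lam1 * half * G * f ^ m"]) (simp add: algebra_simps power2_eq_square)
  also have "cg 2 \<dots> (lam0 * f ^ m + of_nat p * T)"
  proof -
    have "cg 1 (lam1 * f ^ m + lam0 * half * G * f ^ m)
      (lam1 * f ^ m + lam0 * half * ((\<delta> + (u0 + v ^ p) * f' ^ p) * (\<zeta> ^ 2) ^ p) * f ^ m)"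
      by (intro cg_add cg_mult cg_refl G_cg)
    also have "\<dots> = T"
      unfolding T_def by (simp add: mult.assoc)
    finally show ?thesis
      using cg_add[OF cg_refl[of 2 "lam0 * f ^ m"] cg2_times_p] by simp
  qed
  finally have "cg 2 (\<xi> ^ (p - 1) + u') (lam * \<eta> ^ (p - 1) * (1 + of_nat p * half * G))"
    using u'_cg cg_sym cg_trans by blast
  with lamC der_u eqF show ?thesis
    by blast
qed

section \<open>Hensel lifting of the images of y and 1/y\<close>

lemma cg_mult_pow: "cg n x y \<Longrightarrow> cg (n + k) (of_nat p ^ k * x) (of_nat p ^ k * y)"
  by (induction k) (auto dest: cg_times_p simp: mult.assoc)

text \<open>Newton iteration for (1 + p G)^(-1/2), kept as a coherent sequence of approximations
  since the limit lies only in the completion. The congruence to 1 modulo p selects the root for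
  which \<phi>(y) reduces to y^p.\<close>

lemma hensel_inverse_sqrt:
  "\<exists>r. \<forall>n. cg n (r n ^ 2 * (1 + of_nat p * G)) 1 \<and> cg 1 (r n) 1 \<and> cg n (r (Suc n)) (r n)"
proof -
  have cg0: "cg 0 x y" for x y
    by (rule cg_pI[where t = "x - y"]) simp
  have "\<exists>r. \<forall>n. (cg n (r n ^ 2 * (1 + of_nat p * G)) 1 \<and> cg 1 (r n) 1) \<and> cg n (r (Suc n)) (r n)"
  proof (rule dependent_nat_choice)
    show "\<exists>x. cg 0 (x ^ 2 * (1 + of_nat p * G)) 1 \<and> cg 1 x 1"
      using cg0 by blast
  next
    fix x :: 'a and n :: nat
    assume "cg n (x ^ 2 * (1 + of_nat p * G)) 1 \<and> cg 1 x 1"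
    then have x: "cg n (x ^ 2 * (1 + of_nat p * G)) 1" "cg 1 x 1" by auto
    show "\<exists>y. (cg (Suc n) (y ^ 2 * (1 + of_nat p * G)) 1 \<and> cg 1 y 1) \<and> cg n y x"
    proof (cases n)
      case 0
      have "cg 1 (1 ^ 2 * (1 + of_nat p * G)) 1"
        by (rule cg_pI[where t = G]) simp
      then show ?thesis
        using 0 cg0 by (intro exI[of _ 1]) auto
    next
      case (Suc l)
      from x(1) obtain k where k: "x ^ 2 * (1 + of_nat p * G) - 1 - of_nat p ^ n * k \<in> I"
        unfolding cg_def by blast
      \<comment> \<open>Modulo p the derivative of r^2 (1 + p G) at x is 2, so half the error is
        subtracted. The quadratic error p^(2n) is divisible by p^(n+1) only for positive n; this is
        why n = 0 is treated apart, restarting from 1.\<close>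
      define y where "y = x - of_nat p ^ n * (half * k)"
      have yx: "cg n y x"
        unfolding y_def by (rule cg_pI[where t = "- (half * k)"]) simp
      then have "cg 1 y 1"
        using x(2) cg_le[of n y x 1] cg_trans Suc by auto
      moreover have "cg (Suc n) (y ^ 2 * (1 + of_nat p * G)) 1"
      proof -
        have "y ^ 2 * (1 + of_nat p * G) = x ^ 2 * (1 + of_nat p * G)
          - of_nat p ^ n * (2 * half * k * (x * (1 + of_nat p * G)))
          + of_nat p ^ Suc n * (of_nat p ^ l * (half * k) ^ 2 * (1 + of_nat p * G))"
          unfolding y_def Suc by (simp add: power2_eq_square algebra_simps)
        then have "cg (Suc n) (y ^ 2 * (1 + of_nat p * G)) (x ^ 2 * (1 + of_nat p * G)
          - of_nat p ^ n * (2 * half * k * (x * (1 + of_nat p * G))))"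
          by (rule cg_pI)
        also have "cg (Suc n) \<dots> (1 + of_nat p ^ n * k - of_nat p ^ n * (1 * k * (1 * (1 + 0))))"
        proof (intro cg_diff)
          show "cg (Suc n) (x ^ 2 * (1 + of_nat p * G)) (1 + of_nat p ^ n * k)"
            using k by (intro cg_I) (simp add: algebra_simps)
          have "cg 1 (1 + of_nat p * G) (1 + 0)"
            by (rule cg_pI[where t = G]) simp
          then have "cg 1 (2 * half * k * (x * (1 + of_nat p * G))) (1 * k * (1 * (1 + 0)))"
            by (intro cg_mult cg_refl x(2) cg_I[OF half])
          from cg_mult_pow[OF this, of n]
          show "cg (Suc n) (of_nat p ^ n * (2 * half * k * (x * (1 + of_nat p * G))))
            (of_nat p ^ n * (1 * k * (1 * (1 + 0))))"
            by simp
        qed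
        finally show ?thesis by simp
      qed
      ultimately show ?thesis
        using yx by blast
    qed
  qed
  then show ?thesis by blast
qed

text \<open>\<open>s n\<close> and \<open>r n\<close> approximate \<phi>(y) and \<phi>(1/y) modulo
  p^n. The last congruence compares the coefficients of (1/p) \<phi>^*(dx/y) and lam dx/y with
  respect to dx.\<close>

lemma frobenius_lift_data:
  assumes lam0: "lam0 \<in> C" "lam0 * poly.coeff (f_poly ^ m) (p - 1) - 1 \<in> I"
    and \<alpha>: "\<alpha> \<in> C" and \<beta>: "\<beta> \<in> C"
  shows "\<exists>u u' lam s r. lam \<in> C \<and> der u u' \<and>
    (\<forall>n. cg n (s n ^ 2) ((\<xi> ^ p + of_nat p * u) ^ 3
      + (a ^ p + of_nat p * \<alpha>) * (\<xi> ^ p + of_nat p * u) + (b ^ p + of_nat p * \<beta>))) \<and>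
    (\<forall>n. cg n (s n * r n) 1) \<and>
    (\<forall>n. cg n (s (Suc n)) (s n)) \<and> (\<forall>n. cg n (r (Suc n)) (r n)) \<and>
    cg 1 (s 1) (\<eta> ^ p) \<and> cg 1 (r 1) (\<zeta> ^ p) \<and>
    cg 2 (r 2 * (\<xi> ^ (p - 1) + u')) (lam * \<zeta>)"
proof -
  from lie_solution[OF assms] obtain u u' G lam where u: "lam \<in> C" "der u u'"
    "(\<xi> ^ p + of_nat p * u) ^ 3 + (a ^ p + of_nat p * \<alpha>) * (\<xi> ^ p + of_nat p * u) + (b ^ p + of_nat p * \<beta>)
      - \<eta> ^ (2 * p) * (1 + of_nat p * G) \<in> I" (is "?F - _ \<in> _")
    "cg 2 (\<xi> ^ (p - 1) + u') (lam * \<eta> ^ (p - 1) * (1 + of_nat p * half * G))"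
    by blast
  from hensel_inverse_sqrt[of G] obtain r where r: "\<And>n. cg n (r n ^ 2 * (1 + of_nat p * G)) 1"
    "\<And>n. cg 1 (r n) 1" "\<And>n. cg n (r (Suc n)) (r n)" by blast
  \<comment> \<open>The square root is taken as (1 + p G) times the inverse square root, so that one
    sequence serves both \<phi>(y) and \<phi>(1/y).\<close>
  let ?s = "\<lambda>n. \<eta> ^ p * (r n * (1 + of_nat p * G))" and ?r = "\<lambda>n. \<zeta> ^ p * r n"
  have ez: "cg n (\<eta> * \<zeta>) 1" for n
    using eta_zeta by (rule cg_I)
  have "cg n (?s n ^ 2) ?F" for n
  proof -
    have "?s n ^ 2 = \<eta> ^ (2 * p) * (1 + of_nat p * G) * (r n ^ 2 * (1 + of_nat p * G))"
      by (simp add: algebra_simps power2_eq_square power_mult_distrib power_mult)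
    also have "cg n \<dots> (\<eta> ^ (2 * p) * (1 + of_nat p * G) * 1)"
      by (intro cg_scale r)
    also have "cg n \<dots> ?F"
      using u(3) by (intro cg_sym[OF cg_I]) simp
    finally show ?thesis .
  qed
  moreover have "cg n (?s n * ?r n) 1" for n
  proof -
    have "?s n * ?r n = (\<eta> * \<zeta>) ^ p * (r n ^ 2 * (1 + of_nat p * G))"
      by (simp add: algebra_simps power2_eq_square power_mult_distrib)
    also have "cg n \<dots> (1 ^ p * 1)"
      by (intro cg_mult cg_power ez r)
    finally show ?thesis by simp
  qed
  moreover have "cg n (?s (Suc n)) (?s n)" "cg n (?r (Suc n)) (?r n)" for n
    by (intro cg_mult cg_refl r)+
  moreover have "cg 1 (?s 1) (\<eta> ^ p)"
  proof -
    have "cg 1 (1 + of_nat p * G) 1"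
      by (rule cg_pI[where t = G]) simp
    then have "cg 1 (?s 1) (\<eta> ^ p * (1 * 1))"
      by (intro cg_mult cg_refl r)
    then show ?thesis by simp
  qed
  moreover have "cg 1 (?r 1) (\<zeta> ^ p)"
    using cg_scale[OF r(2)[of 1], of "\<zeta> ^ p"] by simp
  moreover have "cg 2 (?r 2 * (\<xi> ^ (p - 1) + u')) (lam * \<zeta>)"
  proof -
    \<comment> \<open>With r = 1 + p e everything is linear modulo p^2, and r (1 + p
      \<open>half\<close> G) equals 1 + \<open>half\<close> (r^2 (1 + p G) - 1).\<close>
    have r2: "cg 2 (r 2 * (1 + of_nat p * half * G)) 1"
    proof -
      from r(2)[of 2] obtain e where "r 2 - 1 - of_nat p * e \<in> I"
        unfolding cg_def by auto
      then have e: "cg 2 (r 2) (1 + of_nat p * e)"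
        by (intro cg_I) (simp add: algebra_simps)
      have "cg 2 (2 * half) 1"
        using half by (rule cg_I)
      have "cg 2 (r 2 * (1 + of_nat p * half * G)) ((1 + of_nat p * e) * (1 + of_nat p * half * G))"
        by (intro cg_mult cg_refl e)
      also have "cg 2 \<dots> (1 + of_nat p * e * 1 + of_nat p * half * G)"
        by (rule cg_pI[where t = "e * half * G"]) (simp add: algebra_simps power2_eq_square)
      also have "cg 2 \<dots> (1 + of_nat p * e * (2 * half) + of_nat p * half * G)"
        by (intro cg_add cg_mult cg_refl cg_sym[OF \<open>cg 2 (2 * half) 1\<close>])
      also have "\<dots> = 1 + half * ((1 + 2 * (of_nat p * e) + of_nat p * G) - 1)"
        by (simp add: algebra_simps)
      also have "cg 2 \<dots> (1 + half * (r 2 ^ 2 * (1 + of_nat p * G) - 1))"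
      proof (intro cg_add cg_mult cg_refl cg_diff)
        have "cg 2 (r 2 ^ 2 * (1 + of_nat p * G)) ((1 + of_nat p * e) ^ 2 * (1 + of_nat p * G))"
          by (intro cg_mult cg_power cg_refl e)
        also have "cg 2 \<dots> (1 + 2 * (of_nat p * e) + of_nat p * G)"
          by (rule cg_pI[where t = "e ^ 2 * (1 + of_nat p * G) + 2 * e * G"])
            (simp add: algebra_simps power2_eq_square)
        finally show "cg 2 (1 + 2 * (of_nat p * e) + of_nat p * G) (r 2 ^ 2 * (1 + of_nat p * G))"
          by (rule cg_sym)
      qed
      also have "cg 2 \<dots> (1 + half * (1 - 1))"
        by (intro cg_add cg_mult cg_refl cg_diff r)
      finally show ?thesis by simp
    qed
    have "cg 2 (?r 2 * (\<xi> ^ (p - 1) + u')) (?r 2 * (lam * \<eta> ^ (p - 1) * (1 + of_nat p * half * G)))"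
      by (intro cg_scale u)
    also have "\<dots> = lam * ((\<eta> * \<zeta>) ^ (p - 1) * \<zeta>) * (r 2 * (1 + of_nat p * half * G))"
      unfolding power_split_p[of \<zeta>, symmetric] by (simp add: algebra_simps power_mult_distrib)
    also have "cg 2 \<dots> (lam * (1 ^ (p - 1) * \<zeta>) * 1)"
      by (intro cg_mult cg_power cg_refl ez r2)
    finally show ?thesis by simp
  qed
  ultimately show ?thesis
    using u(1,2) by (intro exI[of _ u] exI[of _ u'] exI[of _ lam] exI[of _ ?s] exI[of _ ?r]) blast
qed

end

section \<open>A type mapping onto all commutative rings on a given type\<close>

text \<open>The product of all commutative rings carried by subsets of a type is an instance of
  \<open>comm_ring_1\<close> that projects onto each of them. The factor \<open>int\<close> makes it nontrivial.\<close>

typedef (overloaded) ('a, 'm) uring =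
  "{g :: int \<times> (('a, 'm) ring_scheme \<Rightarrow> 'a).
     \<forall>S. if cring S then snd g S \<in> carrier S else snd g S = undefined}"
proof (intro exI CollectI allI)
  fix S :: "('a, 'm) ring_scheme"
  show "if cring S then snd (0, \<lambda>S. if cring S then \<zero>\<^bsub>S\<^esub> else undefined) S \<in> carrier S
    else snd (0, \<lambda>S. if cring S then \<zero>\<^bsub>S\<^esub> else undefined) S = undefined"
    by (simp add: cring.cring_simprules(2))
qed

definition pr :: "('a, 'm) ring_scheme \<Rightarrow> ('a, 'm) uring \<Rightarrow> 'a"
  where "pr S g = snd (Rep_uring g) S"

definition mk_uring :: "int \<Rightarrow> (('a, 'm) ring_scheme \<Rightarrow> 'a) \<Rightarrow> ('a, 'm) uring"
  where "mk_uring k h = Abs_uring (k, \<lambda>S. if cring S then h S else undefined)"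

lemma pr_closed [simp, intro]: "cring S \<Longrightarrow> pr S g \<in> carrier S"
  using Rep_uring[of g] unfolding pr_def by (auto split: if_splits)

lemma Rep_mk_uring:
  assumes "\<And>S. cring S \<Longrightarrow> h S \<in> carrier S"
  shows "Rep_uring (mk_uring k h) = (k, \<lambda>S. if cring S then h S else undefined)"
  unfolding mk_uring_def using assms by (intro Abs_uring_inverse) auto

lemma pr_mk_uring:
  assumes "\<And>S. cring S \<Longrightarrow> h S \<in> carrier S" "cring S"
  shows "pr S (mk_uring k h) = h S"
  unfolding pr_def using assms(2) by (simp add: Rep_mk_uring[OF assms(1)])

lemma uring_eqI:
  assumes "fst (Rep_uring g) = fst (Rep_uring h)" "\<And>S. cring S \<Longrightarrow> pr S g = pr S h"
  shows "g = h"
proof -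
  have "snd (Rep_uring g) S = snd (Rep_uring h) S" for S
    using assms(2)[of S] Rep_uring[of g] Rep_uring[of h] unfolding pr_def
    by (cases "cring S") auto
  then show ?thesis
    using assms(1) by (metis Rep_uring_inject ext prod_eqI)
qed

instantiation uring :: (type, type) comm_ring_1
begin

definition zero_uring :: "('a, 'b) uring" where "0 = mk_uring 0 (\<lambda>S. \<zero>\<^bsub>S\<^esub>)"
definition one_uring :: "('a, 'b) uring" where "1 = mk_uring 1 (\<lambda>S. \<one>\<^bsub>S\<^esub>)"
definition plus_uring :: "('a, 'b) uring \<Rightarrow> ('a, 'b) uring \<Rightarrow> ('a, 'b) uring"
  where "g + h = mk_uring (fst (Rep_uring g) + fst (Rep_uring h)) (\<lambda>S. pr S g \<oplus>\<^bsub>S\<^esub> pr S h)"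
definition times_uring :: "('a, 'b) uring \<Rightarrow> ('a, 'b) uring \<Rightarrow> ('a, 'b) uring"
  where "g * h = mk_uring (fst (Rep_uring g) * fst (Rep_uring h)) (\<lambda>S. pr S g \<otimes>\<^bsub>S\<^esub> pr S h)"
definition uminus_uring :: "('a, 'b) uring \<Rightarrow> ('a, 'b) uring"
  where "- g = mk_uring (- fst (Rep_uring g)) (\<lambda>S. \<ominus>\<^bsub>S\<^esub> pr S g)"
definition minus_uring :: "('a, 'b) uring \<Rightarrow> ('a, 'b) uring \<Rightarrow> ('a, 'b) uring"
  where "g - h = g + (- h :: ('a, 'b) uring)"

lemma cring_closed:
  assumes "cring S"
  shows "\<zero>\<^bsub>S\<^esub> \<in> carrier S" "\<one>\<^bsub>S\<^esub> \<in> carrier S" "pr S g \<oplus>\<^bsub>S\<^esub> pr S h \<in> carrier S"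
    "pr S g \<otimes>\<^bsub>S\<^esub> pr S h \<in> carrier S" "\<ominus>\<^bsub>S\<^esub> pr S g \<in> carrier S"
proof -
  interpret cring S by fact
  show "\<zero>\<^bsub>S\<^esub> \<in> carrier S" "\<one>\<^bsub>S\<^esub> \<in> carrier S" "pr S g \<oplus>\<^bsub>S\<^esub> pr S h \<in> carrier S"
    "pr S g \<otimes>\<^bsub>S\<^esub> pr S h \<in> carrier S" "\<ominus>\<^bsub>S\<^esub> pr S g \<in> carrier S"
    using pr_closed[OF assms] by simp_all
qed

lemma pr_simps:
  assumes "cring S"
  shows "pr S 0 = \<zero>\<^bsub>S\<^esub>" "pr S 1 = \<one>\<^bsub>S\<^esub>" "pr S (g + h) = pr S g \<oplus>\<^bsub>S\<^esub> pr S h"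
    "pr S (g * h) = pr S g \<otimes>\<^bsub>S\<^esub> pr S h" "pr S (- g) = \<ominus>\<^bsub>S\<^esub> pr S g"
  unfolding zero_uring_def one_uring_def plus_uring_def times_uring_def uminus_uring_def
  using assms by (simp_all add: pr_mk_uring cring_closed)

lemma fst_simps:
  "fst (Rep_uring (0 :: ('a, 'b) uring)) = 0" "fst (Rep_uring (1 :: ('a, 'b) uring)) = 1"
  "fst (Rep_uring (g + h :: ('a, 'b) uring)) = fst (Rep_uring g) + fst (Rep_uring h)"
  "fst (Rep_uring (g * h :: ('a, 'b) uring)) = fst (Rep_uring g) * fst (Rep_uring h)"
  "fst (Rep_uring (- g :: ('a, 'b) uring)) = - fst (Rep_uring g)"
  unfolding zero_uring_def one_uring_def plus_uring_def times_uring_def uminus_uring_def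
  by (simp_all add: Rep_mk_uring cring_closed)

instance
proof
  fix g h k :: "('a, 'b) uring"
  have pr_axioms: "pr S (g + h + k) = pr S (g + (h + k))" "pr S (g + h) = pr S (h + g)"
    "pr S (0 + g) = pr S g" "pr S (- g + g) = pr S 0" "pr S (g * h * k) = pr S (g * (h * k))"
    "pr S (g * h) = pr S (h * g)" "pr S (1 * g) = pr S g"
    "pr S ((g + h) * k) = pr S (g * k + h * k)"
    if S: "cring S" for S :: "('a, 'b) ring_scheme"
  proof -
    interpret cring S by fact
    note [simp] = pr_closed[OF S]
    show "pr S (g + h + k) = pr S (g + (h + k))"
      by (simp add: pr_simps[OF S] a_assoc)
    show "pr S (g + h) = pr S (h + g)"
      by (simp add: pr_simps[OF S] a_comm)
    show "pr S (0 + g) = pr S g" "pr S (- g + g) = pr S 0" "pr S (1 * g) = pr S g"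
      by (simp_all add: pr_simps[OF S] l_neg)
    show "pr S (g * h * k) = pr S (g * (h * k))"
      by (simp add: pr_simps[OF S] m_assoc)
    show "pr S (g * h) = pr S (h * g)"
      by (simp add: pr_simps[OF S] m_comm)
    show "pr S ((g + h) * k) = pr S (g * k + h * k)"
      by (simp add: pr_simps[OF S] l_distr)
  qed
  show "g + h + k = g + (h + k)"
    by (rule uring_eqI) (simp add: fst_simps, rule pr_axioms)
  show "g + h = h + g"
    by (rule uring_eqI) (simp add: fst_simps, rule pr_axioms)
  show "0 + g = g"
    by (rule uring_eqI) (simp add: fst_simps, rule pr_axioms)
  show "- g + g = 0"
    by (rule uring_eqI) (simp add: fst_simps, rule pr_axioms)
  show "g * h * k = g * (h * k)"
    by (rule uring_eqI) (simp add: fst_simps, rule pr_axioms)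
  show "g * h = h * g"
    by (rule uring_eqI) (simp add: fst_simps, rule pr_axioms)
  show "1 * g = g"
    by (rule uring_eqI) (simp add: fst_simps, rule pr_axioms)
  show "(g + h) * k = g * k + h * k"
    by (rule uring_eqI) (simp add: fst_simps distrib_right, rule pr_axioms)
  show "g - h = g + - h"
    by (simp add: minus_uring_def)
  show "(0 :: ('a, 'b) uring) \<noteq> 1"
  proof
    assume "(0 :: ('a, 'b) uring) = 1"
    then have "fst (Rep_uring (0 :: ('a, 'b) uring)) = fst (Rep_uring (1 :: ('a, 'b) uring))"
      by (rule arg_cong)
    then show False
      unfolding fst_simps by simp
  qed
qed

end

lemma pr_surj:
  assumes "cring S" "x \<in> carrier S"
  obtains g where "pr S g = x"
proof -
  have "pr S (mk_uring 0 (\<lambda>S'. if S' = S then x else \<zero>\<^bsub>S'\<^esub>)) = x"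
  proof (subst pr_mk_uring)
    show "(if S' = S then x else \<zero>\<^bsub>S'\<^esub>) \<in> carrier S'" if "cring S'" for S'
      using assms(2) cring_closed(1)[OF that] by simp
  qed (use assms in simp_all)
  then show thesis
    using that by blast
qed

lemma pr_minus: "cring S \<Longrightarrow> pr S (g - h) = pr S g \<ominus>\<^bsub>S\<^esub> pr S h"
  by (simp only: minus_uring_def pr_simps a_minus_def)

lemma pr_power:
  assumes S: "cring S"
  shows "pr S (g ^ n) = pr S g [^]\<^bsub>S\<^esub> n"
proof (induction n)
  case 0
  interpret cring S by fact
  show ?case
    unfolding power_0 nat_pow_0 by (rule pr_simps(2)[OF S])
next
  case (Suc n)
  interpret cring S by fact
  show ?case
    unfolding power_Suc2 nat_pow_Suc pr_simps(4)[OF S] Suc ..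
qed

lemma pr_of_nat_mult:
  assumes S: "cring S"
  shows "pr S (of_nat n * g) = add_pow S n (pr S g)"
proof (induction n)
  case 0
  interpret cring S by fact
  show ?case
    by (simp add: pr_simps(1)[OF S])
next
  case (Suc n)
  interpret cring S by fact
  have "of_nat (Suc n) * g = of_nat n * g + g"
    by (simp add: algebra_simps)
  then have "pr S (of_nat (Suc n) * g) = pr S (of_nat n * g) \<oplus>\<^bsub>S\<^esub> pr S g"
    by (simp only: pr_simps(3)[OF S])
  then show ?case
    unfolding Suc by (simp only: add.nat_pow_Suc)
qed

lemma pr_of_nat: "cring S \<Longrightarrow> pr S (of_nat n) = nat_elem S n"
  using pr_of_nat_mult[of S n 1] by (simp only: mult_1_right pr_simps)

lemma pr_numeral_mult: "cring S \<Longrightarrow> pr S (numeral n * g) = add_pow S (numeral n :: nat) (pr S g)"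
  using pr_of_nat_mult[of S "numeral n"] by simp

section \<open>Quotient modules and Kaehler differentials\<close>

text \<open>Well-definedness in usable form: the union defining \<open>coset_map\<close> collapses
  once the coset of values does not depend on the representative.\<close>

lemma coset_map_const:
  assumes "C \<noteq> {}" "\<And>c. c \<in> C \<Longrightarrow> N +>\<^bsub>M\<^esub> g c = D"
  shows "coset_map M N g C = D"
  unfolding coset_map_def using assms by auto

lemma (in abelian_subgroup) a_rcos_eq_iff:
  assumes "x \<in> carrier G" "y \<in> carrier G"
  shows "H +> x = H +> y \<longleftrightarrow> x \<ominus> y \<in> H"
proof
  assume "H +> x = H +> y"
  then have "x \<in> H +> y"
    using a_rcos_self[OF assms(1)] by simp
  then show "x \<ominus> y \<in> H"
    using a_rcos_module_imp[OF assms(2)] assms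
    by (simp add: a_minus_def)
next
  assume "x \<ominus> y \<in> H"
  then have "x \<in> H +> y"
    using a_rcos_module_rev[OF assms(2) assms(1)] by (simp add: a_minus_def)
  then show "H +> x = H +> y"
    using a_repr_independence[OF _ assms(2) a_subgroup] by simp
qed

context module
begin

lemma submodule_abelian_subgroup:
  assumes "submodule N R M"
  shows "abelian_subgroup N M"
  by (intro abelian_subgroupI3 additive_subgroup.intro submodule.axioms(1)[OF assms] M.abelian_group_axioms)

lemma
  assumes N: "submodule N R M"
  shows quot_module_carrier: "carrier (quot_module M N) = (\<lambda>x. N +>\<^bsub>M\<^esub> x) ` carrier M"
    and quot_module_zero: "\<zero>\<^bsub>quot_module M N\<^esub> = N +>\<^bsub>M\<^esub> \<zero>\<^bsub>M\<^esub>"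
    and quot_module_add: "\<And>x y. x \<in> carrier M \<Longrightarrow> y \<in> carrier M \<Longrightarrow>
      (N +>\<^bsub>M\<^esub> x) \<oplus>\<^bsub>quot_module M N\<^esub> (N +>\<^bsub>M\<^esub> y) = N +>\<^bsub>M\<^esub> (x \<oplus>\<^bsub>M\<^esub> y)"
    and quot_module_smult: "\<And>c x. c \<in> carrier R \<Longrightarrow> x \<in> carrier M \<Longrightarrow>
      c \<odot>\<^bsub>quot_module M N\<^esub> (N +>\<^bsub>M\<^esub> x) = N +>\<^bsub>M\<^esub> (c \<odot>\<^bsub>M\<^esub> x)"
proof -
  interpret N: abelian_subgroup N M
    by (rule submodule_abelian_subgroup[OF N])
  show "carrier (quot_module M N) = (\<lambda>x. N +>\<^bsub>M\<^esub> x) ` carrier M"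
    unfolding quot_module_def by (auto simp: A_RCOSETS_def')
  show "\<zero>\<^bsub>quot_module M N\<^esub> = N +>\<^bsub>M\<^esub> \<zero>\<^bsub>M\<^esub>"
    unfolding quot_module_def using N.a_subset by simp
  show "(N +>\<^bsub>M\<^esub> x) \<oplus>\<^bsub>quot_module M N\<^esub> (N +>\<^bsub>M\<^esub> y) = N +>\<^bsub>M\<^esub> (x \<oplus>\<^bsub>M\<^esub> y)"
    if "x \<in> carrier M" "y \<in> carrier M" for x y
    unfolding quot_module_def using that by (simp add: N.a_rcos_sum)
  show "c \<odot>\<^bsub>quot_module M N\<^esub> (N +>\<^bsub>M\<^esub> x) = N +>\<^bsub>M\<^esub> (c \<odot>\<^bsub>M\<^esub> x)"
    if c: "c \<in> carrier R" and x: "x \<in> carrier M" for c x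
  proof -
    have "coset_map M N (\<lambda>x. c \<odot>\<^bsub>M\<^esub> x) (N +>\<^bsub>M\<^esub> x) = N +>\<^bsub>M\<^esub> (c \<odot>\<^bsub>M\<^esub> x)"
    proof (rule coset_map_const)
      show "N +>\<^bsub>M\<^esub> x \<noteq> {}"
        using N.a_rcos_self[OF x] by blast
      fix y assume "y \<in> N +>\<^bsub>M\<^esub> x"
      then have y: "y \<in> carrier M" "y \<ominus>\<^bsub>M\<^esub> x \<in> N"
        using x N.a_elemrcos_carrier N.a_rcos_module_imp by (auto simp: a_minus_def)
      have "c \<odot>\<^bsub>M\<^esub> (y \<ominus>\<^bsub>M\<^esub> x) \<in> N"
        using submodule.smult_closed[OF N c y(2)] .
      moreover have "c \<odot>\<^bsub>M\<^esub> (y \<ominus>\<^bsub>M\<^esub> x) = c \<odot>\<^bsub>M\<^esub> y \<ominus>\<^bsub>M\<^esub> c \<odot>\<^bsub>M\<^esub> x"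
        using c x y by (simp add: a_minus_def smult_r_distr smult_r_minus)
      ultimately show "N +>\<^bsub>M\<^esub> c \<odot>\<^bsub>M\<^esub> y = N +>\<^bsub>M\<^esub> c \<odot>\<^bsub>M\<^esub> x"
        using N.a_rcos_eq_iff[of "c \<odot>\<^bsub>M\<^esub> y" "c \<odot>\<^bsub>M\<^esub> x"] c x y by simp
    qed
    then show ?thesis
      by (simp add: quot_module_def)
  qed
qed

lemma quot_module_module:
  assumes N: "submodule N R M"
  shows "module R (quot_module M N)"
proof (rule moduleI[OF R.is_cring])
  note simps = quot_module_carrier[OF N] quot_module_zero[OF N] quot_module_add[OF N]
    quot_module_smult[OF N]
  show "abelian_group (quot_module M N)"
  proof (rule abelian_groupI)
    fix x assume "x \<in> carrier (quot_module M N)"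
    then obtain x' where x: "x = N +>\<^bsub>M\<^esub> x'" "x' \<in> carrier M"
      by (auto simp: simps)
    then show "\<exists>y\<in>carrier (quot_module M N). y \<oplus>\<^bsub>quot_module M N\<^esub> x = \<zero>\<^bsub>quot_module M N\<^esub>"
      by (intro bexI[of _ "N +>\<^bsub>M\<^esub> (\<ominus>\<^bsub>M\<^esub> x')"]) (auto simp: simps M.l_neg)
  qed (auto simp: simps M.a_ac)
qed (auto simp: quot_module_carrier[OF N] quot_module_add[OF N] quot_module_smult[OF N]
    smult_l_distr smult_r_distr smult_assoc1)

lemma submodule_span_submodule:
  assumes "S \<subseteq> carrier M"
  shows "submodule (submodule_span R M S) R M"
proof (rule submoduleI)
  \<comment> \<open>The whole module belongs to the family whose intersection is the span; otherwise
    the intersection could be over an empty family.\<close>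
  have "submodule (carrier M) R M"
    by (rule carrier_is_submodule)
  then show "submodule_span R M S \<subseteq> carrier M"
    unfolding submodule_span_def using assms by blast
  show "\<zero>\<^bsub>M\<^esub> \<in> submodule_span R M S"
    unfolding submodule_span_def
    using subgroup.one_closed[OF submodule.axioms(1)] by fastforce
  show "\<ominus>\<^bsub>M\<^esub> a \<in> submodule_span R M S" if "a \<in> submodule_span R M S" for a
    using that submoduleE(3) unfolding submodule_span_def by blast
  show "a \<oplus>\<^bsub>M\<^esub> b \<in> submodule_span R M S" if "a \<in> submodule_span R M S" "b \<in> submodule_span R M S" for a b
    using that submoduleE(5) unfolding submodule_span_def by blast
  show "a \<odot>\<^bsub>M\<^esub> x \<in> submodule_span R M S" if "a \<in> carrier R" "x \<in> submodule_span R M S" for a x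
    using that submoduleE(4) unfolding submodule_span_def by blast
qed

end

lemma submodule_span_superset: "S \<subseteq> submodule_span A M S"
  unfolding submodule_span_def by blast

lemma submodule_span_least: "submodule H A M \<Longrightarrow> S \<subseteq> H \<Longrightarrow> submodule_span A M S \<subseteq> H"
  unfolding submodule_span_def by blast

context cring
begin

lemma free_module_module: "module R (free_module R I)" (is "module R ?F")
proof (rule moduleI[OF is_cring])
  show "abelian_group (?F)"
  proof (rule abelian_groupI)
    fix g h assume g: "g \<in> carrier (?F)" and h: "h \<in> carrier (?F)"
    have "finite ({i. g i \<noteq> \<zero>} \<union> {i. h i \<noteq> \<zero>})"
      using g h by (auto simp: free_module_def)
    moreover have "{i. g i \<oplus> h i \<noteq> \<zero>} \<subseteq> {i. g i \<noteq> \<zero>} \<union> {i. h i \<noteq> \<zero>}"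
      by auto
    ultimately have "finite {i. g i \<oplus> h i \<noteq> \<zero>}"
      by (rule rev_finite_subset)
    then show "g \<oplus>\<^bsub>?F\<^esub> h \<in> carrier (?F)"
      using g h by (auto simp: free_module_def)
    show "g \<oplus>\<^bsub>?F\<^esub> h = h \<oplus>\<^bsub>?F\<^esub> g"
    proof
      fix i
      have "g i \<in> carrier R" "h i \<in> carrier R"
        using g h by (cases "i \<in> I"; auto simp: free_module_def)+
      then show "(g \<oplus>\<^bsub>?F\<^esub> h) i = (h \<oplus>\<^bsub>?F\<^esub> g) i"
        by (simp add: free_module_def a_comm)
    qed
  next
    fix g h k assume gh: "g \<in> carrier (?F)" "h \<in> carrier (?F)"
      "k \<in> carrier (?F)"
    show "g \<oplus>\<^bsub>?F\<^esub> h \<oplus>\<^bsub>?F\<^esub> k = g \<oplus>\<^bsub>?F\<^esub> (h \<oplus>\<^bsub>?F\<^esub> k)"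
    proof
      fix i
      have "g i \<in> carrier R" "h i \<in> carrier R" "k i \<in> carrier R"
        using gh by (cases "i \<in> I"; auto simp: free_module_def)+
      then show "(g \<oplus>\<^bsub>?F\<^esub> h \<oplus>\<^bsub>?F\<^esub> k) i
        = (g \<oplus>\<^bsub>?F\<^esub> (h \<oplus>\<^bsub>?F\<^esub> k)) i"
        by (simp add: free_module_def a_assoc)
    qed
  next
    show "\<zero>\<^bsub>?F\<^esub> \<in> carrier (?F)"
      by (simp add: free_module_def)
    fix g assume g: "g \<in> carrier (?F)"
    then have gi: "g i \<in> carrier R" for i
      by (cases "i \<in> I") (auto simp: free_module_def)
    show "\<zero>\<^bsub>?F\<^esub> \<oplus>\<^bsub>?F\<^esub> g = g"
      using gi by (simp add: free_module_def)
    have "{i. \<ominus> g i \<noteq> \<zero>} \<subseteq> {i. g i \<noteq> \<zero>}"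
      by auto
    then have "finite {i. \<ominus> g i \<noteq> \<zero>}"
      using g by (auto simp: free_module_def intro: finite_subset)
    then show "\<exists>h\<in>carrier (?F). h \<oplus>\<^bsub>?F\<^esub> g = \<zero>\<^bsub>?F\<^esub>"
      using gi g by (intro bexI[of _ "\<lambda>i. \<ominus> g i"]) (auto simp: free_module_def l_neg)
  qed
next
  fix c g assume c: "c \<in> carrier R" and g: "g \<in> carrier (?F)"
  have "{i. c \<otimes> g i \<noteq> \<zero>} \<subseteq> {i. g i \<noteq> \<zero>}"
    using c by auto
  then have "finite {i. c \<otimes> g i \<noteq> \<zero>}"
    using g by (auto simp: free_module_def intro: finite_subset)
  then show "c \<odot>\<^bsub>?F\<^esub> g \<in> carrier (?F)"
    using c g by (auto simp: free_module_def)
next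
  fix c e g assume c: "c \<in> carrier R" "e \<in> carrier R" and g: "g \<in> carrier (?F)"
  then have gi: "g i \<in> carrier R" for i
    by (cases "i \<in> I") (auto simp: free_module_def)
  show "(c \<oplus> e) \<odot>\<^bsub>?F\<^esub> g = c \<odot>\<^bsub>?F\<^esub> g \<oplus>\<^bsub>?F\<^esub> e \<odot>\<^bsub>?F\<^esub> g"
    using c gi by (simp add: free_module_def l_distr)
  show "(c \<otimes> e) \<odot>\<^bsub>?F\<^esub> g = c \<odot>\<^bsub>?F\<^esub> (e \<odot>\<^bsub>?F\<^esub> g)"
    using c gi by (simp add: free_module_def m_assoc)
next
  fix c g h assume c: "c \<in> carrier R" and g: "g \<in> carrier (?F)" "h \<in> carrier (?F)"
  have gi: "g i \<in> carrier R" "h i \<in> carrier R" for i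
    using g by (cases "i \<in> I"; auto simp: free_module_def)+
  show "c \<odot>\<^bsub>?F\<^esub> (g \<oplus>\<^bsub>?F\<^esub> h)
    = c \<odot>\<^bsub>?F\<^esub> g \<oplus>\<^bsub>?F\<^esub> c \<odot>\<^bsub>?F\<^esub> h"
    using c gi by (simp add: free_module_def r_distr)
next
  fix g assume g: "g \<in> carrier (?F)"
  then have gi: "g i \<in> carrier R" for i
    by (cases "i \<in> I") (auto simp: free_module_def)
  show "\<one> \<odot>\<^bsub>?F\<^esub> g = g"
    using gi by (simp add: free_module_def)
qed

lemma free_gen_closed:
  assumes "i \<in> I"
  shows "free_gen R i \<in> carrier (free_module R I)"
proof -
  have "{k. free_gen R i k \<noteq> \<zero>} \<subseteq> {i}"
    by (auto simp: free_gen_def)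
  then have "finite {k. free_gen R i k \<noteq> \<zero>}"
    by (rule finite_subset) simp
  then show ?thesis
    using assms by (auto simp: free_module_def free_gen_def)
qed

lemma kaehler_free_module: "module R (kaehler_free R)"
  unfolding kaehler_free_def by (rule free_module_module)

end

locale kaehler_base = cring A for A (structure) and B :: "('b, 'n) ring_scheme" and \<iota> +
  assumes \<iota>_closed: "r \<in> carrier B \<Longrightarrow> \<iota> r \<in> carrier A"
begin

sublocale F: module A "kaehler_free A"
  by (rule kaehler_free_module)

lemma gen_closed [simp, intro]: "x \<in> carrier A \<Longrightarrow> free_gen A x \<in> carrier (kaehler_free A)"
  unfolding kaehler_free_def by (rule free_gen_closed)

abbreviation N where "N \<equiv> kaehler_relations B \<iota> A"

lemma N_submodule: "submodule N A (kaehler_free A)"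
  unfolding kaehler_relations_def Let_def
  by (rule F.submodule_span_submodule) (auto simp: \<iota>_closed)

sublocale N: abelian_subgroup N "kaehler_free A"
  by (rule F.submodule_abelian_subgroup[OF N_submodule])

lemma kaehler_module: "module A (kaehler B \<iota> A)"
  unfolding kaehler_def by (rule F.quot_module_module[OF N_submodule])

lemma N_rel_add:
  assumes "x \<in> carrier A" "y \<in> carrier A"
  shows "free_gen A (x \<oplus> y) \<ominus>\<^bsub>kaehler_free A\<^esub> (free_gen A x \<oplus>\<^bsub>kaehler_free A\<^esub> free_gen A y) \<in> N"
  unfolding kaehler_relations_def Let_def
  using assms by (intro subsetD[OF submodule_span_superset]) blast

lemma N_rel_mult:
  assumes "x \<in> carrier A" "y \<in> carrier A"
  shows "free_gen A (x \<otimes> y) \<ominus>\<^bsub>kaehler_free A\<^esub>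
    (x \<odot>\<^bsub>kaehler_free A\<^esub> free_gen A y \<oplus>\<^bsub>kaehler_free A\<^esub> y \<odot>\<^bsub>kaehler_free A\<^esub> free_gen A x) \<in> N"
  unfolding kaehler_relations_def Let_def
  using assms by (intro subsetD[OF submodule_span_superset]) blast

lemma N_rel_const:
  assumes "r \<in> carrier B"
  shows "free_gen A (\<iota> r) \<in> N"
  unfolding kaehler_relations_def Let_def
  using assms by (intro subsetD[OF submodule_span_superset]) blast

abbreviation d where "d \<equiv> kaehler_d B \<iota> A"

lemma d_closed: "x \<in> carrier A \<Longrightarrow> d x \<in> carrier (kaehler B \<iota> A)"
  unfolding kaehler_d_def kaehler_def F.quot_module_carrier[OF N_submodule] by auto

lemma d_add:
  assumes "x \<in> carrier A" "y \<in> carrier A"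
  shows "d (x \<oplus> y) = d x \<oplus>\<^bsub>kaehler B \<iota> A\<^esub> d y"
  unfolding kaehler_d_def kaehler_def
  using assms N_rel_add[OF assms]
  by (simp add: F.quot_module_add[OF N_submodule] N.a_rcos_eq_iff)

lemma d_mult:
  assumes "x \<in> carrier A" "y \<in> carrier A"
  shows "d (x \<otimes> y) = x \<odot>\<^bsub>kaehler B \<iota> A\<^esub> d y \<oplus>\<^bsub>kaehler B \<iota> A\<^esub> y \<odot>\<^bsub>kaehler B \<iota> A\<^esub> d x"
  unfolding kaehler_d_def kaehler_def
  using assms N_rel_mult[OF assms]
  by (simp add: F.quot_module_add[OF N_submodule] F.quot_module_smult[OF N_submodule] N.a_rcos_eq_iff)

lemma d_const:
  assumes "r \<in> carrier B"
  shows "d (\<iota> r) = \<zero>\<^bsub>kaehler B \<iota> A\<^esub>"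
  unfolding kaehler_d_def kaehler_def F.quot_module_zero[OF N_submodule]
  using assms N_rel_const[OF assms]
  by (simp add: N.a_rcos_eq_iff \<iota>_closed a_minus_def)

end

locale kaehler_hom = S: kaehler_base A B \<iota> + T: kaehler_base A' B' \<iota>'
  for A (structure) and B :: "('b, 'n) ring_scheme" and \<iota>
    and A' (structure) and B' :: "('c, 'k) ring_scheme" and \<iota>' +
  fixes u
  assumes u_hom: "u \<in> ring_hom A A'"
    and u_base: "r \<in> carrier B \<Longrightarrow> \<exists>r'\<in>carrier B'. u (\<iota> r) = \<iota>' r'"
begin

sublocale u: ring_hom_cring A A' u
  by (intro ring_hom_cring.intro ring_hom_cring_axioms.intro S.is_cring T.is_cring u_hom)

abbreviation FA where "FA \<equiv> kaehler_free A"
abbreviation FA' where "FA' \<equiv> kaehler_free A'"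
abbreviation push where "push \<equiv> free_push A A' u"

lemma FA_value: "g \<in> carrier FA \<Longrightarrow> g x \<in> carrier A"
  by (cases "x \<in> carrier A") (auto simp: kaehler_free_def free_module_def)

text \<open>Replaces the support of g by any finite P containing it, so that two functions can be
  summed over a common index set.\<close>

lemma push_eq:
  assumes g: "g \<in> carrier FA" and P: "finite P" "P \<subseteq> carrier A" "{x. g x \<noteq> \<zero>\<^bsub>A\<^esub>} \<subseteq> P"
  shows "push g k = (\<Oplus>\<^bsub>A'\<^esub>x\<in>{x \<in> P. u x = k}. u (g x))"
  unfolding free_push_def
  by (rule T.add.finprod_mono_neutral_cong_left) (use P FA_value[OF g] in auto)

lemma FA_support:
  assumes "g \<in> carrier FA"
  shows "finite {x. g x \<noteq> \<zero>\<^bsub>A\<^esub>}" "{x. g x \<noteq> \<zero>\<^bsub>A\<^esub>} \<subseteq> carrier A"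
  using assms by (auto simp: kaehler_free_def free_module_def)

lemma push_closed:
  assumes g: "g \<in> carrier FA"
  shows "push g \<in> carrier FA'"
proof -
  have "push g k = \<zero>\<^bsub>A'\<^esub>" if "k \<notin> u ` {x. g x \<noteq> \<zero>\<^bsub>A\<^esub>}" for k
  proof -
    have "{x \<in> carrier A. g x \<noteq> \<zero>\<^bsub>A\<^esub> \<and> u x = k} = {}"
      using that by auto
    then show ?thesis
      unfolding free_push_def by (simp only: T.finsum_empty)
  qed
  then have sub: "{k. push g k \<noteq> \<zero>\<^bsub>A'\<^esub>} \<subseteq> u ` {x. g x \<noteq> \<zero>\<^bsub>A\<^esub>}"
    by blast
  then have "finite {k. push g k \<noteq> \<zero>\<^bsub>A'\<^esub>}"
    using FA_support(1)[OF g] by (meson finite_imageI finite_subset)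
  moreover have "push g k = \<zero>\<^bsub>A'\<^esub>" if "k \<notin> carrier A'" for k
    using that sub FA_support(2)[OF g] u.hom_closed by blast
  moreover have "push g k \<in> carrier A'" for k
    unfolding free_push_def using FA_value[OF g] by (intro T.finsum_closed) auto
  ultimately show ?thesis
    by (auto simp: kaehler_free_def free_module_def)
qed

lemma push_add:
  assumes g: "g \<in> carrier FA" and h: "h \<in> carrier FA"
  shows "push (g \<oplus>\<^bsub>FA\<^esub> h) = push g \<oplus>\<^bsub>FA'\<^esub> push h"
proof
  fix k
  let ?P = "{x. g x \<noteq> \<zero>\<^bsub>A\<^esub>} \<union> {x. h x \<noteq> \<zero>\<^bsub>A\<^esub>}"
  have val: "(g \<oplus>\<^bsub>FA\<^esub> h) x = g x \<oplus>\<^bsub>A\<^esub> h x" for x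
    by (simp add: kaehler_free_def free_module_def)
  have P: "finite ?P" "?P \<subseteq> carrier A"
    using FA_support[OF g] FA_support[OF h] by auto
  have "{x. (g \<oplus>\<^bsub>FA\<^esub> h) x \<noteq> \<zero>\<^bsub>A\<^esub>} \<subseteq> ?P"
    by (auto simp: val)
  then have "push (g \<oplus>\<^bsub>FA\<^esub> h) k = (\<Oplus>\<^bsub>A'\<^esub>x\<in>{x \<in> ?P. u x = k}. u (g x) \<oplus>\<^bsub>A'\<^esub> u (h x))"
    using push_eq[OF S.F.M.a_closed[OF g h] P] FA_value[OF g] FA_value[OF h]
    by (simp add: val)
  also have "\<dots> = (\<Oplus>\<^bsub>A'\<^esub>x\<in>{x \<in> ?P. u x = k}. u (g x)) \<oplus>\<^bsub>A'\<^esub> (\<Oplus>\<^bsub>A'\<^esub>x\<in>{x \<in> ?P. u x = k}. u (h x))"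
    using FA_value[OF g] FA_value[OF h] by (intro T.finsum_addf) auto
  also have "\<dots> = push g k \<oplus>\<^bsub>A'\<^esub> push h k"
    using push_eq[OF g P] push_eq[OF h P] by simp
  finally show "push (g \<oplus>\<^bsub>FA\<^esub> h) k = (push g \<oplus>\<^bsub>FA'\<^esub> push h) k"
    by (simp add: kaehler_free_def free_module_def)
qed

lemma push_smult:
  assumes g: "g \<in> carrier FA" and c: "c \<in> carrier A"
  shows "push (c \<odot>\<^bsub>FA\<^esub> g) = u c \<odot>\<^bsub>FA'\<^esub> push g"
proof
  fix k
  let ?P = "{x. g x \<noteq> \<zero>\<^bsub>A\<^esub>}"
  have val: "(c \<odot>\<^bsub>FA\<^esub> g) x = c \<otimes>\<^bsub>A\<^esub> g x" for x
    by (simp add: kaehler_free_def free_module_def)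
  have P: "finite ?P" "?P \<subseteq> carrier A"
    using FA_support[OF g] by auto
  have "{x. (c \<odot>\<^bsub>FA\<^esub> g) x \<noteq> \<zero>\<^bsub>A\<^esub>} \<subseteq> ?P"
    using c by (auto simp: val)
  then have "push (c \<odot>\<^bsub>FA\<^esub> g) k = (\<Oplus>\<^bsub>A'\<^esub>x\<in>{x \<in> ?P. u x = k}. u c \<otimes>\<^bsub>A'\<^esub> u (g x))"
    using push_eq[OF S.F.smult_closed[OF c g] P] FA_value[OF g] c
    by (simp add: val)
  also have "\<dots> = u c \<otimes>\<^bsub>A'\<^esub> push g k"
    unfolding push_eq[OF g P order_refl]
    using P FA_value[OF g] c by (intro T.finsum_rdistr[symmetric]) auto
  finally show "push (c \<odot>\<^bsub>FA\<^esub> g) k = (u c \<odot>\<^bsub>FA'\<^esub> push g) k"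
    by (simp add: kaehler_free_def free_module_def)
qed

lemma push_gen:
  assumes x: "x \<in> carrier A"
  shows "push (free_gen A x) = free_gen A' (u x)"
proof
  fix k
  have "push (free_gen A x) k = (\<Oplus>\<^bsub>A'\<^esub>y\<in>{y \<in> {x}. u y = k}. u (free_gen A x y))"
    using x by (intro push_eq S.gen_closed) (auto simp: free_gen_def)
  also have "\<dots> = free_gen A' (u x) k"
  proof (cases "u x = k")
    case True
    then have "{y \<in> {x}. u y = k} = {x}" by auto
    then show ?thesis
      using True by (simp add: free_gen_def)
  next
    case False
    then have "{y \<in> {x}. u y = k} = {}" by auto
    then have "(\<Oplus>\<^bsub>A'\<^esub>y\<in>{y \<in> {x}. u y = k}. u (free_gen A x y)) = \<zero>\<^bsub>A'\<^esub>"
      by (simp only: T.finsum_empty)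
    then show ?thesis
      using False by (simp add: free_gen_def)
  qed
  finally show "push (free_gen A x) k = free_gen A' (u x) k" .
qed

lemma push_zero: "push \<zero>\<^bsub>FA\<^esub> = \<zero>\<^bsub>FA'\<^esub>"
proof -
  have "push (\<zero>\<^bsub>A\<^esub> \<odot>\<^bsub>FA\<^esub> \<zero>\<^bsub>FA\<^esub>) = \<zero>\<^bsub>A'\<^esub> \<odot>\<^bsub>FA'\<^esub> push \<zero>\<^bsub>FA\<^esub>"
    by (subst push_smult) simp_all
  then show ?thesis
    using push_closed[OF S.F.M.zero_closed] by simp
qed

lemma push_minus:
  assumes g: "g \<in> carrier FA"
  shows "push (\<ominus>\<^bsub>FA\<^esub> g) = \<ominus>\<^bsub>FA'\<^esub> push g"
proof -
  have "push (\<ominus>\<^bsub>FA\<^esub> g) \<oplus>\<^bsub>FA'\<^esub> push g = \<zero>\<^bsub>FA'\<^esub>"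
    using g by (simp add: push_add[symmetric] S.F.M.l_neg push_zero)
  then show ?thesis
    using g push_closed by (simp add: T.F.M.minus_equality)
qed

lemma push_diff:
  assumes "g \<in> carrier FA" "h \<in> carrier FA"
  shows "push (g \<ominus>\<^bsub>FA\<^esub> h) = push g \<ominus>\<^bsub>FA'\<^esub> push h"
  using assms by (simp add: a_minus_def push_add push_minus)

text \<open>The elements that \<open>push\<close> sends into the relations of the target form a
  submodule, so it suffices to treat the three kinds of generators. Constants are covered by
  \<open>u_base\<close>.\<close>

lemma push_relations:
  assumes "g \<in> S.N"
  shows "push g \<in> T.N"
proof -
  let ?H = "{g \<in> carrier FA. push g \<in> T.N}"
  have "submodule ?H A FA"
  proof (rule S.F.submoduleI)
    show "\<zero>\<^bsub>FA\<^esub> \<in> ?H"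
      by (simp add: push_zero)
    show "\<ominus>\<^bsub>FA\<^esub> g \<in> ?H" if "g \<in> ?H" for g
      using that by (simp add: push_minus)
    show "g \<oplus>\<^bsub>FA\<^esub> h \<in> ?H" if "g \<in> ?H" "h \<in> ?H" for g h
      using that by (simp add: push_add)
    show "c \<odot>\<^bsub>FA\<^esub> g \<in> ?H" if "c \<in> carrier A" "g \<in> ?H" for c g
      using that submodule.smult_closed[OF T.N_submodule] by (simp add: push_smult)
  qed auto
  moreover have "free_gen A (x \<oplus>\<^bsub>A\<^esub> y) \<ominus>\<^bsub>FA\<^esub> (free_gen A x \<oplus>\<^bsub>FA\<^esub> free_gen A y) \<in> ?H"
    if "x \<in> carrier A" "y \<in> carrier A" for x y
    using that T.N_rel_add[of "u x" "u y"] by (simp add: push_diff push_add push_gen)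
  moreover have "free_gen A (x \<otimes>\<^bsub>A\<^esub> y) \<ominus>\<^bsub>FA\<^esub> (x \<odot>\<^bsub>FA\<^esub> free_gen A y \<oplus>\<^bsub>FA\<^esub> y \<odot>\<^bsub>FA\<^esub> free_gen A x) \<in> ?H"
    if "x \<in> carrier A" "y \<in> carrier A" for x y
    using that T.N_rel_mult[of "u x" "u y"] by (simp add: push_diff push_add push_smult push_gen)
  moreover have "free_gen A (\<iota> r) \<in> ?H" if "r \<in> carrier B" for r
    using that u_base[OF that] T.N_rel_const S.\<iota>_closed by (auto simp: push_gen)
  ultimately have "S.N \<subseteq> ?H"
    unfolding kaehler_relations_def[of B] Let_def by (intro submodule_span_least) auto
  then show ?thesis
    using assms by blast
qed

lemma kaehler_map_coset:
  assumes g: "g \<in> carrier FA"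
  shows "kaehler_map B' \<iota>' A A' u (S.N +>\<^bsub>FA\<^esub> g) = T.N +>\<^bsub>FA'\<^esub> push g"
  unfolding kaehler_map_def
proof (rule coset_map_const)
  show "S.N +>\<^bsub>FA\<^esub> g \<noteq> {}"
    using S.N.a_rcos_self[OF g] by blast
  fix h assume "h \<in> S.N +>\<^bsub>FA\<^esub> g"
  then have h: "h \<in> carrier FA" "h \<ominus>\<^bsub>FA\<^esub> g \<in> S.N"
    using g S.N.a_elemrcos_carrier S.N.a_rcos_module_imp by (auto simp: a_minus_def)
  then show "T.N +>\<^bsub>FA'\<^esub> push h = T.N +>\<^bsub>FA'\<^esub> push g"
    using push_relations[OF h(2)] g by (simp add: T.N.a_rcos_eq_iff push_closed push_diff)
qed

lemma kaehler_map_smult_d: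
  assumes "c \<in> carrier A" "x \<in> carrier A"
  shows "kaehler_map B' \<iota>' A A' u (c \<odot>\<^bsub>kaehler B \<iota> A\<^esub> S.d x) = u c \<odot>\<^bsub>kaehler B' \<iota>' A'\<^esub> T.d (u x)"
  using assms
  by (simp add: kaehler_def kaehler_d_def S.F.quot_module_smult[OF S.N_submodule]
      T.F.quot_module_smult[OF T.N_submodule] kaehler_map_coset push_smult push_gen)

end

section \<open>The p-adic completion\<close>

locale padic = cring A for A (structure) +
  fixes p :: nat
begin

abbreviation J where "J n \<equiv> padic_ideal p A n"
abbreviation Q where "Q n \<equiv> padic_quot p A n"

text \<open>The composite of the projection of \<open>uring\<close> onto A with reduction modulo
  p^n. As it is onto, identities in A/p^n are proved by computing in the type
  \<open>uring\<close>.\<close>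

definition q :: "nat \<Rightarrow> ('a, 'b) uring \<Rightarrow> 'a set"
  where "q n g = J n +> pr A g"

lemmas pr_A_simps = pr_simps[OF is_cring] pr_minus[OF is_cring] pr_power[OF is_cring]
  pr_of_nat_mult[OF is_cring] pr_of_nat[OF is_cring]

lemma pr_A_closed [simp]: "pr A g \<in> carrier A"
  by (rule pr_closed[OF is_cring])

sublocale J: ideal "J n" A for n
  unfolding padic_ideal_def by (rule cgenideal_ideal) simp

sublocale Q: cring "Q n" for n
  unfolding padic_quot_def by (rule J.quotient_is_cring[OF is_cring])

lemma class_hom: "(\<lambda>x. J n +> x) \<in> ring_hom A (Q n)"
  unfolding padic_quot_def by (rule J.rcos_ring_hom)

lemma carrier_Q: "carrier (Q n) = (\<lambda>x. J n +> x) ` carrier A"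
  unfolding padic_quot_def FactRing_def by (auto simp: A_RCOSETS_def')

lemma q_closed [simp, intro]: "q n g \<in> carrier (Q n)"
  unfolding q_def carrier_Q by simp

lemma q_add: "q n (g + h) = q n g \<oplus>\<^bsub>Q n\<^esub> q n h"
  and q_mult: "q n (g * h) = q n g \<otimes>\<^bsub>Q n\<^esub> q n h"
  and q_one: "q n 1 = \<one>\<^bsub>Q n\<^esub>"
  unfolding q_def using ring_hom_add[OF class_hom] ring_hom_mult[OF class_hom] ring_hom_one[OF class_hom]
  by (simp_all add: pr_A_simps)

lemma q_zero: "q n 0 = \<zero>\<^bsub>Q n\<^esub>"
proof -
  have "q n 0 \<oplus>\<^bsub>Q n\<^esub> q n 0 = q n 0"
    by (simp flip: q_add)
  then show ?thesis
    using Q.add.l_cancel_one[OF q_closed q_closed, of n 0 0] by simp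
qed

lemma q_uminus: "q n (- g) = \<ominus>\<^bsub>Q n\<^esub> q n g"
proof -
  have "q n (- g) \<oplus>\<^bsub>Q n\<^esub> q n g = \<zero>\<^bsub>Q n\<^esub>"
    by (simp flip: q_add q_zero)
  then show ?thesis
    using Q.minus_equality[OF _ q_closed q_closed] by simp
qed

lemma q_power: "q n (g ^ k) = q n g [^]\<^bsub>Q n\<^esub> k"
  by (induction k) (simp_all only: power_0 power_Suc2 q_one q_mult Q.nat_pow_0 Q.nat_pow_Suc)

lemma q_of_nat_mult: "q n (of_nat k * g) = add_pow (Q n) k (q n g)"
proof (induction k)
  case (Suc k)
  have "of_nat (Suc k) * g = of_nat k * g + g"
    by (simp add: algebra_simps)
  then show ?case
    by (simp only: q_add Suc Q.add.nat_pow_Suc)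
qed (simp add: q_zero)

lemma q_surj:
  assumes "c \<in> carrier (Q n)"
  obtains g where "c = q n g"
proof -
  from assms obtain x where x: "x \<in> carrier A" "c = J n +> x"
    unfolding carrier_Q by blast
  obtain g where "pr A g = x"
    using pr_surj[OF is_cring x(1)] .
  then show thesis
    using x(2) that unfolding q_def by blast
qed

lemma mem_J_iff: "x \<in> J n \<longleftrightarrow> (\<exists>t\<in>carrier A. x = t \<otimes> nat_elem A (p ^ n))"
  unfolding padic_ideal_def cgenideal_def by auto

text \<open>Has the shape of \<open>cg n\<close> with the kernel of \<open>pr A\<close> in place of
  \<open>I\<close>; through it the solution found for the abstract setup becomes a statement about
  A/p^n.\<close>

lemma q_eq_iff: "q n g = q n h \<longleftrightarrow> (\<exists>t. pr A (g - h - of_nat p ^ n * t) = \<zero>)"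
proof -
  have "q n g = q n h \<longleftrightarrow> pr A (g - h) \<in> J n"
    unfolding q_def pr_A_simps(6) by (rule J.a_rcos_eq_iff) simp_all
  also have "\<dots> \<longleftrightarrow> (\<exists>t. pr A (g - h) = pr A (of_nat p ^ n * t))"
  proof -
    have e: "pr A (of_nat p ^ n * t) = pr A t \<otimes> nat_elem A (p ^ n)" for t
    proof -
      have "of_nat p ^ n * t = t * of_nat (p ^ n)"
        by (simp add: mult.commute)
      then show ?thesis
        by (simp only: pr_A_simps)
    qed
    show ?thesis
    proof
      assume "pr A (g - h) \<in> J n"
      then obtain t where t: "t \<in> carrier A" "pr A (g - h) = t \<otimes> nat_elem A (p ^ n)"
        unfolding mem_J_iff by blast
      obtain t' where "pr A t' = t"
        using pr_surj[OF is_cring t(1)] .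
      then show "\<exists>t. pr A (g - h) = pr A (of_nat p ^ n * t)"
        unfolding e using t(2) by blast
    next
      assume "\<exists>t. pr A (g - h) = pr A (of_nat p ^ n * t)"
      then show "pr A (g - h) \<in> J n"
        unfolding e mem_J_iff using pr_A_closed by blast
    qed
  qed
  also have "\<dots> \<longleftrightarrow> (\<exists>t. pr A (g - h - of_nat p ^ n * t) = \<zero>)"
  proof -
    have "pr A (x - y) = \<zero> \<longleftrightarrow> pr A x = pr A y" for x y
      unfolding pr_A_simps(6) using r_right_minus_eq[OF pr_A_closed pr_A_closed] .
    then show ?thesis
      by (simp only:)
  qed
  finally show ?thesis .
qed

lemma q_cong_pr: "pr A g = pr A h \<Longrightarrow> q n g = q n h"
  by (simp add: q_def)

lemma q_pI: "g = h + of_nat p ^ n * t \<Longrightarrow> q n g = q n h"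
  unfolding q_eq_iff by (rule exI[of _ t]) (simp add: pr_A_simps(1))

lemma q_add_imp:
  assumes "q (n + j) g = q (n + j) h"
  shows "q n g = q n h"
proof -
  from assms obtain t where "pr A (g - h - of_nat p ^ (n + j) * t) = \<zero>"
    unfolding q_eq_iff by blast
  then have "pr A (g - h - of_nat p ^ n * (of_nat p ^ j * t)) = \<zero>"
    by (simp only: power_add mult.assoc)
  then show ?thesis
    unfolding q_eq_iff by blast
qed

lemma q_Suc_imp: "q (Suc n) g = q (Suc n) h \<Longrightarrow> q n g = q n h"
  by (rule q_add_imp[of n 1]) simp

lemma transition_q: "padic_transition p A n (q (Suc n) g) = q n g"
  unfolding padic_transition_def
proof (rule coset_map_const)
  have "pr A g \<in> q (Suc n) g"
    unfolding q_def by (rule J.a_rcos_self) (rule pr_A_closed)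
  then show "q (Suc n) g \<noteq> {}"
    by blast
  fix c assume c: "c \<in> q (Suc n) g"
  have cA: "c \<in> carrier A"
    using J.a_elemrcos_carrier[OF pr_A_closed c[unfolded q_def]] .
  obtain h where h: "c = pr A h"
    using pr_surj[OF is_cring cA] by (metis (no_types))
  have "q (Suc n) h = q (Suc n) g"
    using a_repr_independence[OF c[unfolded q_def] pr_A_closed J.a_subgroup] unfolding h q_def ..
  then have "q n h = q n g"
    by (rule q_Suc_imp)
  then show "J n +> c = q n g"
    unfolding h q_def .
qed

lemma transition_hom: "padic_transition p A n \<in> ring_hom (Q (Suc n)) (Q n)"
proof (rule ring_hom_memI)
  fix c assume c: "c \<in> carrier (Q (Suc n))"
  then obtain g where g: "c = q (Suc n) g" by (rule q_surj)
  show "padic_transition p A n c \<in> carrier (Q n)"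
    by (simp add: g transition_q)
  fix e assume "e \<in> carrier (Q (Suc n))"
  then obtain h where h: "e = q (Suc n) h" by (rule q_surj)
  show "padic_transition p A n (c \<otimes>\<^bsub>Q (Suc n)\<^esub> e)
    = padic_transition p A n c \<otimes>\<^bsub>Q n\<^esub> padic_transition p A n e"
    unfolding g h by (simp flip: q_mult add: transition_q)
  show "padic_transition p A n (c \<oplus>\<^bsub>Q (Suc n)\<^esub> e)
    = padic_transition p A n c \<oplus>\<^bsub>Q n\<^esub> padic_transition p A n e"
    unfolding g h by (simp flip: q_add add: transition_q)
next
  show "padic_transition p A n \<one>\<^bsub>Q (Suc n)\<^esub> = \<one>\<^bsub>Q n\<^esub>"
    by (simp flip: q_one add: transition_q)
qed

section \<open>Elements of the completion as coherent sequences of representatives\<close>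

abbreviation Ahat where "Ahat \<equiv> padic_completion p A"

definition hat :: "(nat \<Rightarrow> ('a, 'b) uring) \<Rightarrow> nat \<Rightarrow> 'a set"
  where "hat g = (\<lambda>n. q n (g n))"

definition compat :: "(nat \<Rightarrow> ('a, 'b) uring) \<Rightarrow> bool"
  where "compat g \<longleftrightarrow> (\<forall>n. q n (g (Suc n)) = q n (g n))"

lemma hat_closed: "compat g \<Longrightarrow> hat g \<in> carrier Ahat"
  unfolding padic_completion_def hat_def compat_def by (simp add: transition_q)

lemma hat_surj:
  assumes "s \<in> carrier Ahat"
  obtains g where "s = hat g" "compat g"
proof -
  have s: "\<And>n. s n \<in> carrier (Q n)" "\<And>n. padic_transition p A n (s (Suc n)) = s n"
    using assms unfolding padic_completion_def by auto
  have "\<forall>n. \<exists>g. s n = q n g"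
    using q_surj[OF s(1)] by blast
  from choice[OF this] obtain g where g: "\<And>n. s n = q n (g n)" by blast
  have "compat g"
    unfolding compat_def using s(2) by (simp add: g transition_q)
  moreover have "s = hat g"
    unfolding hat_def by (simp add: g fun_eq_iff)
  ultimately show thesis
    using that by blast
qed

lemma compat_add: "compat g \<Longrightarrow> compat h \<Longrightarrow> compat (\<lambda>n. g n + h n)"
  and compat_mult: "compat g \<Longrightarrow> compat h \<Longrightarrow> compat (\<lambda>n. g n * h n)"
  and compat_uminus: "compat g \<Longrightarrow> compat (\<lambda>n. - g n)"
  and compat_const: "compat (\<lambda>n. x)"
  unfolding compat_def by (simp_all add: q_add q_mult q_uminus)

lemma compat_minus: "compat g \<Longrightarrow> compat h \<Longrightarrow> compat (\<lambda>n. g n - h n)"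
  using compat_add[OF _ compat_uminus, of g h] by simp

lemma hat_add: "hat g \<oplus>\<^bsub>Ahat\<^esub> hat h = hat (\<lambda>n. g n + h n)"
  and hat_mult: "hat g \<otimes>\<^bsub>Ahat\<^esub> hat h = hat (\<lambda>n. g n * h n)"
  and hat_zero: "\<zero>\<^bsub>Ahat\<^esub> = hat (\<lambda>n. 0)"
  and hat_one: "\<one>\<^bsub>Ahat\<^esub> = hat (\<lambda>n. 1)"
  unfolding padic_completion_def hat_def by (simp_all add: q_add q_mult q_zero q_one)

lemma Ahat_cring: "cring Ahat"
proof (rule cringI)
  show "abelian_group Ahat"
  proof (rule abelian_groupI)
    fix s t r assume "s \<in> carrier Ahat" "t \<in> carrier Ahat" "r \<in> carrier Ahat"
    then show "s \<oplus>\<^bsub>Ahat\<^esub> t \<oplus>\<^bsub>Ahat\<^esub> r = s \<oplus>\<^bsub>Ahat\<^esub> (t \<oplus>\<^bsub>Ahat\<^esub> r)"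
      by (elim hat_surj) (simp add: hat_add add.assoc)
  next
    fix s t assume "s \<in> carrier Ahat" "t \<in> carrier Ahat"
    then show "s \<oplus>\<^bsub>Ahat\<^esub> t \<in> carrier Ahat" "s \<oplus>\<^bsub>Ahat\<^esub> t = t \<oplus>\<^bsub>Ahat\<^esub> s"
      by (elim hat_surj; simp add: hat_add hat_closed compat_add add.commute)+
  next
    show "\<zero>\<^bsub>Ahat\<^esub> \<in> carrier Ahat"
      by (simp add: hat_zero hat_closed compat_const)
    fix s assume "s \<in> carrier Ahat"
    then obtain g where g: "s = hat g" "compat g" by (rule hat_surj)
    show "\<zero>\<^bsub>Ahat\<^esub> \<oplus>\<^bsub>Ahat\<^esub> s = s"
      by (simp add: g hat_zero hat_add)
    show "\<exists>t\<in>carrier Ahat. t \<oplus>\<^bsub>Ahat\<^esub> s = \<zero>\<^bsub>Ahat\<^esub>"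
      using g by (intro bexI[of _ "hat (\<lambda>n. - g n)"]) (simp_all add: hat_add hat_zero hat_closed compat_uminus)
  qed
  show "comm_monoid Ahat"
  proof (rule comm_monoidI)
    fix s t r assume "s \<in> carrier Ahat" "t \<in> carrier Ahat" "r \<in> carrier Ahat"
    then show "s \<otimes>\<^bsub>Ahat\<^esub> t \<otimes>\<^bsub>Ahat\<^esub> r = s \<otimes>\<^bsub>Ahat\<^esub> (t \<otimes>\<^bsub>Ahat\<^esub> r)"
      by (elim hat_surj) (simp add: hat_mult mult.assoc)
  next
    fix s t assume "s \<in> carrier Ahat" "t \<in> carrier Ahat"
    then show "s \<otimes>\<^bsub>Ahat\<^esub> t \<in> carrier Ahat" "s \<otimes>\<^bsub>Ahat\<^esub> t = t \<otimes>\<^bsub>Ahat\<^esub> s"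
      by (elim hat_surj; simp add: hat_mult hat_closed compat_mult mult.commute)+
  next
    show "\<one>\<^bsub>Ahat\<^esub> \<in> carrier Ahat"
      by (simp add: hat_one hat_closed compat_const)
    fix s assume "s \<in> carrier Ahat"
    then show "\<one>\<^bsub>Ahat\<^esub> \<otimes>\<^bsub>Ahat\<^esub> s = s"
      by (elim hat_surj) (simp add: hat_one hat_mult)
  qed
  fix s t r assume "s \<in> carrier Ahat" "t \<in> carrier Ahat" "r \<in> carrier Ahat"
  then show "(s \<oplus>\<^bsub>Ahat\<^esub> t) \<otimes>\<^bsub>Ahat\<^esub> r = s \<otimes>\<^bsub>Ahat\<^esub> r \<oplus>\<^bsub>Ahat\<^esub> t \<otimes>\<^bsub>Ahat\<^esub> r"
    by (elim hat_surj) (simp add: hat_add hat_mult distrib_right)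
qed

sublocale Ahat: cring Ahat
  by (rule Ahat_cring)

lemma hat_uminus:
  assumes "compat g"
  shows "\<ominus>\<^bsub>Ahat\<^esub> hat g = hat (\<lambda>n. - g n)"
proof (rule Ahat.minus_equality)
  show "hat (\<lambda>n. - g n) \<oplus>\<^bsub>Ahat\<^esub> hat g = \<zero>\<^bsub>Ahat\<^esub>"
    by (simp add: hat_add hat_zero)
qed (use assms in \<open>simp_all add: hat_closed compat_uminus\<close>)

lemma hat_minus:
  assumes "compat h"
  shows "hat g \<ominus>\<^bsub>Ahat\<^esub> hat h = hat (\<lambda>n. g n - h n)"
  using assms by (simp add: a_minus_def hat_uminus hat_add)

lemma hat_power: "hat g [^]\<^bsub>Ahat\<^esub> k = hat (\<lambda>n. g n ^ k)"
  by (induction k)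
    (simp_all only: power_0 power_Suc2 hat_one hat_mult Ahat.nat_pow_0 Ahat.nat_pow_Suc)

lemma hat_nat_elem: "nat_elem Ahat k = hat (\<lambda>n. of_nat k)"
proof (induction k)
  case (Suc k)
  then show ?case
    by (simp only: Ahat.add.nat_pow_Suc hat_one hat_add of_nat_Suc add.commute)
qed (simp add: hat_zero)

text \<open>An element of the completion vanishing modulo \<open>p\<^sup>k\<close> is divisible by \<open>p\<^sup>k\<close>, even if \<open>A\<close> has
  torsion: successive representatives are corrected by multiples of \<open>p\<^sup>n\<close>.\<close>

lemma compat_divisible:
  assumes g: "compat g" and z: "q k (g k) = q k 0"
  shows "\<exists>h. compat h \<and> hat g = hat (\<lambda>n. of_nat p ^ k * h n)"
proof -
  have "\<exists>e. \<forall>n. pr A (g (Suc n) - g n - of_nat p ^ n * e n) = \<zero>"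
    using g unfolding compat_def q_eq_iff by metis
  then obtain e where e: "\<And>n. pr A (g (Suc n) - g n - of_nat p ^ n * e n) = \<zero>" by blast
  obtain t0 where t0: "pr A (g k - 0 - of_nat p ^ k * t0) = \<zero>"
    using z unfolding q_eq_iff by blast
  \<comment> \<open>Partial sums of t0 + e(k) + p e(k+1) + p^2 e(k+2) + ..., chosen so that g(k + j)
    and p^k h(j) have the same image in A itself.\<close>
  define h where "h = rec_nat t0 (\<lambda>j t. t + of_nat p ^ j * e (k + j))"
  have h: "h 0 = t0" "\<And>j. h (Suc j) = h j + of_nat p ^ j * e (k + j)"
    unfolding h_def by simp_all
  have *: "pr A (g (k + j) - of_nat p ^ k * h j) = \<zero>" for j
  proof (induction j)
    case 0
    then show ?case
      using t0 by (simp add: h)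
  next
    case (Suc j)
    have "g (k + Suc j) - of_nat p ^ k * h (Suc j)
      = (g (k + j) - of_nat p ^ k * h j) + (g (Suc (k + j)) - g (k + j) - of_nat p ^ (k + j) * e (k + j))"
      by (simp add: h algebra_simps power_add)
    then show ?case
      using Suc e[of "k + j"] by (simp only: pr_A_simps(3) l_zero zero_closed)
  qed
  have "compat h"
    unfolding compat_def h by (intro allI q_pI[OF refl])
  moreover have "q n (g n) = q n (of_nat p ^ k * h n)" for n
  proof -
    have le: "q n (g (n + j)) = q n (g n)" for j
    proof (induction j)
      case (Suc j)
      have "q (n + j) (g (Suc (n + j))) = q (n + j) (g (n + j))"
        using g unfolding compat_def by blast
      then have "q n (g (Suc (n + j))) = q n (g (n + j))"
        by (rule q_add_imp)
      then show ?case
        using Suc by simp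
    qed simp
    have "q n (g (k + n)) = q n (of_nat p ^ k * h n)"
      unfolding q_eq_iff using *[of n] by (intro exI[of _ 0]) simp
    then show ?thesis
      using le[of k] by (simp add: add.commute)
  qed
  ultimately show ?thesis
    unfolding hat_def by (intro exI[of _ h]) auto
qed

section \<open>Endomorphisms of the completion assembled from its levels\<close>

definition lift_endo :: "(nat \<Rightarrow> 'a set \<Rightarrow> 'a set) \<Rightarrow> (nat \<Rightarrow> 'a set) \<Rightarrow> nat \<Rightarrow> 'a set"
  where "lift_endo \<psi> s = (\<lambda>n. \<psi> n (s n))"

context
  fixes \<psi> :: "nat \<Rightarrow> 'a set \<Rightarrow> 'a set"
  assumes \<psi>_hom: "\<And>n. \<psi> n \<in> ring_hom (Q n) (Q n)"
    and \<psi>_compat: "\<And>n c. c \<in> carrier (Q (Suc n)) \<Longrightarrow>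
      padic_transition p A n (\<psi> (Suc n) c) = \<psi> n (padic_transition p A n c)"
begin

lemma lift_endo_hom: "lift_endo \<psi> \<in> ring_hom Ahat Ahat"
proof (rule ring_hom_memI)
  fix s assume s: "s \<in> carrier Ahat"
  then have s': "s n \<in> carrier (Q n)" "padic_transition p A n (s (Suc n)) = s n" for n
    unfolding padic_completion_def by auto
  show "lift_endo \<psi> s \<in> carrier Ahat"
    using \<psi>_compat[OF s'(1)] ring_hom_closed[OF \<psi>_hom s'(1)] s'(2)
    unfolding padic_completion_def lift_endo_def by simp
  fix t assume t: "t \<in> carrier Ahat"
  then have t': "t n \<in> carrier (Q n)" for n
    unfolding padic_completion_def by auto
  show "lift_endo \<psi> (s \<otimes>\<^bsub>Ahat\<^esub> t) = lift_endo \<psi> s \<otimes>\<^bsub>Ahat\<^esub> lift_endo \<psi> t"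
    "lift_endo \<psi> (s \<oplus>\<^bsub>Ahat\<^esub> t) = lift_endo \<psi> s \<oplus>\<^bsub>Ahat\<^esub> lift_endo \<psi> t"
    unfolding padic_completion_def lift_endo_def
    by (simp_all add: ring_hom_mult[OF \<psi>_hom s'(1) t'] ring_hom_add[OF \<psi>_hom s'(1) t'])
next
  show "lift_endo \<psi> \<one>\<^bsub>Ahat\<^esub> = \<one>\<^bsub>Ahat\<^esub>"
    unfolding padic_completion_def lift_endo_def by (simp add: ring_hom_one[OF \<psi>_hom])
qed

text \<open>The endomorphism acts level by level, so its value at n depends only on the n-th
  component of the lift picked by \<open>SOME\<close>; constant sequences show that a lift
  exists.\<close>

lemma endo_level_lift:
  assumes "c \<in> carrier (Q n)"
  shows "endo_level p A (lift_endo \<psi>) n c = \<psi> n c"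
proof -
  obtain g where g: "c = q n g"
    using assms by (rule q_surj)
  have "\<exists>s. s \<in> carrier Ahat \<and> s n = c"
    using hat_closed[OF compat_const[of g]] by (intro exI[of _ "hat (\<lambda>_. g)"]) (simp add: g hat_def)
  from someI_ex[OF this] show ?thesis
    unfolding endo_level_def lift_endo_def by simp
qed

text \<open>The Frobenius condition has to be checked at level 1 only: an element of the completion
  that vanishes there is p times an element of the completion, by
  \<open>compat_divisible\<close>.\<close>

lemma lift_endo_frobenius:
  assumes "\<And>c. c \<in> carrier (Q 1) \<Longrightarrow> \<psi> 1 c = c [^]\<^bsub>Q 1\<^esub> p"
  shows "frobenius_lift p Ahat (lift_endo \<psi>)"
  unfolding frobenius_lift_def
proof (intro conjI ballI lift_endo_hom)
  fix s assume s: "s \<in> carrier Ahat"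
  then obtain g where g: "s = hat g" "compat g" by (rule hat_surj)
  obtain h where h: "lift_endo \<psi> s = hat h" "compat h"
    using ring_hom_closed[OF lift_endo_hom s] by (rule hat_surj)
  have cg: "compat (\<lambda>n. g n ^ p)"
    using g(2) unfolding compat_def q_power by simp
  have d: "lift_endo \<psi> s \<ominus>\<^bsub>Ahat\<^esub> s [^]\<^bsub>Ahat\<^esub> p = hat (\<lambda>n. h n - g n ^ p)"
    unfolding h unfolding g(1) hat_power by (rule hat_minus[OF cg])
  have "q 1 (h 1) = q 1 (g 1 ^ p)"
  proof -
    have "q 1 (h 1) = lift_endo \<psi> s 1"
      by (simp add: h hat_def)
    also have "\<dots> = q 1 (g 1) [^]\<^bsub>Q 1\<^esub> p"
      unfolding lift_endo_def g hat_def by (rule assms) simp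
    finally show ?thesis
      by (simp add: q_power)
  qed
  then have "q 1 (h 1 - g 1 ^ p) = q 1 0"
    unfolding q_eq_iff by simp
  then obtain r where r: "compat r" "hat (\<lambda>n. h n - g n ^ p) = hat (\<lambda>n. of_nat p ^ 1 * r n)"
    using compat_divisible[OF compat_minus[OF h(2) cg], of 1] by blast
  have "lift_endo \<psi> s \<ominus>\<^bsub>Ahat\<^esub> s [^]\<^bsub>Ahat\<^esub> p = hat r \<otimes>\<^bsub>Ahat\<^esub> nat_elem Ahat p"
    unfolding d r hat_nat_elem hat_mult by (simp add: mult.commute)
  then show "lift_endo \<psi> s \<ominus>\<^bsub>Ahat\<^esub> s [^]\<^bsub>Ahat\<^esub> p \<in> PIdl\<^bsub>Ahat\<^esub> (nat_elem Ahat p)"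
    unfolding cgenideal_def using hat_closed[OF r(1)] by blast
qed

end

end

section \<open>Differentials on the completion\<close>

lemma ring_hom_nat_elem:
  assumes "cring S" "cring T" "h \<in> ring_hom S T"
  shows "h (nat_elem S n) = nat_elem T n"
proof -
  interpret S: cring S by fact
  interpret T: cring T by fact
  interpret ring_hom_cring S T h
    by (intro ring_hom_cring.intro ring_hom_cring_axioms.intro assms)
  show ?thesis
  proof (induction n)
    case (Suc n)
    have "h (nat_elem S (Suc n)) = h (nat_elem S n) \<oplus>\<^bsub>T\<^esub> h \<one>\<^bsub>S\<^esub>"
      unfolding S.add.nat_pow_Suc by (rule hom_add) simp_all
    then show ?case
      unfolding Suc T.add.nat_pow_Suc hom_one .
  qed simp
qed

text \<open>\<open>add_pow\<close> is a recursion on the zero and add fields alone, so pointwise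
  operations on the record G already determine it.\<close>

lemma add_pow_pointwise:
  assumes "ring.zero G = (\<lambda>n. \<zero>\<^bsub>H n\<^esub>)" "add G = (\<lambda>v w n. v n \<oplus>\<^bsub>H n\<^esub> w n)"
  shows "add_pow G (k::nat) w n = add_pow (H n) k (w n)"
  using assms by (induction k) (simp_all add: add_pow_def nat_pow_def)

lemma (in module) add_pow_smult:
  assumes "c \<in> carrier R" "x \<in> carrier M"
  shows "add_pow M (k::nat) (c \<odot>\<^bsub>M\<^esub> x) = add_pow R k c \<odot>\<^bsub>M\<^esub> x"
proof (induction k)
  case (Suc k)
  then show ?case
    using assms by (simp add: smult_l_distr)
qed (use assms in simp)

locale padic_algebra = padic A p + R: cring R
  for A :: "('a, 'b) ring_scheme" (structure) and p and R :: "('r, 'n) ring_scheme" and \<iota> :: "'r \<Rightarrow> 'a" +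
  assumes \<iota>_hom: "\<iota> \<in> ring_hom R A"
begin

sublocale RP: padic R p
  by unfold_locales

abbreviation str where "str n \<equiv> padic_structure p \<iota> A n"

lemma str_class:
  assumes r: "r \<in> carrier R"
  shows "str n (RP.J n +>\<^bsub>R\<^esub> r) = J n +> \<iota> r"
  unfolding padic_structure_def
proof (rule coset_map_const)
  have "r \<in> RP.J n +>\<^bsub>R\<^esub> r"
    using r by (rule RP.J.a_rcos_self)
  then show "RP.J n +>\<^bsub>R\<^esub> r \<noteq> {}"
    by blast
  interpret h: ring_hom_cring R A \<iota>
    by (intro ring_hom_cring.intro ring_hom_cring_axioms.intro R.is_cring is_cring \<iota>_hom)
  fix c assume c: "c \<in> RP.J n +>\<^bsub>R\<^esub> r"
  have cR: "c \<in> carrier R"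
    using RP.J.a_elemrcos_carrier[OF r c] .
  have "RP.J n +>\<^bsub>R\<^esub> c = RP.J n +>\<^bsub>R\<^esub> r"
    using R.a_repr_independence[OF c r RP.J.a_subgroup] by simp
  then have "c \<ominus>\<^bsub>R\<^esub> r \<in> RP.J n"
    using RP.J.a_rcos_eq_iff[OF cR r] by simp
  then obtain t where t: "t \<in> carrier R" "c \<ominus>\<^bsub>R\<^esub> r = t \<otimes>\<^bsub>R\<^esub> nat_elem R (p ^ n)"
    unfolding RP.mem_J_iff by blast
  have "\<iota> c \<ominus> \<iota> r = \<iota> (c \<ominus>\<^bsub>R\<^esub> r)"
    using cR r by (simp add: a_minus_def)
  also have "\<dots> = \<iota> t \<otimes> nat_elem A (p ^ n)"
    unfolding t(2) using t(1) by (simp add: ring_hom_nat_elem[OF R.is_cring is_cring \<iota>_hom])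
  finally have "\<iota> c \<ominus> \<iota> r \<in> J n"
    unfolding mem_J_iff using t(1) by blast
  then show "J n +> \<iota> c = J n +> \<iota> r"
    using J.a_rcos_eq_iff cR r by simp
qed

lemma str_closed: "C \<in> carrier (RP.Q n) \<Longrightarrow> str n C \<in> carrier (Q n)"
  unfolding RP.carrier_Q carrier_Q using str_class ring_hom_closed[OF \<iota>_hom] by auto

sublocale K: kaehler_base "Q n" "RP.Q n" "str n" for n
  by unfold_locales (rule str_closed)

abbreviation Om where "Om n \<equiv> omega_level p R \<iota> A n"

sublocale Om: module "Q n" "Om n" for n
  unfolding omega_level_def by (rule K.kaehler_module)

abbreviation dd where "dd n \<equiv> kaehler_d (RP.Q n) (str n) (Q n)"

lemma dd_closed [simp, intro]: "c \<in> carrier (Q n) \<Longrightarrow> dd n c \<in> carrier (Om n)"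
  unfolding omega_level_def by (rule K.d_closed)

lemma dd_add: "c \<in> carrier (Q n) \<Longrightarrow> e \<in> carrier (Q n) \<Longrightarrow> dd n (c \<oplus>\<^bsub>Q n\<^esub> e) = dd n c \<oplus>\<^bsub>Om n\<^esub> dd n e"
  unfolding omega_level_def by (rule K.d_add)

lemma dd_mult: "c \<in> carrier (Q n) \<Longrightarrow> e \<in> carrier (Q n) \<Longrightarrow>
  dd n (c \<otimes>\<^bsub>Q n\<^esub> e) = c \<odot>\<^bsub>Om n\<^esub> dd n e \<oplus>\<^bsub>Om n\<^esub> e \<odot>\<^bsub>Om n\<^esub> dd n c"
  unfolding omega_level_def by (rule K.d_mult)

lemma dd_const:
  assumes "r \<in> carrier R" "pr A c = \<iota> r"
  shows "dd n (q n c) = \<zero>\<^bsub>Om n\<^esub>"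
proof -
  have "RP.J n +>\<^bsub>R\<^esub> r \<in> carrier (RP.Q n)"
    unfolding RP.carrier_Q using assms(1) by blast
  from K.d_const[OF this] show ?thesis
    unfolding omega_level_def str_class[OF assms(1)] q_def assms(2) .
qed

lemma transition_kaehler_hom:
  "kaehler_hom (Q (Suc n)) (RP.Q (Suc n)) (str (Suc n)) (Q n) (RP.Q n) (str n) (padic_transition p A n)"
proof unfold_locales
  show "padic_transition p A n \<in> ring_hom (Q (Suc n)) (Q n)"
    by (rule transition_hom)
  fix C assume "C \<in> carrier (RP.Q (Suc n))"
  then obtain r where r: "r \<in> carrier R" "C = RP.J (Suc n) +>\<^bsub>R\<^esub> r"
    unfolding RP.carrier_Q by blast
  have "\<iota> r \<in> carrier A"
    using ring_hom_closed[OF \<iota>_hom r(1)] .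
  then obtain c where c: "pr A c = \<iota> r"
    using pr_surj[OF is_cring] by blast
  have "padic_transition p A n (str (Suc n) C) = str n (RP.J n +>\<^bsub>R\<^esub> r)"
    unfolding r(2) str_class[OF r(1)] using transition_q[of n c] unfolding q_def c .
  moreover have "RP.J n +>\<^bsub>R\<^esub> r \<in> carrier (RP.Q n)"
    unfolding RP.carrier_Q using r(1) by blast
  ultimately show "\<exists>r'\<in>carrier (RP.Q n). padic_transition p A n (str (Suc n) C) = str n r'"
    by blast
qed

section \<open>Forms g dx on the completion and derivatives with respect to x\<close>

abbreviation Omhat where "Omhat \<equiv> omega_completed p R \<iota> A"

definition form :: "(nat \<Rightarrow> ('a, 'b) uring) \<Rightarrow> ('a, 'b) uring \<Rightarrow> nat \<Rightarrow> ('a set \<Rightarrow> 'a set) set"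
  where "form g x = (\<lambda>n. q n (g n) \<odot>\<^bsub>Om n\<^esub> dd n (q n x))"

lemma form_closed:
  assumes "compat g"
  shows "form g x \<in> carrier Omhat"
proof -
  have "omega_transition p R \<iota> A n (form g x (Suc n)) = form g x n" for n
  proof -
    interpret T: kaehler_hom "Q (Suc n)" "RP.Q (Suc n)" "str (Suc n)" "Q n" "RP.Q n" "str n"
      "padic_transition p A n"
      by (rule transition_kaehler_hom)
    show ?thesis
      unfolding omega_transition_def form_def omega_level_def
      using assms by (simp add: T.kaehler_map_smult_d transition_q compat_def)
  qed
  moreover have "form g x n \<in> carrier (Om n)" for n
    unfolding form_def by (intro Om.smult_closed dd_closed q_closed)
  ultimately show ?thesis
    unfolding omega_completed_def by simp
qed

lemma form_add: "form g x \<oplus>\<^bsub>Omhat\<^esub> form h x = form (\<lambda>n. g n + h n) x"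
  unfolding omega_completed_def form_def
  by (simp add: q_add Om.smult_l_distr)

lemma form_smult: "hat g \<odot>\<^bsub>Omhat\<^esub> form h x = form (\<lambda>n. g n * h n) x"
  unfolding omega_completed_def form_def hat_def
  by (simp add: q_mult Om.smult_assoc1)

lemma form_add_pow: "add_pow Omhat (k::nat) (form g x) = form (\<lambda>n. of_nat k * g n) x"
proof
  fix n
  have "add_pow Omhat k (form g x) n = add_pow (Om n) k (form g x n)"
    by (rule add_pow_pointwise) (simp_all add: omega_completed_def)
  also have "\<dots> = form (\<lambda>n. of_nat k * g n) x n"
    unfolding form_def q_of_nat_mult by (rule Om.add_pow_smult) auto
  finally show "add_pow Omhat k (form g x) n = form (\<lambda>n. of_nat k * g n) x n" .
qed

text \<open>The relation dg = g' dx, required in the differentials of every A/p^n with one and the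
  same g'. This is the interpretation of \<open>der\<close> in
  \<open>frobenius_setup\<close>.\<close>

definition der :: "('a, 'b) uring \<Rightarrow> ('a, 'b) uring \<Rightarrow> ('a, 'b) uring \<Rightarrow> bool"
  where "der x g g' \<longleftrightarrow> (\<forall>n. dd n (q n g) = q n g' \<odot>\<^bsub>Om n\<^esub> dd n (q n x))"

lemma der_add:
  assumes "der x g g'" "der x h h'"
  shows "der x (g + h) (g' + h')"
  using assms unfolding der_def by (simp add: q_add dd_add Om.smult_l_distr)

lemma der_mult:
  assumes "der x g g'" "der x h h'"
  shows "der x (g * h) (g * h' + h * g')"
  using assms unfolding der_def
  by (simp add: q_add q_mult dd_mult Om.smult_l_distr Om.smult_assoc1)

lemma der_const:
  assumes "r \<in> carrier R" "pr A c = \<iota> r"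
  shows "der x c 0"
  unfolding der_def dd_const[OF assms] q_zero by simp

lemma der_self: "der x x 1"
  unfolding der_def q_one by simp

lemma der_cong:
  assumes "der x g g'" "pr A g = pr A h" "pr A g' = pr A h'"
  shows "der x h h'"
  using assms unfolding der_def q_def by simp

lemma der_one: "der x 1 0"
proof (rule der_const[of "\<one>\<^bsub>R\<^esub>"])
  show "pr A 1 = \<iota> \<one>\<^bsub>R\<^esub>"
    using ring_hom_one[OF \<iota>_hom] by (simp add: pr_A_simps)
qed simp

text \<open>In the module, 2 y dy = d(y^2) = s' dx, and \<open>half * z\<close> inverts 2y. The
  computation uses dy itself, since a derivative of y is what is to be produced.\<close>

lemma der_sqrt:
  assumes y: "pr A (y * z) = pr A 1" and sq: "der x (y ^ 2) s'" and half: "pr A (2 * half) = pr A 1"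
  shows "der x y (half * z * s')"
  unfolding der_def
proof
  fix n
  let ?e = "dd n (q n y)"
  have "q n (half * z) \<odot>\<^bsub>Om n\<^esub> (q n y \<odot>\<^bsub>Om n\<^esub> ?e \<oplus>\<^bsub>Om n\<^esub> q n y \<odot>\<^bsub>Om n\<^esub> ?e)
    = q n (half * z * (y + y)) \<odot>\<^bsub>Om n\<^esub> ?e"
    unfolding q_mult[of n "half * z" "y + y"] q_add[of n y y]
    by (simp add: Om.smult_assoc1 Om.smult_l_distr)
  also have "q n (half * z * (y + y)) = q n 1"
  proof (rule q_cong_pr)
    have "half * z * (y + y) = (2 * half) * (y * z)"
      by (simp add: algebra_simps)
    then have "pr A (half * z * (y + y)) = pr A (2 * half) \<otimes> pr A (y * z)"
      by (simp only: pr_A_simps(4))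
    then show "pr A (half * z * (y + y)) = pr A 1"
      unfolding y half by (simp add: pr_A_simps(2))
  qed
  also have "q n 1 \<odot>\<^bsub>Om n\<^esub> ?e = ?e"
    by (simp add: q_one)
  also have "q n y \<odot>\<^bsub>Om n\<^esub> ?e \<oplus>\<^bsub>Om n\<^esub> q n y \<odot>\<^bsub>Om n\<^esub> ?e = q n s' \<odot>\<^bsub>Om n\<^esub> dd n (q n x)"
    using sq unfolding der_def power2_eq_square q_mult by (simp add: dd_mult)
  finally show "?e = q n (half * z * s') \<odot>\<^bsub>Om n\<^esub> dd n (q n x)"
    unfolding q_mult[of n "half * z" s'] by (simp add: Om.smult_assoc1)
qed

text \<open>From d(y z) = d(1) = 0 one gets y dz = - z dy; multiplication by z isolates dz.\<close>

lemma der_inverse: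
  assumes yz: "pr A (y * z) = pr A 1" and y: "der x y y'"
  shows "der x z (- (z * z * y'))"
  unfolding der_def
proof
  fix n
  let ?w = "dd n (q n z)" and ?D = "dd n (q n x)"
  have "dd n (q n (y * z)) = \<zero>\<^bsub>Om n\<^esub>"
    using der_one[of x] unfolding q_cong_pr[OF yz] der_def q_zero by simp
  then have "q n y \<odot>\<^bsub>Om n\<^esub> ?w \<oplus>\<^bsub>Om n\<^esub> q n z \<odot>\<^bsub>Om n\<^esub> (q n y' \<odot>\<^bsub>Om n\<^esub> ?D) = \<zero>\<^bsub>Om n\<^esub>"
    using y unfolding q_mult der_def by (simp add: dd_mult)
  then have "q n z \<odot>\<^bsub>Om n\<^esub> (q n y \<odot>\<^bsub>Om n\<^esub> ?w \<oplus>\<^bsub>Om n\<^esub> q n z \<odot>\<^bsub>Om n\<^esub> (q n y' \<odot>\<^bsub>Om n\<^esub> ?D)) = \<zero>\<^bsub>Om n\<^esub>"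
    by simp
  then have "q n (z * y) \<odot>\<^bsub>Om n\<^esub> ?w \<oplus>\<^bsub>Om n\<^esub> q n (z * z * y') \<odot>\<^bsub>Om n\<^esub> ?D = \<zero>\<^bsub>Om n\<^esub>"
    unfolding q_mult by (simp add: Om.smult_r_distr Om.smult_assoc1)
  then have "?w \<oplus>\<^bsub>Om n\<^esub> q n (z * z * y') \<odot>\<^bsub>Om n\<^esub> ?D = \<zero>\<^bsub>Om n\<^esub>"
    unfolding mult.commute[of z y] q_cong_pr[OF yz] q_one by simp
  then have "?w = \<ominus>\<^bsub>Om n\<^esub> (q n (z * z * y') \<odot>\<^bsub>Om n\<^esub> ?D)"
    by (intro Om.M.minus_equality[symmetric]) simp_all
  then show "?w = q n (- (z * z * y')) \<odot>\<^bsub>Om n\<^esub> ?D"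
    unfolding q_uminus by (simp add: Om.smult_l_minus)
qed

text \<open>The pullback of g dx is the image of g times d of the image of x, re-expressed through
  dx by the derivative y'. The hypothesis \<open>base\<close> makes the induced map on differentials
  respect the constants.\<close>

lemma form_pullback:
  assumes \<psi>: "\<And>n. \<psi> n \<in> ring_hom (Q n) (Q n)"
    and base: "\<And>n r. r \<in> carrier R \<Longrightarrow> \<exists>r'\<in>carrier R. \<psi> n (J n +> \<iota> r) = J n +> \<iota> r'"
    and compat: "\<And>n c. c \<in> carrier (Q (Suc n)) \<Longrightarrow>
      padic_transition p A n (\<psi> (Suc n) c) = \<psi> n (padic_transition p A n c)"
    and g: "\<And>n. \<psi> n (q n (g n)) = q n (h n)"
    and x: "\<And>n. \<psi> n (q n x) = q n y" and y: "der x y y'"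
  shows "omega_pullback p R \<iota> A (lift_endo \<psi>) (form g x) = form (\<lambda>n. h n * y') x"
proof
  fix n
  let ?u = "endo_level p A (lift_endo \<psi>) n"
  have u: "?u c = \<psi> n c" if "c \<in> carrier (Q n)" for c
    using endo_level_lift[OF \<psi> compat that] .
  interpret T: kaehler_hom "Q n" "RP.Q n" "str n" "Q n" "RP.Q n" "str n" ?u
  proof unfold_locales
    show "?u \<in> ring_hom (Q n) (Q n)"
      using \<psi>[of n] by (auto simp: ring_hom_def Pi_iff u)
    fix C assume "C \<in> carrier (RP.Q n)"
    then obtain r where r: "r \<in> carrier R" "C = RP.J n +>\<^bsub>R\<^esub> r"
      unfolding RP.carrier_Q by blast
    obtain r' where r': "r' \<in> carrier R" "\<psi> n (J n +> \<iota> r) = J n +> \<iota> r'"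
      using base[OF r(1)] by blast
    have "J n +> \<iota> r \<in> carrier (Q n)"
      unfolding carrier_Q using ring_hom_closed[OF \<iota>_hom r(1)] by blast
    then have "?u (str n C) = str n (RP.J n +>\<^bsub>R\<^esub> r')"
      unfolding r(2) str_class[OF r(1)] str_class[OF r'(1)] using u r'(2) by simp
    moreover have "RP.J n +>\<^bsub>R\<^esub> r' \<in> carrier (RP.Q n)"
      unfolding RP.carrier_Q using r'(1) by blast
    ultimately show "\<exists>r'\<in>carrier (RP.Q n). ?u (str n C) = str n r'"
      by blast
  qed
  have "omega_pullback p R \<iota> A (lift_endo \<psi>) (form g x) n = q n (h n) \<odot>\<^bsub>Om n\<^esub> dd n (q n y)"
    unfolding omega_pullback_def form_def omega_level_def
    by (simp add: T.kaehler_map_smult_d u g x)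
  also have "dd n (q n y) = q n y' \<odot>\<^bsub>Om n\<^esub> dd n (q n x)"
    using y unfolding der_def by blast
  finally show "omega_pullback p R \<iota> A (lift_endo \<psi>) (form g x) n = form (\<lambda>n. h n * y') x n"
    unfolding form_def q_mult by (simp add: Om.smult_assoc1)
qed

end

section \<open>The coordinate ring of the curve\<close>

lemma UP_extend_hom:
  assumes "cring R" "cring S" "h \<in> ring_hom R S" "s \<in> carrier S"
  obtains k where "k \<in> ring_hom (UP R) S"
    "\<And>r. r \<in> carrier R \<Longrightarrow> k (up_ring.monom (UP R) r 0) = h r" "k (up_ring.monom (UP R) \<one>\<^bsub>R\<^esub> 1) = s"
proof -
  interpret UP_pre_univ_prop R S h "UP R"
    by (intro UP_pre_univ_prop.intro ring_hom_cring.intro ring_hom_cring_axioms.intro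
        UP_cring.intro assms)
  show thesis
    using that[of "UnivPoly.eval R S h s"] eval_ring_hom eval_const eval_monom1 assms(4) by blast
qed

lemma UP_induct_subset:
  assumes "cring R"
    and const: "\<And>r. r \<in> carrier R \<Longrightarrow> up_ring.monom (UP R) r 0 \<in> T" and var: "up_ring.monom (UP R) \<one>\<^bsub>R\<^esub> 1 \<in> T"
    and add: "\<And>f g. f \<in> carrier (UP R) \<Longrightarrow> g \<in> carrier (UP R) \<Longrightarrow> f \<in> T \<Longrightarrow> g \<in> T \<Longrightarrow> f \<oplus>\<^bsub>UP R\<^esub> g \<in> T"
    and mult: "\<And>f g. f \<in> carrier (UP R) \<Longrightarrow> g \<in> carrier (UP R) \<Longrightarrow> f \<in> T \<Longrightarrow> g \<in> T \<Longrightarrow> f \<otimes>\<^bsub>UP R\<^esub> g \<in> T"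
  shows "carrier (UP R) \<subseteq> T"
proof
  interpret UP_cring R "UP R"
    by (intro UP_cring.intro assms)
  have mon: "up_ring.monom (UP R) r n \<in> T" if r: "r \<in> carrier R" for r n
  proof (induction n)
    case (Suc n)
    have "up_ring.monom (UP R) r (Suc n) = up_ring.monom (UP R) r n \<otimes>\<^bsub>UP R\<^esub> up_ring.monom (UP R) \<one>\<^bsub>R\<^esub> 1"
      using monom_mult[of r "\<one>\<^bsub>R\<^esub>" n 1] r by simp
    then show ?case
      using mult[OF _ _ Suc var] r by simp
  qed (use const r in simp)
  fix f assume f: "f \<in> carrier (UP R)"
  have "(\<Oplus>\<^bsub>UP R\<^esub>i\<in>{..n}. up_ring.monom (UP R) (up_ring.coeff (UP R) f i) i) \<in> T" for n
  proof (induction n)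
    case (Suc n)
    then show ?case
      using f mon[of "up_ring.coeff (UP R) f (Suc n)" "Suc n"] by (simp add: add)
  qed (use f mon in simp)
  then show "f \<in> T"
    using up_repr[OF f] by metis
qed

lemma quotient_factor_hom:
  assumes "cring R" "cring S" and I: "ideal I R" and h: "h \<in> ring_hom R S"
    and ker: "\<And>x. x \<in> I \<Longrightarrow> h x = \<zero>\<^bsub>S\<^esub>"
  obtains k where "k \<in> ring_hom (R Quot I) S" "\<And>x. x \<in> carrier R \<Longrightarrow> k (I +>\<^bsub>R\<^esub> x) = h x"
proof -
  interpret R: cring R by fact
  interpret S: cring S by fact
  interpret I: ideal I R by fact
  interpret h: ring_hom_cring R S h
    by (intro ring_hom_cring.intro ring_hom_cring_axioms.intro assms)
  define k where "k C = the_elem (h ` C)" for C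
  have k: "k (I +>\<^bsub>R\<^esub> x) = h x" if x: "x \<in> carrier R" for x
  proof -
    have "h y = h x" if y: "y \<in> I +>\<^bsub>R\<^esub> x" for y
    proof -
      have yR: "y \<in> carrier R"
        using I.a_elemrcos_carrier[OF x y] .
      have "I +>\<^bsub>R\<^esub> y = I +>\<^bsub>R\<^esub> x"
        using R.a_repr_independence[OF y x I.a_subgroup] by simp
      then have "y \<ominus>\<^bsub>R\<^esub> x \<in> I"
        using I.a_rcos_eq_iff[OF yR x] by simp
      then have "h (y \<ominus>\<^bsub>R\<^esub> x) = \<zero>\<^bsub>S\<^esub>"
        by (rule ker)
      then have "h y \<ominus>\<^bsub>S\<^esub> h x = \<zero>\<^bsub>S\<^esub>"
        using yR x by (simp add: a_minus_def)
      then show ?thesis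
        using S.r_right_minus_eq yR x by simp
    qed
    moreover have "x \<in> I +>\<^bsub>R\<^esub> x"
      using I.a_rcos_self[OF x] .
    ultimately have "h ` (I +>\<^bsub>R\<^esub> x) = {h x}"
      by blast
    then show ?thesis
      unfolding k_def by simp
  qed
  have q: "(\<lambda>x. I +>\<^bsub>R\<^esub> x) \<in> ring_hom R (R Quot I)"
    by (rule I.rcos_ring_hom)
  have carr: "carrier (R Quot I) = (\<lambda>x. I +>\<^bsub>R\<^esub> x) ` carrier R"
    unfolding FactRing_def by (auto simp: A_RCOSETS_def')
  have "k \<in> ring_hom (R Quot I) S"
  proof (rule ring_hom_memI)
    fix C assume "C \<in> carrier (R Quot I)"
    then obtain x where x: "x \<in> carrier R" "C = I +>\<^bsub>R\<^esub> x"
      unfolding carr by blast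
    show "k C \<in> carrier S"
      unfolding x(2) k[OF x(1)] using x(1) by simp
    fix D assume "D \<in> carrier (R Quot I)"
    then obtain y where y: "y \<in> carrier R" "D = I +>\<^bsub>R\<^esub> y"
      unfolding carr by blast
    show "k (C \<otimes>\<^bsub>R Quot I\<^esub> D) = k C \<otimes>\<^bsub>S\<^esub> k D"
      unfolding x(2) y(2) ring_hom_mult[OF q x(1) y(1), symmetric] using x(1) y(1) by (simp add: k)
    show "k (C \<oplus>\<^bsub>R Quot I\<^esub> D) = k C \<oplus>\<^bsub>S\<^esub> k D"
      unfolding x(2) y(2) ring_hom_add[OF q x(1) y(1), symmetric] using x(1) y(1) by (simp add: k)
  next
    show "k \<one>\<^bsub>R Quot I\<^esub> = \<one>\<^bsub>S\<^esub>"
      unfolding ring_hom_one[OF q, symmetric] by (simp add: k)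
  qed
  then show thesis
    using that k by blast
qed

lemma UP_monom0_hom:
  assumes "cring R"
  shows "(\<lambda>r. up_ring.monom (UP R) r 0) \<in> ring_hom R (UP R)"
proof -
  interpret UP_cring R "UP R"
    by (intro UP_cring.intro assms)
  show ?thesis
    by (rule const_ring_hom)
qed

lemma UP_is_cring: "cring R \<Longrightarrow> cring (UP R)"
  by (rule UP_cring.UP_cring[OF UP_cring.intro])

locale curve = R: cring R for R :: "('r, 'm) ring_scheme" and a b :: 'r +
  assumes a: "a \<in> carrier R" and b: "b \<in> carrier R"
begin

abbreviation P where "P \<equiv> poly3_ring R"
abbreviation A where "A \<equiv> curve_ring R a b"
abbreviation \<iota> where "\<iota> \<equiv> curve_scalar R a b"
abbreviation cl where "cl \<equiv> curve_class R a b"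
abbreviation x where "x \<equiv> cl (poly3_x R)"
abbreviation y where "y \<equiv> cl (poly3_y R)"
abbreviation z where "z \<equiv> cl (poly3_z R)"

lemma crings: "cring (UP R)" "cring (UP (UP R))" "cring P"
  unfolding poly3_ring_def by (intro UP_is_cring R.is_cring)+

sublocale P: cring P
  by (rule crings)

lemma poly3_const_hom: "poly3_const R \<in> ring_hom R P"
proof -
  have "(\<lambda>r. up_ring.monom P r 0) \<circ> ((\<lambda>r. up_ring.monom (UP (UP R)) r 0) \<circ> (\<lambda>r. up_ring.monom (UP R) r 0)) \<in> ring_hom R P"
    unfolding poly3_ring_def
    by (intro ring_hom_trans[OF ring_hom_trans[OF UP_monom0_hom UP_monom0_hom] UP_monom0_hom]
        R.is_cring crings)
  then show ?thesis
    unfolding poly3_const_def[abs_def] o_def .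
qed

lemma poly3_closed [simp]: "poly3_x R \<in> carrier P" "poly3_y R \<in> carrier P" "poly3_z R \<in> carrier P"
proof -
  interpret U1: UP_cring R "UP R"
    by (intro UP_cring.intro R.is_cring)
  interpret U2: UP_cring "UP R" "UP (UP R)"
    by (intro UP_cring.intro crings)
  interpret U3: UP_cring "UP (UP R)" P
    unfolding poly3_ring_def by (intro UP_cring.intro crings)
  show "poly3_x R \<in> carrier P" "poly3_y R \<in> carrier P" "poly3_z R \<in> carrier P"
    unfolding poly3_x_def poly3_y_def poly3_z_def by simp_all
qed

lemma poly3_const_closed [simp]: "r \<in> carrier R \<Longrightarrow> poly3_const R r \<in> carrier P"
  using ring_hom_closed[OF poly3_const_hom] .

abbreviation relations where "relations \<equiv>
  {poly3_y R [^]\<^bsub>P\<^esub> (2::nat) \<ominus>\<^bsub>P\<^esub>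
     (poly3_x R [^]\<^bsub>P\<^esub> (3::nat) \<oplus>\<^bsub>P\<^esub> poly3_const R a \<otimes>\<^bsub>P\<^esub> poly3_x R \<oplus>\<^bsub>P\<^esub> poly3_const R b),
   poly3_y R \<otimes>\<^bsub>P\<^esub> poly3_z R \<ominus>\<^bsub>P\<^esub> \<one>\<^bsub>P\<^esub>}"

lemma curve_ideal_eq: "curve_ideal R a b = Idl\<^bsub>P\<^esub> relations"
  unfolding curve_ideal_def Let_def ..

lemma relations_closed: "relations \<subseteq> carrier P"
  using a b by auto

sublocale I: ideal "curve_ideal R a b" P
  unfolding curve_ideal_eq by (rule P.genideal_ideal[OF relations_closed])

lemma A_cring: "cring A"
  unfolding curve_ring_def by (rule I.quotient_is_cring[OF P.is_cring])

sublocale A: cring A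
  by (rule A_cring)

lemma cl_hom: "cl \<in> ring_hom P A"
  unfolding curve_class_def[abs_def] curve_ring_def by (rule I.rcos_ring_hom)

sublocale cl: ring_hom_cring P A cl
  by (intro ring_hom_cring.intro ring_hom_cring_axioms.intro P.is_cring A.is_cring cl_hom)

lemma carrier_A: "carrier A = cl ` carrier P"
  unfolding curve_ring_def curve_class_def FactRing_def by (auto simp: A_RCOSETS_def')

lemma \<iota>_hom: "\<iota> \<in> ring_hom R A"
proof -
  have "cl \<circ> poly3_const R \<in> ring_hom R A"
    by (rule ring_hom_trans[OF poly3_const_hom cl_hom])
  then show ?thesis
    unfolding curve_scalar_def[abs_def] o_def .
qed

lemma \<iota>_closed [simp]: "r \<in> carrier R \<Longrightarrow> \<iota> r \<in> carrier A"
  using ring_hom_closed[OF \<iota>_hom] .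

lemma cl_zero: "f \<in> curve_ideal R a b \<Longrightarrow> cl f = \<zero>\<^bsub>A\<^esub>"
  using I.a_rcos_const unfolding curve_class_def curve_ring_def FactRing_def by simp

lemma y_sq: "y [^]\<^bsub>A\<^esub> (2::nat) = x [^]\<^bsub>A\<^esub> (3::nat) \<oplus>\<^bsub>A\<^esub> \<iota> a \<otimes>\<^bsub>A\<^esub> x \<oplus>\<^bsub>A\<^esub> \<iota> b"
proof -
  have "poly3_y R [^]\<^bsub>P\<^esub> (2::nat) \<ominus>\<^bsub>P\<^esub>
     (poly3_x R [^]\<^bsub>P\<^esub> (3::nat) \<oplus>\<^bsub>P\<^esub> poly3_const R a \<otimes>\<^bsub>P\<^esub> poly3_x R \<oplus>\<^bsub>P\<^esub> poly3_const R b)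
     \<in> curve_ideal R a b"
    unfolding curve_ideal_eq by (intro subsetD[OF P.genideal_self[OF relations_closed]]) simp
  from cl_zero[OF this]
  have "y [^]\<^bsub>A\<^esub> (2::nat) \<ominus>\<^bsub>A\<^esub> (x [^]\<^bsub>A\<^esub> (3::nat) \<oplus>\<^bsub>A\<^esub> \<iota> a \<otimes>\<^bsub>A\<^esub> x \<oplus>\<^bsub>A\<^esub> \<iota> b) = \<zero>\<^bsub>A\<^esub>"
    using a b by (simp add: a_minus_def curve_scalar_def)
  then show ?thesis
    using a b by (simp add: A.r_right_minus_eq)
qed

lemma y_z: "y \<otimes>\<^bsub>A\<^esub> z = \<one>\<^bsub>A\<^esub>"
proof -
  have "poly3_y R \<otimes>\<^bsub>P\<^esub> poly3_z R \<ominus>\<^bsub>P\<^esub> \<one>\<^bsub>P\<^esub> \<in> curve_ideal R a b"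
    unfolding curve_ideal_eq by (intro subsetD[OF P.genideal_self[OF relations_closed]]) simp
  from cl_zero[OF this] have "y \<otimes>\<^bsub>A\<^esub> z \<ominus>\<^bsub>A\<^esub> \<one>\<^bsub>A\<^esub> = \<zero>\<^bsub>A\<^esub>"
    by (simp add: a_minus_def)
  then show ?thesis
    by (simp add: A.r_right_minus_eq)
qed

text \<open>The universal property of the coordinate ring: evaluate the three nested polynomial
  rings one variable at a time, observe that the two relations lie in the kernel, and pass to the
  quotient.\<close>

lemma curve_hom:
  assumes S: "cring S" and h: "h \<in> ring_hom R S"
    and xyz: "x' \<in> carrier S" "y' \<in> carrier S" "z' \<in> carrier S"
    and sq: "y' [^]\<^bsub>S\<^esub> (2::nat) = x' [^]\<^bsub>S\<^esub> (3::nat) \<oplus>\<^bsub>S\<^esub> h a \<otimes>\<^bsub>S\<^esub> x' \<oplus>\<^bsub>S\<^esub> h b"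
    and inv: "y' \<otimes>\<^bsub>S\<^esub> z' = \<one>\<^bsub>S\<^esub>"
  obtains k where "k \<in> ring_hom A S" "\<And>r. r \<in> carrier R \<Longrightarrow> k (\<iota> r) = h r"
    "k x = x'" "k y = y'" "k z = z'"
proof -
  interpret S: cring S by fact
  obtain k1 where k1: "k1 \<in> ring_hom (UP R) S"
    "\<And>r. r \<in> carrier R \<Longrightarrow> k1 (up_ring.monom (UP R) r 0) = h r" "k1 (up_ring.monom (UP R) \<one>\<^bsub>R\<^esub> 1) = x'"
    using UP_extend_hom[OF R.is_cring S h xyz(1)] by blast
  obtain k2 where k2: "k2 \<in> ring_hom (UP (UP R)) S"
    "\<And>r. r \<in> carrier (UP R) \<Longrightarrow> k2 (up_ring.monom (UP (UP R)) r 0) = k1 r" "k2 (up_ring.monom (UP (UP R)) \<one>\<^bsub>UP R\<^esub> 1) = y'"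
    using UP_extend_hom[OF crings(1) S k1(1) xyz(2)] by blast
  obtain k3 where k3: "k3 \<in> ring_hom P S"
    "\<And>r. r \<in> carrier (UP (UP R)) \<Longrightarrow> k3 (up_ring.monom P r 0) = k2 r" "k3 (up_ring.monom P \<one>\<^bsub>UP (UP R)\<^esub> 1) = z'"
    using UP_extend_hom[OF crings(2) S k2(1) xyz(3)] unfolding poly3_ring_def by blast
  interpret U1: UP_cring R "UP R"
    by (intro UP_cring.intro R.is_cring)
  interpret U2: UP_cring "UP R" "UP (UP R)"
    by (intro UP_cring.intro crings)
  interpret k3: ring_hom_cring P S k3
    by (intro ring_hom_cring.intro ring_hom_cring_axioms.intro P.is_cring S k3)
  have vals: "k3 (poly3_x R) = x'" "k3 (poly3_y R) = y'" "k3 (poly3_z R) = z'"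
    "\<And>r. r \<in> carrier R \<Longrightarrow> k3 (poly3_const R r) = h r"
    unfolding poly3_x_def poly3_y_def poly3_z_def poly3_const_def
    using k1 k2 k3 by simp_all
  have hcl: "h a \<in> carrier S" "h b \<in> carrier S"
    using ring_hom_closed[OF h] a b by auto
  have "k3 f = \<zero>\<^bsub>S\<^esub>" if "f \<in> curve_ideal R a b" for f
  proof -
    have "ideal (a_kernel P S k3) P"
      by (rule ring_hom_ring.kernel_is_ideal[OF ring_hom_ringI2[OF P.ring_axioms S.ring_axioms k3(1)]])
    moreover have "relations \<subseteq> a_kernel P S k3"
    proof -
      have "k3 (poly3_y R [^]\<^bsub>P\<^esub> (2::nat) \<ominus>\<^bsub>P\<^esub>
        (poly3_x R [^]\<^bsub>P\<^esub> (3::nat) \<oplus>\<^bsub>P\<^esub> poly3_const R a \<otimes>\<^bsub>P\<^esub> poly3_x R \<oplus>\<^bsub>P\<^esub> poly3_const R b)) = \<zero>\<^bsub>S\<^esub>"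
        using a b xyz hcl sq by (simp add: a_minus_def vals S.r_neg)
      moreover have "k3 (poly3_y R \<otimes>\<^bsub>P\<^esub> poly3_z R \<ominus>\<^bsub>P\<^esub> \<one>\<^bsub>P\<^esub>) = \<zero>\<^bsub>S\<^esub>"
        using inv by (simp add: a_minus_def vals S.r_neg)
      ultimately show ?thesis
        using relations_closed unfolding a_kernel_def' by blast
    qed
    ultimately have "curve_ideal R a b \<subseteq> a_kernel P S k3"
      unfolding curve_ideal_eq by (rule P.genideal_minimal)
    then show ?thesis
      using that unfolding a_kernel_def' by blast
  qed
  then obtain k where k: "k \<in> ring_hom A S" "\<And>f. f \<in> carrier P \<Longrightarrow> k (cl f) = k3 f"
    using quotient_factor_hom[OF P.is_cring S I.is_ideal k3(1)]
    unfolding curve_ring_def curve_class_def by blast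
  show thesis
    by (rule that[OF k(1)]) (simp_all add: k(2) vals curve_scalar_def)
qed

text \<open>The ring is generated by scalars and x, y, z. Scalars include -1, so closure under sums
  and products suffices.\<close>

lemma curve_induct:
  assumes T: "\<And>r. r \<in> carrier R \<Longrightarrow> \<iota> r \<in> T" "x \<in> T" "y \<in> T" "z \<in> T"
    and add: "\<And>f g. f \<in> carrier A \<Longrightarrow> g \<in> carrier A \<Longrightarrow> f \<in> T \<Longrightarrow> g \<in> T \<Longrightarrow> f \<oplus>\<^bsub>A\<^esub> g \<in> T"
    and mult: "\<And>f g. f \<in> carrier A \<Longrightarrow> g \<in> carrier A \<Longrightarrow> f \<in> T \<Longrightarrow> g \<in> T \<Longrightarrow> f \<otimes>\<^bsub>A\<^esub> g \<in> T"
  shows "carrier A \<subseteq> T"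
proof -
  interpret U1: UP_cring R "UP R"
    by (intro UP_cring.intro R.is_cring)
  interpret U2: UP_cring "UP R" "UP (UP R)"
    by (intro UP_cring.intro crings)
  interpret U3: UP_cring "UP (UP R)" P
    unfolding poly3_ring_def by (intro UP_cring.intro crings)
  let ?c2 = "\<lambda>f. up_ring.monom P f 0"
  let ?c1 = "\<lambda>f. up_ring.monom P (up_ring.monom (UP (UP R)) f 0) 0"
  have h2: "?c2 \<in> ring_hom (UP (UP R)) P"
    using UP_monom0_hom[OF crings(2)] unfolding poly3_ring_def .
  have h1: "?c1 \<in> ring_hom (UP R) P"
    using ring_hom_trans[OF UP_monom0_hom[OF crings(1)] h2] unfolding o_def .
  have 1: "carrier (UP R) \<subseteq> {f. cl (?c1 f) \<in> T}"
  proof (rule UP_induct_subset[OF R.is_cring])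
    fix r assume "r \<in> carrier R"
    then show "up_ring.monom (UP R) r 0 \<in> {f. cl (?c1 f) \<in> T}"
      using T(1) unfolding curve_scalar_def poly3_const_def by simp
  next
    show "up_ring.monom (UP R) \<one>\<^bsub>R\<^esub> 1 \<in> {f. cl (?c1 f) \<in> T}"
      using T(2) unfolding poly3_x_def by simp
  next
    fix f g assume fg: "f \<in> carrier (UP R)" "g \<in> carrier (UP R)"
      "f \<in> {f. cl (?c1 f) \<in> T}" "g \<in> {f. cl (?c1 f) \<in> T}"
    show "f \<oplus>\<^bsub>UP R\<^esub> g \<in> {f. cl (?c1 f) \<in> T}" "f \<otimes>\<^bsub>UP R\<^esub> g \<in> {f. cl (?c1 f) \<in> T}"
      using fg add mult unfolding mem_Collect_eq ring_hom_add[OF h1 fg(1,2)] ring_hom_mult[OF h1 fg(1,2)]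
      by simp_all
  qed
  have 2: "carrier (UP (UP R)) \<subseteq> {f. cl (?c2 f) \<in> T}"
  proof (rule UP_induct_subset[OF crings(1)])
    fix r assume "r \<in> carrier (UP R)"
    then show "up_ring.monom (UP (UP R)) r 0 \<in> {f. cl (?c2 f) \<in> T}"
      using 1 by blast
  next
    show "up_ring.monom (UP (UP R)) \<one>\<^bsub>UP R\<^esub> 1 \<in> {f. cl (?c2 f) \<in> T}"
      using T(3) unfolding poly3_y_def by simp
  next
    fix f g assume fg: "f \<in> carrier (UP (UP R))" "g \<in> carrier (UP (UP R))"
      "f \<in> {f. cl (?c2 f) \<in> T}" "g \<in> {f. cl (?c2 f) \<in> T}"
    show "f \<oplus>\<^bsub>UP (UP R)\<^esub> g \<in> {f. cl (?c2 f) \<in> T}" "f \<otimes>\<^bsub>UP (UP R)\<^esub> g \<in> {f. cl (?c2 f) \<in> T}"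
      using fg add mult unfolding mem_Collect_eq ring_hom_add[OF h2 fg(1,2)] ring_hom_mult[OF h2 fg(1,2)]
      by simp_all
  qed
  have "carrier P \<subseteq> {f. cl f \<in> T}"
    unfolding poly3_ring_def
  proof (rule UP_induct_subset[OF crings(2)])
    fix r assume "r \<in> carrier (UP (UP R))"
    then show "up_ring.monom (UP (UP (UP R))) r 0 \<in> {f. cl f \<in> T}"
      using 2 unfolding poly3_ring_def by blast
  next
    show "up_ring.monom (UP (UP (UP R))) \<one>\<^bsub>UP (UP R)\<^esub> 1 \<in> {f. cl f \<in> T}"
      using T(4) unfolding poly3_z_def poly3_ring_def by simp
  next
    fix f g assume fg: "f \<in> carrier (UP (UP (UP R)))" "g \<in> carrier (UP (UP (UP R)))"
      "f \<in> {f. cl f \<in> T}" "g \<in> {f. cl f \<in> T}"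
    have fg': "f \<in> carrier P" "g \<in> carrier P"
      using fg unfolding poly3_ring_def by auto
    have "cl (f \<oplus>\<^bsub>P\<^esub> g) \<in> T" "cl (f \<otimes>\<^bsub>P\<^esub> g) \<in> T"
      using fg fg' add mult by simp_all
    then show "f \<oplus>\<^bsub>UP (UP (UP R))\<^esub> g \<in> {f. cl f \<in> T}" "f \<otimes>\<^bsub>UP (UP (UP R))\<^esub> g \<in> {f. cl f \<in> T}"
      unfolding poly3_ring_def by simp_all
  qed
  then show ?thesis
    unfolding carrier_A by blast
qed

end

section \<open>Ordinary curves carry Lie invariant lifts\<close>

text \<open>A relation rather than a map, because the coefficients lie in two different types that
  are compared only after projection to their rings.\<close>

lemma coeff_rel_mult:
  fixes P :: "'a::comm_ring_1 \<Rightarrow> 'b::comm_ring_1 \<Rightarrow> bool"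
  assumes P: "P 0 0" "\<And>x x' y y'. P x x' \<Longrightarrow> P y y' \<Longrightarrow> P (x + y) (x' + y')"
      "\<And>x x' y y'. P x x' \<Longrightarrow> P y y' \<Longrightarrow> P (x * y) (x' * y')"
    and g: "\<And>i. P (poly.coeff g i) (poly.coeff g' i)"
    and h: "\<And>i. P (poly.coeff h i) (poly.coeff h' i)"
  shows "P (poly.coeff (g * h) i) (poly.coeff (g' * h') i)"
proof -
  have "P (sum s S) (sum s' S)" if "\<And>j. P (s j) (s' j)" for s s' and S :: "nat set"
    using that by (induction S rule: infinite_finite_induct) (auto intro: P)
  then show ?thesis
    unfolding coeff_mult by (simp add: P g h)
qed

context padic_algebra
begin

lemma pr_diff_zero_iff: "pr A (g - h) = \<zero> \<longleftrightarrow> pr A g = pr A h"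
  unfolding pr_A_simps(6) by (rule r_right_minus_eq[OF pr_A_closed pr_A_closed])

lemma form_cong: "(\<And>n. q n (g n) = q n (h n)) \<Longrightarrow> form g x = form h x"
  unfolding form_def by simp

text \<open>The coefficient \<open>r w\<close> is already \<open>1/p\<close> times that of the pulled back form.\<close>

lemma form_eigen:
  assumes r: "compat r" and cong: "q 2 (r 2 * w) = q 2 (lam * z)"
  shows "\<exists>\<eta>\<in>carrier Omhat. add_pow Omhat p \<eta> = form (\<lambda>n. r n * (of_nat p * w)) x \<and>
    (\<exists>\<theta>\<in>carrier Omhat. \<eta> = hat (\<lambda>_. lam) \<odot>\<^bsub>Omhat\<^esub> form (\<lambda>_. z) x \<oplus>\<^bsub>Omhat\<^esub> add_pow Omhat (p ^ 2) \<theta>)"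
proof -
  let ?g = "\<lambda>n. r n * w"
  have g: "compat ?g"
    by (intro compat_mult r compat_const)
  then have 1: "form ?g x \<in> carrier Omhat"
    by (rule form_closed)
  have "compat (\<lambda>n. ?g n - lam * z)"
    by (intro compat_minus g compat_const)
  moreover have "q 2 (?g 2 - lam * z) = q 2 0"
    using cong unfolding q_eq_iff by simp
  \<comment> \<open>Agreement at level 2 suffices for divisibility by p^2 in the whole completion,
    by \<open>compat_divisible\<close>.\<close>
  ultimately obtain h where h: "compat h" "hat (\<lambda>n. ?g n - lam * z) = hat (\<lambda>n. of_nat p ^ 2 * h n)"
    using compat_divisible[of "\<lambda>n. ?g n - lam * z" 2] by auto
  have 2: "form h x \<in> carrier Omhat"
    using h(1) by (rule form_closed)
  have 3: "add_pow Omhat p (form ?g x) = form (\<lambda>n. r n * (of_nat p * w)) x"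
    unfolding form_add_pow by (simp add: mult.left_commute)
  have "q n (?g n) = q n (lam * z + of_nat (p ^ 2) * h n)" for n
  proof -
    have "q n (?g n - lam * z) = q n (of_nat p ^ 2 * h n)"
      using fun_cong[OF h(2), of n] unfolding hat_def .
    then have "q n ((?g n - lam * z) + lam * z) = q n (of_nat p ^ 2 * h n + lam * z)"
      unfolding q_add[of n _ "lam * z"] by simp
    then show ?thesis
      by (simp add: add.commute)
  qed
  then have "form ?g x = hat (\<lambda>_. lam) \<odot>\<^bsub>Omhat\<^esub> form (\<lambda>_. z) x \<oplus>\<^bsub>Omhat\<^esub> add_pow Omhat (p ^ 2) (form h x)"
    unfolding form_smult form_add_pow form_add by (rule form_cong)
  with 1 2 3 show ?thesis
    by blast
qed

end

section \<open>Frobenius endomorphisms on the levels of the completion\<close>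

context curve
begin

text \<open>A root of the twisted cubic is given modulo each p^n separately, so each A/p^n gets its
  own endomorphism from the universal property, which factors because p^n is zero in the target.
  Coherence of \<open>s\<close> and \<open>r\<close> gives compatibility with the transition maps;
  it is tested on generators.\<close>

lemma frobenius_levels:
  assumes \<phi>R: "\<phi>\<^sub>R \<in> ring_hom R R"
    and PA: "padic_algebra A R \<iota>"
    and sq: "\<And>n. padic.q A p n (s n ^ 2) = padic.q A p n (u ^ 3 + a' * u + b')"
    and inv: "\<And>n. padic.q A p n (s n * r n) = padic.q A p n 1"
    and a': "pr A a' = \<iota> (\<phi>\<^sub>R a)" and b': "pr A b' = \<iota> (\<phi>\<^sub>R b)"
    and s: "\<And>n. padic.q A p n (s (Suc n)) = padic.q A p n (s n)"
    and r: "\<And>n. padic.q A p n (r (Suc n)) = padic.q A p n (r n)"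
  obtains \<psi> where "\<And>n. \<psi> n \<in> ring_hom (padic_quot p A n) (padic_quot p A n)"
    "\<And>n c. c \<in> carrier R \<Longrightarrow> \<psi> n (padic_ideal p A n +>\<^bsub>A\<^esub> \<iota> c) = padic_ideal p A n +>\<^bsub>A\<^esub> \<iota> (\<phi>\<^sub>R c)"
    "\<And>n. \<psi> n (padic_ideal p A n +>\<^bsub>A\<^esub> x) = padic.q A p n u"
    "\<And>n. \<psi> n (padic_ideal p A n +>\<^bsub>A\<^esub> y) = padic.q A p n (s n)"
    "\<And>n. \<psi> n (padic_ideal p A n +>\<^bsub>A\<^esub> z) = padic.q A p n (r n)"
    "\<And>n c. c \<in> carrier (padic_quot p A (Suc n)) \<Longrightarrow>
      padic_transition p A n (\<psi> (Suc n) c) = \<psi> n (padic_transition p A n c)"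
proof -
  interpret PA: padic_algebra A p R \<iota> by fact
  have "\<forall>n. \<exists>k. k \<in> ring_hom (PA.Q n) (PA.Q n) \<and> (\<forall>c\<in>carrier R. k (PA.J n +>\<^bsub>A\<^esub> \<iota> c) = PA.J n +>\<^bsub>A\<^esub> \<iota> (\<phi>\<^sub>R c)) \<and>
    k (PA.J n +>\<^bsub>A\<^esub> x) = PA.q n u \<and> k (PA.J n +>\<^bsub>A\<^esub> y) = PA.q n (s n) \<and> k (PA.J n +>\<^bsub>A\<^esub> z) = PA.q n (r n)"
    (is "\<forall>n. ?ex n")
  proof
    fix n
    let ?h = "\<lambda>c. PA.J n +>\<^bsub>A\<^esub> \<iota> (\<phi>\<^sub>R c)"
    have h: "?h \<in> ring_hom R (PA.Q n)"
      using ring_hom_trans[OF ring_hom_trans[OF \<phi>R \<iota>_hom] PA.class_hom] unfolding o_def .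
    have h_ab: "?h a = PA.q n a'" "?h b = PA.q n b'"
      unfolding PA.q_def a' b' by simp_all
    obtain k0 where k0: "k0 \<in> ring_hom A (PA.Q n)" "\<And>c. c \<in> carrier R \<Longrightarrow> k0 (\<iota> c) = ?h c"
      "k0 x = PA.q n u" "k0 y = PA.q n (s n)" "k0 z = PA.q n (r n)"
    proof (rule curve_hom[OF PA.Q.is_cring h, of "PA.q n u" "PA.q n (s n)" "PA.q n (r n)"])
      show "PA.q n (s n) [^]\<^bsub>PA.Q n\<^esub> (2::nat)
        = PA.q n u [^]\<^bsub>PA.Q n\<^esub> (3::nat) \<oplus>\<^bsub>PA.Q n\<^esub> ?h a \<otimes>\<^bsub>PA.Q n\<^esub> PA.q n u \<oplus>\<^bsub>PA.Q n\<^esub> ?h b"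
        unfolding h_ab using sq[of n] unfolding PA.q_add PA.q_mult PA.q_power .
      show "PA.q n (s n) \<otimes>\<^bsub>PA.Q n\<^esub> PA.q n (r n) = \<one>\<^bsub>PA.Q n\<^esub>"
        using inv[of n] unfolding PA.q_mult PA.q_one .
    qed auto
    interpret k0: ring_hom_cring A "PA.Q n" k0
      by (intro ring_hom_cring.intro ring_hom_cring_axioms.intro A.is_cring PA.Q.is_cring k0)
    have "k0 f = \<zero>\<^bsub>PA.Q n\<^esub>" if "f \<in> PA.J n" for f
    proof -
      obtain t where t: "t \<in> carrier A" "f = t \<otimes>\<^bsub>A\<^esub> nat_elem A (p ^ n)"
        using \<open>f \<in> PA.J n\<close> unfolding PA.mem_J_iff by blast
      have "nat_elem (PA.Q n) (p ^ n) = PA.q n (of_nat (p ^ n) * 1)"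
        unfolding PA.q_of_nat_mult PA.q_one ..
      also have "\<dots> = PA.q n 0"
        by (rule PA.q_pI[where t = 1]) simp
      finally show ?thesis
        unfolding t(2) using t(1)
        by (simp add: ring_hom_nat_elem[OF A.is_cring PA.Q.is_cring k0(1)] PA.q_zero)
    qed
    then obtain k where k: "k \<in> ring_hom (PA.Q n) (PA.Q n)" "\<And>f. f \<in> carrier A \<Longrightarrow> k (PA.J n +>\<^bsub>A\<^esub> f) = k0 f"
      using quotient_factor_hom[OF A.is_cring PA.Q.is_cring PA.J.is_ideal k0(1)]
      unfolding padic_quot_def by blast
    then show "?ex n"
      using k0 by (intro exI[of _ k]) simp
  qed
  from choice[OF this] obtain \<psi> where \<psi>: "\<And>n. \<psi> n \<in> ring_hom (PA.Q n) (PA.Q n)"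
    "\<And>n c. c \<in> carrier R \<Longrightarrow> \<psi> n (PA.J n +>\<^bsub>A\<^esub> \<iota> c) = PA.J n +>\<^bsub>A\<^esub> \<iota> (\<phi>\<^sub>R c)"
    "\<And>n. \<psi> n (PA.J n +>\<^bsub>A\<^esub> x) = PA.q n u" "\<And>n. \<psi> n (PA.J n +>\<^bsub>A\<^esub> y) = PA.q n (s n)"
    "\<And>n. \<psi> n (PA.J n +>\<^bsub>A\<^esub> z) = PA.q n (r n)"
    by blast
  have tr: "padic_transition p A n (PA.J (Suc n) +>\<^bsub>A\<^esub> f) = PA.J n +>\<^bsub>A\<^esub> f" if f: "f \<in> carrier A" for n f
  proof -
    obtain g where g: "pr A g = f"
      using pr_surj[OF A.is_cring f] by blast
    show ?thesis
      using PA.transition_q[of n g] unfolding PA.q_def g .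
  qed
  have "padic_transition p A n (\<psi> (Suc n) c) = \<psi> n (padic_transition p A n c)"
    if c: "c \<in> carrier (PA.Q (Suc n))" for n c
  proof -
    let ?T = "{f. padic_transition p A n (\<psi> (Suc n) (PA.J (Suc n) +>\<^bsub>A\<^esub> f)) = \<psi> n (PA.J n +>\<^bsub>A\<^esub> f)}"
    have h1: "(padic_transition p A n \<circ> (\<psi> (Suc n) \<circ> (\<lambda>f. PA.J (Suc n) +>\<^bsub>A\<^esub> f))) \<in> ring_hom A (PA.Q n)"
      by (rule ring_hom_trans[OF ring_hom_trans[OF PA.class_hom \<psi>(1)] PA.transition_hom])
    have h2: "\<psi> n \<circ> (\<lambda>f. PA.J n +>\<^bsub>A\<^esub> f) \<in> ring_hom A (PA.Q n)"
      by (rule ring_hom_trans[OF PA.class_hom \<psi>(1)])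
    have "carrier A \<subseteq> ?T"
    proof (rule curve_induct)
      fix d assume d: "d \<in> carrier R"
      then have "\<phi>\<^sub>R d \<in> carrier R"
        using ring_hom_closed[OF \<phi>R] by blast
      then show "\<iota> d \<in> ?T"
        using d by (simp add: \<psi>(2) tr)
    next
      show "x \<in> ?T" "y \<in> ?T" "z \<in> ?T"
        by (simp_all add: \<psi>(3-5) PA.transition_q s r)
    next
      fix f g assume fg: "f \<in> carrier A" "g \<in> carrier A" "f \<in> ?T" "g \<in> ?T"
      show "f \<oplus>\<^bsub>A\<^esub> g \<in> ?T"
        using fg(3,4) ring_hom_add[OF h1 fg(1,2)] ring_hom_add[OF h2 fg(1,2)] by simp
      show "f \<otimes>\<^bsub>A\<^esub> g \<in> ?T"
        using fg(3,4) ring_hom_mult[OF h1 fg(1,2)] ring_hom_mult[OF h2 fg(1,2)] by simp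
    qed
    moreover obtain f where f: "f \<in> carrier A" "c = PA.J (Suc n) +>\<^bsub>A\<^esub> f"
      using c unfolding PA.carrier_Q by blast
    ultimately show ?thesis
      unfolding f(2) tr[OF f(1)] by blast
  qed
  then show thesis
    using that[of \<psi>] \<psi> by blast
qed

text \<open>Modulo p the p-th power map is additive by \<open>frob_defect\<close> and
  multiplicative, so agreement with a ring homomorphism may be tested on generators.\<close>

lemma frobenius_level_one:
  assumes p: "Factorial_Ring.prime p" and PA: "padic_algebra A R \<iota>"
    and \<psi>: "\<psi> \<in> ring_hom (padic_quot p A 1) (padic_quot p A 1)"
    and gens: "\<And>c. c \<in> carrier R \<Longrightarrow>
        \<psi> (padic_ideal p A 1 +>\<^bsub>A\<^esub> \<iota> c) = (padic_ideal p A 1 +>\<^bsub>A\<^esub> \<iota> c) [^]\<^bsub>padic_quot p A 1\<^esub> p"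
      "\<And>v. v \<in> {x, y, z} \<Longrightarrow>
        \<psi> (padic_ideal p A 1 +>\<^bsub>A\<^esub> v) = (padic_ideal p A 1 +>\<^bsub>A\<^esub> v) [^]\<^bsub>padic_quot p A 1\<^esub> p"
    and c: "c \<in> carrier (padic_quot p A 1)"
  shows "\<psi> c = c [^]\<^bsub>padic_quot p A 1\<^esub> p"
proof -
  interpret PA: padic_algebra A p R \<iota> by fact
  let ?T = "{f. \<psi> (PA.J 1 +>\<^bsub>A\<^esub> f) = (PA.J 1 +>\<^bsub>A\<^esub> f) [^]\<^bsub>PA.Q 1\<^esub> p}"
  have h: "\<psi> \<circ> (\<lambda>f. PA.J 1 +>\<^bsub>A\<^esub> f) \<in> ring_hom A (PA.Q 1)"
    by (rule ring_hom_trans[OF PA.class_hom \<psi>])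
  have "carrier A \<subseteq> ?T"
  proof (rule curve_induct)
    fix f g assume fg: "f \<in> carrier A" "g \<in> carrier A" "f \<in> ?T" "g \<in> ?T"
    obtain f' where f': "pr A f' = f"
      using pr_surj[OF A.is_cring fg(1)] by blast
    obtain g' where g': "pr A g' = g"
      using pr_surj[OF A.is_cring fg(2)] by blast
    have qf: "PA.J 1 +>\<^bsub>A\<^esub> f = PA.q 1 f'" "PA.J 1 +>\<^bsub>A\<^esub> g = PA.q 1 g'"
      "PA.J 1 +>\<^bsub>A\<^esub> (f \<oplus>\<^bsub>A\<^esub> g) = PA.q 1 (f' + g')" "PA.J 1 +>\<^bsub>A\<^esub> (f \<otimes>\<^bsub>A\<^esub> g) = PA.q 1 (f' * g')"
      unfolding PA.q_def PA.pr_A_simps(3,4) f' g' by simp_all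
    have "PA.q 1 ((f' + g') ^ p) = PA.q 1 (f' ^ p + g' ^ p)"
      by (rule PA.q_pI[where t = "frob_defect p f' g'"]) (simp add: frob_defect[OF p])
    then show "f \<oplus>\<^bsub>A\<^esub> g \<in> ?T"
      using fg(3,4) ring_hom_add[OF h fg(1,2)] unfolding mem_Collect_eq o_def qf PA.q_power[symmetric]
      by (simp add: PA.q_add)
    show "f \<otimes>\<^bsub>A\<^esub> g \<in> ?T"
      using fg(3,4) ring_hom_mult[OF h fg(1,2)] unfolding mem_Collect_eq o_def qf PA.q_power[symmetric]
      by (simp add: PA.q_mult power_mult_distrib)
  qed (use gens in auto)
  moreover obtain f where f: "f \<in> carrier A" "c = PA.J 1 +>\<^bsub>A\<^esub> f"
    using c unfolding PA.carrier_Q by blast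
  ultimately show ?thesis
    by blast
qed

text \<open>The lifts \<open>a0\<close> and \<open>b0\<close> of a and b allow the Hasse invariant
  to be formed as a coefficient of a polynomial over a type; \<open>l\<close> is its inverse in R.
  \<open>units\<close> and \<open>roots\<close> record what the residue characteristic and the
  algebraically closed residue field provide.\<close>

theorem ordinary_lie_invariant:
  assumes p: "Factorial_Ring.prime p" "p \<ge> 5"
    and \<phi>R: "frobenius_lift p R \<phi>\<^sub>R"
    and units: "\<And>n. \<not> p dvd n \<Longrightarrow> \<exists>r\<in>carrier R. nat_elem R n \<otimes>\<^bsub>R\<^esub> r = \<one>\<^bsub>R\<^esub>"
    and roots: "\<And>c. c \<in> carrier R \<Longrightarrow>
      \<exists>r\<in>carrier R. \<exists>t\<in>carrier R. c = r [^]\<^bsub>R\<^esub> p \<oplus>\<^bsub>R\<^esub> nat_elem R p \<otimes>\<^bsub>R\<^esub> t"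
    and ab0: "pr R a0 = a" "pr R b0 = b"
    and l: "l \<in> carrier R"
      "l \<otimes>\<^bsub>R\<^esub> pr R (poly.coeff ([:b0, a0, 0, 1:] ^ ((p - 1) div 2)) (p - 1)) = \<one>\<^bsub>R\<^esub>"
  shows "\<exists>\<phi>. curve_frobenius_lift p R \<phi>\<^sub>R a b \<phi> \<and> lie_invariant p R a b \<phi> 2"
proof -
  have PA: "padic_algebra A R \<iota>"
    by (intro padic_algebra.intro padic_algebra_axioms.intro padic.intro A.is_cring R.is_cring \<iota>_hom)
  interpret PA: padic_algebra A p R \<iota> by (rule PA)
  interpret \<iota>: ring_hom_cring R A \<iota>
    by (intro ring_hom_cring.intro ring_hom_cring_axioms.intro R.is_cring A.is_cring \<iota>_hom)
  have lift: "\<exists>g. pr A g = f" if "f \<in> carrier A" for f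
    using pr_surj[OF A.is_cring that] by blast
  have xyz: "x \<in> carrier A" "y \<in> carrier A" "z \<in> carrier A"
    by simp_all
  obtain \<xi> where \<xi>: "pr A \<xi> = x" using lift[OF xyz(1)] by blast
  obtain \<eta> where \<eta>: "pr A \<eta> = y" using lift[OF xyz(2)] by blast
  obtain \<zeta> where \<zeta>: "pr A \<zeta> = z" using lift[OF xyz(3)] by blast
  obtain ea where ea: "pr A ea = \<iota> a" using lift[OF \<iota>_closed[OF a]] by blast
  obtain eb where eb: "pr A eb = \<iota> b" using lift[OF \<iota>_closed[OF b]] by blast
  have "\<not> p dvd 2"
    using p(2) by (auto dest: dvd_imp_le)
  then obtain half0 where half0: "half0 \<in> carrier R" "nat_elem R 2 \<otimes>\<^bsub>R\<^esub> half0 = \<one>\<^bsub>R\<^esub>"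
    using units by blast
  obtain half where half: "pr A half = \<iota> half0" using lift[OF \<iota>_closed[OF half0(1)]] by blast
  note nat_\<iota> = ring_hom_nat_elem[OF R.is_cring A.is_cring \<iota>_hom]
  note prA = PA.pr_A_simps
  have mult_nat: "pr A (of_nat n * g) = nat_elem A n \<otimes>\<^bsub>A\<^esub> pr A g" for n g
    by (simp only: prA(4,9))
  have half1: "pr A (2 * half) = pr A 1"
  proof -
    have "pr A (2 * half) = \<iota> (nat_elem R 2 \<otimes>\<^bsub>R\<^esub> half0)"
      using mult_nat[of 2 half] half half0(1) by (simp add: nat_\<iota>)
    then show ?thesis
      unfolding half0(2) by (simp add: prA(2))
  qed
  have yz1: "pr A (\<eta> * \<zeta>) = pr A 1"
    by (simp add: prA(2,4) \<eta> \<zeta> y_z)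
  have ysq1: "pr A (\<eta> ^ 2) = pr A (\<xi> ^ 3 + ea * \<xi> + eb)"
    by (simp add: prA(3,4,7) \<eta> \<xi> ea eb y_sq)

  define I where "I = {g. pr A g = \<zero>\<^bsub>A\<^esub>}"
  define C where "C = {g. \<exists>r\<in>carrier R. pr A g = \<iota> r}"
  let ?der = "PA.der \<xi>"
  have I_diff: "g - h \<in> I \<longleftrightarrow> pr A g = pr A h" for g h
    unfolding I_def by (simp add: PA.pr_diff_zero_iff)
  have der_C: "?der c 0" if "c \<in> C" for c
    using that PA.der_const unfolding C_def by blast
  have CI: "g \<in> C" if "pr A g = \<iota> r" "r \<in> carrier R" for g r
    using that unfolding C_def by blast
  have C_one: "1 \<in> C"
    by (rule CI[of _ "\<one>\<^bsub>R\<^esub>"]) (simp_all add: prA(2))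
  have C_add: "g + h \<in> C" and C_mult: "g * h \<in> C" if "g \<in> C" "h \<in> C" for g h
  proof -
    from that obtain r t where rt: "r \<in> carrier R" "t \<in> carrier R" "pr A g = \<iota> r" "pr A h = \<iota> t"
      unfolding C_def by blast
    show "g + h \<in> C"
      using rt by (intro CI[of _ "r \<oplus>\<^bsub>R\<^esub> t"]) (simp_all add: prA(3))
    show "g * h \<in> C"
      using rt by (intro CI[of _ "r \<otimes>\<^bsub>R\<^esub> t"]) (simp_all add: prA(4))
  qed
  have C_uminus: "- g \<in> C" if "g \<in> C" for g
  proof -
    from that obtain r where r: "r \<in> carrier R" "pr A g = \<iota> r"
      unfolding C_def by blast
    then show ?thesis
      by (intro CI[of _ "\<ominus>\<^bsub>R\<^esub> r"]) (simp_all add: prA(5))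
  qed
  have der_f: "?der (\<xi> ^ 3 + ea * \<xi> + eb) (3 * \<xi> ^ 2 + ea)"
  proof -
    have ea_C: "ea \<in> C" "eb \<in> C"
      using CI ea eb a b by auto
    have "?der (\<xi> * (\<xi> * \<xi>) + ea * \<xi> + eb) (\<xi> * (\<xi> * 1 + \<xi> * 1) + \<xi> * \<xi> * 1 + (ea * 1 + \<xi> * 0) + 0)"
      by (intro PA.der_add PA.der_mult PA.der_self der_C ea_C)
    moreover have "\<xi> * (\<xi> * \<xi>) + ea * \<xi> + eb = \<xi> ^ 3 + ea * \<xi> + eb"
      by (simp add: power3_eq_cube mult.assoc)
    moreover have "\<xi> * (\<xi> * 1 + \<xi> * 1) + \<xi> * \<xi> * 1 + (ea * 1 + \<xi> * 0) + 0 = 3 * \<xi> ^ 2 + ea"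
      by (simp add: power2_eq_square algebra_simps)
    ultimately show ?thesis
      by (simp only:)
  qed
  have der_\<eta>: "?der \<eta> (half * \<zeta> * (3 * \<xi> ^ 2 + ea))"
    by (rule PA.der_sqrt[OF yz1 _ half1]) (rule PA.der_cong[OF der_f ysq1[symmetric] refl])
  have der_\<zeta>: "?der \<zeta> (- (half * \<zeta> ^ 3 * (3 * \<xi> ^ 2 + ea)))"
    using PA.der_inverse[OF yz1 der_\<eta>] by (simp add: power3_eq_cube mult_ac)
  \<comment> \<open>Every element has a derivative since the generators do and the differentiable
    elements are closed under sums and products. The setup uses this to differentiate an arbitrary q
    in q^p s.\<close>
  have der_ex: "\<exists>g'. ?der g g'" for g
  proof -
    let ?T = "{f. \<exists>g g'. pr A g = f \<and> ?der g g'}"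
    have "carrier A \<subseteq> ?T"
    proof (rule curve_induct)
      fix r assume r: "r \<in> carrier R"
      then obtain g where "pr A g = \<iota> r"
        using lift by blast
      then show "\<iota> r \<in> ?T"
        using PA.der_const[OF r] by blast
    next
      show "x \<in> ?T" "y \<in> ?T" "z \<in> ?T"
        using \<xi> \<eta> \<zeta> PA.der_self der_\<eta> der_\<zeta> by blast+
    next
      fix f1 f2 assume "f1 \<in> ?T" "f2 \<in> ?T"
      then obtain g1 g1' g2 g2' where g: "pr A g1 = f1" "?der g1 g1'" "pr A g2 = f2" "?der g2 g2'"
        by blast
      have "pr A (g1 + g2) = f1 \<oplus>\<^bsub>A\<^esub> f2" "pr A (g1 * g2) = f1 \<otimes>\<^bsub>A\<^esub> f2"
        by (simp_all add: prA(3,4) g)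
      then show "f1 \<oplus>\<^bsub>A\<^esub> f2 \<in> ?T" "f1 \<otimes>\<^bsub>A\<^esub> f2 \<in> ?T"
        using PA.der_add[OF g(2,4)] PA.der_mult[OF g(2,4)] by blast+
    qed
    then obtain h g' where "pr A h = pr A g" "?der h g'"
      using PA.pr_A_closed[of g] by blast
    then show ?thesis
      using PA.der_cong by blast
  qed

  interpret FS: frobenius_setup p I C ?der \<xi> \<eta> \<zeta> ea eb half
  proof
    show "0 \<in> I"
      unfolding I_def by (simp add: prA(1))
    show "g + h \<in> I" if "g \<in> I" "h \<in> I" for g h
      using that unfolding I_def by (simp add: prA(3))
    show "t * g \<in> I" if "g \<in> I" for g t
      using that unfolding I_def by (simp add: prA(4))
    show "\<exists>r\<in>C. of_nat n * r - 1 \<in> I" if n: "\<not> p dvd n" for n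
    proof -
      obtain r where r: "r \<in> carrier R" "nat_elem R n \<otimes>\<^bsub>R\<^esub> r = \<one>\<^bsub>R\<^esub>"
        using units[OF n] by blast
      obtain g where g: "pr A g = \<iota> r"
        using lift[OF \<iota>_closed[OF r(1)]] by blast
      have "pr A (of_nat n * g) = \<iota> (nat_elem R n \<otimes>\<^bsub>R\<^esub> r)"
        unfolding mult_nat g using r(1) by (simp add: nat_\<iota>)
      then have "of_nat n * g - 1 \<in> I"
        unfolding I_diff r(2) by (simp add: prA(2))
      then show ?thesis
        using CI[OF g r(1)] by blast
    qed
    show "\<exists>r\<in>C. \<exists>t. c - r ^ p - of_nat p * t \<in> I" if c: "c \<in> C" for c
    proof -
      obtain c0 where c0: "c0 \<in> carrier R" "pr A c = \<iota> c0"
        using c unfolding C_def by blast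
      obtain r t where rt: "r \<in> carrier R" "t \<in> carrier R" "c0 = r [^]\<^bsub>R\<^esub> p \<oplus>\<^bsub>R\<^esub> nat_elem R p \<otimes>\<^bsub>R\<^esub> t"
        using roots[OF c0(1)] by blast
      obtain g where g: "pr A g = \<iota> r"
        using lift[OF \<iota>_closed[OF rt(1)]] by blast
      obtain h where h: "pr A h = \<iota> t"
        using lift[OF \<iota>_closed[OF rt(2)]] by blast
      have "pr A c = pr A (g ^ p + of_nat p * h)"
        unfolding c0(2) rt(3) prA(3) mult_nat prA(7) g h using rt(1,2) by (simp add: nat_\<iota>)
      then have "c - (g ^ p + of_nat p * h) \<in> I"
        unfolding I_diff .
      then have "c - g ^ p - of_nat p * h \<in> I"
        by (simp add: diff_diff_eq)
      then show ?thesis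
        using CI[OF g rt(1)] by blast
    qed
    show "?der g h'" if "?der g g'" "g' - h' \<in> I" for g g' h'
      using PA.der_cong[OF that(1) refl] that(2) unfolding I_diff by blast
    show "ea \<in> C" "eb \<in> C" "half \<in> C"
      using CI ea eb half a b half0(1) by auto
    show "2 * half - 1 \<in> I" "\<eta> * \<zeta> - 1 \<in> I" "\<eta> ^ 2 - (\<xi> ^ 3 + ea * \<xi> + eb) \<in> I"
      unfolding I_diff by (fact half1 yz1 ysq1)+
  qed (fact p C_one C_add C_mult C_uminus der_C der_ex der_\<zeta> PA.der_add PA.der_mult PA.der_self)+

  have cg: "FS.cg n g h \<longleftrightarrow> PA.q n g = PA.q n h" for n g h
    unfolding FS.cg_def PA.q_eq_iff unfolding I_def by simp

  have \<phi>_hom: "\<phi>\<^sub>R \<in> ring_hom R R"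
    using \<phi>R unfolding frobenius_lift_def by blast
  have \<phi>_lift: "\<exists>t\<in>carrier R. \<phi>\<^sub>R c = c [^]\<^bsub>R\<^esub> p \<oplus>\<^bsub>R\<^esub> nat_elem R p \<otimes>\<^bsub>R\<^esub> t" if c: "c \<in> carrier R" for c
  proof -
    have "\<phi>\<^sub>R c \<ominus>\<^bsub>R\<^esub> c [^]\<^bsub>R\<^esub> p \<in> PIdl\<^bsub>R\<^esub> (nat_elem R p)"
      using \<phi>R c unfolding frobenius_lift_def by blast
    then obtain t where t: "t \<in> carrier R" "\<phi>\<^sub>R c \<ominus>\<^bsub>R\<^esub> c [^]\<^bsub>R\<^esub> p = t \<otimes>\<^bsub>R\<^esub> nat_elem R p"
      unfolding cgenideal_def by blast
    have \<phi>c: "\<phi>\<^sub>R c \<in> carrier R"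
      using ring_hom_closed[OF \<phi>_hom c] .
    have "\<phi>\<^sub>R c = c [^]\<^bsub>R\<^esub> p \<oplus>\<^bsub>R\<^esub> (\<phi>\<^sub>R c \<ominus>\<^bsub>R\<^esub> c [^]\<^bsub>R\<^esub> p)"
      using c \<phi>c by (simp add: a_minus_def R.a_lcomm R.r_neg)
    then show ?thesis
      unfolding t(2) using t(1) by (auto simp: R.m_comm)
  qed
  have \<phi>_lift_A: "\<exists>\<alpha>\<in>C. pr A (g ^ p + of_nat p * \<alpha>) = \<iota> (\<phi>\<^sub>R c)" if c: "c \<in> carrier R" and g: "pr A g = \<iota> c" for c g
  proof -
    obtain t where t: "t \<in> carrier R" "\<phi>\<^sub>R c = c [^]\<^bsub>R\<^esub> p \<oplus>\<^bsub>R\<^esub> nat_elem R p \<otimes>\<^bsub>R\<^esub> t"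
      using \<phi>_lift[OF c] by blast
    obtain \<alpha> where \<alpha>: "pr A \<alpha> = \<iota> t"
      using lift[OF \<iota>_closed[OF t(1)]] by blast
    have "pr A (g ^ p + of_nat p * \<alpha>) = \<iota> (\<phi>\<^sub>R c)"
      unfolding t(2) prA(3) mult_nat prA(7) g \<alpha> using t(1) c by (simp add: nat_\<iota>)
    then show ?thesis
      using CI[OF \<alpha> t(1)] by blast
  qed
  obtain \<alpha> where \<alpha>: "\<alpha> \<in> C" "pr A (ea ^ p + of_nat p * \<alpha>) = \<iota> (\<phi>\<^sub>R a)"
    using \<phi>_lift_A[OF a ea] by blast
  obtain \<beta> where \<beta>: "\<beta> \<in> C" "pr A (eb ^ p + of_nat p * \<beta>) = \<iota> (\<phi>\<^sub>R b)"
    using \<phi>_lift_A[OF b eb] by blast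

  obtain lam0 where lam0: "pr A lam0 = \<iota> l"
    using lift[OF \<iota>_closed[OF l(1)]] by blast
  \<comment> \<open>Transports the Hasse invariant from the type over R to the type over the curve
    ring: \<iota> of one projection equals the other, coefficient by coefficient and power by
    power.\<close>
  have H: "pr A (poly.coeff (FS.f_poly ^ FS.m) (p - 1))
    = \<iota> (pr R (poly.coeff ([:b0, a0, 0, 1:] ^ ((p - 1) div 2)) (p - 1)))"
  proof -
    let ?P = "\<lambda>g h. pr A h = \<iota> (pr R g)"
    note prR = pr_simps[OF R.is_cring]
    have P: "?P 0 0" "?P 1 1" "\<And>g g' h h'. ?P g g' \<Longrightarrow> ?P h h' \<Longrightarrow> ?P (g + h) (g' + h')"
      "\<And>g g' h h'. ?P g g' \<Longrightarrow> ?P h h' \<Longrightarrow> ?P (g * h) (g' * h')"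
      using pr_closed[OF R.is_cring] by (simp_all add: prA(1-4) prR)
    have base: "?P (poly.coeff [:b0, a0, 0, 1:] i) (poly.coeff FS.f_poly i)" for i
      unfolding FS.f_poly_def using ea eb ab0 P(1,2) by (simp add: coeff_pCons split: nat.split)
    have "?P (poly.coeff ([:b0, a0, 0, 1:] ^ k) i) (poly.coeff (FS.f_poly ^ k) i)" for k i
    proof (induction k arbitrary: i)
      case 0
      then show ?case
        using P(1,2) by (cases i) (simp_all add: coeff_1)
    next
      case (Suc k)
      show ?case
        unfolding power_Suc using coeff_rel_mult[of ?P, OF P(1,3,4) base Suc] .
    qed
    then show ?thesis
      unfolding FS.m_def .
  qed
  have "lam0 * poly.coeff (FS.f_poly ^ FS.m) (p - 1) - 1 \<in> I"
    unfolding I_diff prA(4) H lam0 using l pr_closed[OF R.is_cring]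
    by (simp add: \<iota>.hom_mult[symmetric] prA(2) del: \<iota>.hom_mult)
  from FS.frobenius_lift_data[OF CI[OF lam0 l(1)] this \<alpha>(1) \<beta>(1), unfolded cg]
  obtain u u' lam s r where d: "lam \<in> C" "?der u u'"
    "\<And>n. PA.q n (s n ^ 2) = PA.q n ((\<xi> ^ p + of_nat p * u) ^ 3
      + (ea ^ p + of_nat p * \<alpha>) * (\<xi> ^ p + of_nat p * u) + (eb ^ p + of_nat p * \<beta>))"
    "\<And>n. PA.q n (s n * r n) = PA.q n 1"
    "\<And>n. PA.q n (s (Suc n)) = PA.q n (s n)" "\<And>n. PA.q n (r (Suc n)) = PA.q n (r n)"
    "PA.q 1 (s 1) = PA.q 1 (\<eta> ^ p)" "PA.q 1 (r 1) = PA.q 1 (\<zeta> ^ p)"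
    "PA.q 2 (r 2 * (\<xi> ^ (p - 1) + u')) = PA.q 2 (lam * \<zeta>)"
    by blast
  obtain \<psi> where \<psi>: "\<And>n. \<psi> n \<in> ring_hom (PA.Q n) (PA.Q n)"
    "\<And>n c. c \<in> carrier R \<Longrightarrow> \<psi> n (PA.J n +>\<^bsub>A\<^esub> \<iota> c) = PA.J n +>\<^bsub>A\<^esub> \<iota> (\<phi>\<^sub>R c)"
    "\<And>n. \<psi> n (PA.J n +>\<^bsub>A\<^esub> x) = PA.q n (\<xi> ^ p + of_nat p * u)"
    "\<And>n. \<psi> n (PA.J n +>\<^bsub>A\<^esub> y) = PA.q n (s n)"
    "\<And>n. \<psi> n (PA.J n +>\<^bsub>A\<^esub> z) = PA.q n (r n)"
    "\<And>n c. c \<in> carrier (PA.Q (Suc n)) \<Longrightarrow>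
      padic_transition p A n (\<psi> (Suc n) c) = \<psi> n (padic_transition p A n c)"
    using frobenius_levels[OF \<phi>_hom PA d(3,4) \<alpha>(2) \<beta>(2) d(5,6)] by blast
  have xi_q: "PA.J n +>\<^bsub>A\<^esub> x = PA.q n \<xi>" "PA.J n +>\<^bsub>A\<^esub> y = PA.q n \<eta>" "PA.J n +>\<^bsub>A\<^esub> z = PA.q n \<zeta>" for n
    unfolding PA.q_def \<xi> \<eta> \<zeta> by simp_all
  let ?\<phi> = "PA.lift_endo \<psi>"
  have frob: "frobenius_lift p (padic_completion p A) ?\<phi>"
  proof (rule PA.lift_endo_frobenius[OF \<psi>(1) \<psi>(6)])
    fix c assume "c \<in> carrier (PA.Q 1)"
    then show "\<psi> 1 c = c [^]\<^bsub>PA.Q 1\<^esub> p"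
    proof (rule frobenius_level_one[OF p(1) PA \<psi>(1), rotated -1])
      fix c assume c: "c \<in> carrier R"
      obtain g where g: "pr A g = \<iota> c"
        using lift[OF \<iota>_closed[OF c]] by blast
      obtain t where "pr A (g ^ p + of_nat p * t) = \<iota> (\<phi>\<^sub>R c)"
        using \<phi>_lift_A[OF c g] by blast
      then have "PA.J 1 +>\<^bsub>A\<^esub> \<iota> (\<phi>\<^sub>R c) = PA.q 1 (g ^ p + of_nat p * t)"
        unfolding PA.q_def by simp
      also have "\<dots> = PA.q 1 (g ^ p)"
        by (rule PA.q_pI[where t = t]) simp
      also have "\<dots> = (PA.J 1 +>\<^bsub>A\<^esub> \<iota> c) [^]\<^bsub>PA.Q 1\<^esub> p"
        unfolding PA.q_power by (simp add: PA.q_def g)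
      finally show "\<psi> 1 (PA.J 1 +>\<^bsub>A\<^esub> \<iota> c) = (PA.J 1 +>\<^bsub>A\<^esub> \<iota> c) [^]\<^bsub>PA.Q 1\<^esub> p"
        using \<psi>(2)[OF c] by simp
    next
      have "PA.q 1 (\<xi> ^ p + of_nat p * u) = PA.q 1 (\<xi> ^ p)"
        by (rule PA.q_pI[where t = u]) simp
      moreover fix v assume "v \<in> {x, y, z}"
      ultimately show "\<psi> 1 (PA.J 1 +>\<^bsub>A\<^esub> v) = (PA.J 1 +>\<^bsub>A\<^esub> v) [^]\<^bsub>PA.Q 1\<^esub> p"
        using \<psi>(3,4,5)[of 1] d(7,8) unfolding PA.q_power xi_q by (auto simp: xi_q)
    qed
  qed
  have "?\<phi> (completion_scalar p R a b c) = completion_scalar p R a b (\<phi>\<^sub>R c)" if "c \<in> carrier R" for c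
    unfolding PA.lift_endo_def completion_scalar_def padic_embed_def using \<psi>(2)[OF that] by simp
  with frob have 1: "curve_frobenius_lift p R \<phi>\<^sub>R a b ?\<phi>"
    unfolding curve_frobenius_lift_def curve_completion_def by blast

  obtain lamR where lamR: "lamR \<in> carrier R" "pr A lam = \<iota> lamR"
    using d(1) unfolding C_def by blast
  have inv_form: "invariant_form p R a b = PA.form (\<lambda>_. \<zeta>) \<xi>"
    unfolding invariant_form_def Let_def PA.form_def padic_embed_def xi_q ..
  have scal: "completion_scalar p R a b lamR = PA.hat (\<lambda>_. lam)"
    unfolding completion_scalar_def padic_embed_def PA.hat_def PA.q_def lamR(2) ..
  have "?der (\<xi> ^ p + of_nat p * u) (of_nat p * \<xi> ^ (p - 1) * 1 + of_nat p * u')"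
    by (intro FS.der_add FS.der_power FS.der_of_nat FS.der_xi d)
  \<comment> \<open>The factor p is explicit in d\<phi>(x), so the division of the pullback by p has
    a concrete representative.\<close>
  then have dx: "?der (\<xi> ^ p + of_nat p * u) (of_nat p * (\<xi> ^ (p - 1) + u'))"
    by (simp add: distrib_left)
  have pull: "omega_pullback p R \<iota> A ?\<phi> (PA.form (\<lambda>_. \<zeta>) \<xi>) = PA.form (\<lambda>n. r n * (of_nat p * (\<xi> ^ (p - 1) + u'))) \<xi>"
  proof (rule PA.form_pullback[OF \<psi>(1) _ \<psi>(6) _ _ dx])
    show "\<exists>r'\<in>carrier R. \<psi> n (PA.J n +>\<^bsub>A\<^esub> \<iota> r) = PA.J n +>\<^bsub>A\<^esub> \<iota> r'" if "r \<in> carrier R" for n r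
      using \<psi>(2)[OF that] ring_hom_closed[OF \<phi>_hom that] by blast
    show "\<psi> n (PA.q n \<zeta>) = PA.q n (r n)" "\<psi> n (PA.q n \<xi>) = PA.q n (\<xi> ^ p + of_nat p * u)" for n
      using \<psi>(3,5) unfolding xi_q by auto
  qed
  have "PA.compat r"
    using d(6) unfolding PA.compat_def by blast
  from PA.form_eigen[OF this d(9), of \<xi>] have "lie_invariant_eigen p R a b ?\<phi> 2 lamR"
    unfolding lie_invariant_eigen_def Let_def curve_omega_def inv_form scal pull .
  with 1 lamR(1) show ?thesis
    unfolding lie_invariant_def by blast
qed

end

section \<open>The Hasse invariant\<close>

lemma coeff_linear_poly_power_all:
  fixes a b :: "'a::comm_ring_1"
  shows "poly.coeff ([:b, a:] ^ n) i = of_nat (n choose i) * a ^ i * b ^ (n - i)"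
proof (cases "i \<le> n")
  case True
  then show ?thesis by (rule coeff_linear_poly_power)
next
  case False
  have "Polynomial.degree ([:b, a:] ^ n) \<le> 1 * n"
    by (rule order.trans[OF degree_power_le]) (intro mult_right_mono, simp_all)
  then show ?thesis
    using False by (simp add: coeff_eq_0 binomial_eq_0)
qed

text \<open>Expand (x^3 + (a x + b))^m: k counts the factors x^3, and e - 3k of the remaining
  factors contribute a x. The guard keeps the natural subtraction e - 3k honest.\<close>

lemma coeff_cubic_power:
  fixes a b :: "'a::comm_ring_1"
  shows "poly.coeff ([:b, a, 0, 1:] ^ m) e
    = (\<Sum>k\<le>m. if 3 * k \<le> e then of_nat ((m choose k) * ((m - k) choose (e - 3 * k))) * a ^ (e - 3 * k)
        * b ^ (m - k - (e - 3 * k)) else 0)"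
proof -
  have "[:b, a, 0, 1:] = Polynomial.monom 1 3 + [:b, a:]"
    by (simp add: monom_altdef numeral_3_eq_3)
  then have "[:b, a, 0, 1:] ^ m
    = (\<Sum>k\<le>m. of_nat (m choose k) * Polynomial.monom 1 3 ^ k * [:b, a:] ^ (m - k))"
    by (simp add: binomial_ring)
  also have "poly.coeff \<dots> e
    = (\<Sum>k\<le>m. poly.coeff (of_nat (m choose k) * Polynomial.monom 1 3 ^ k * [:b, a:] ^ (m - k)) e)"
    by (rule coeff_sum)
  also have "\<dots> = (\<Sum>k\<le>m. if 3 * k \<le> e then of_nat ((m choose k) * ((m - k) choose (e - 3 * k))) * a ^ (e - 3 * k)
        * b ^ (m - k - (e - 3 * k)) else 0)"
  proof (intro sum.cong refl)
    fix k
    have "of_nat (m choose k) * Polynomial.monom 1 3 ^ k * [:b, a:] ^ (m - k)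
      = Polynomial.smult (of_nat (m choose k)) (Polynomial.monom 1 (3 * k) * [:b, a:] ^ (m - k))"
      by (simp add: monom_power mult.commute of_nat_poly)
    then have "poly.coeff (of_nat (m choose k) * Polynomial.monom 1 3 ^ k * [:b, a:] ^ (m - k)) e
      = of_nat (m choose k) * poly.coeff (Polynomial.monom 1 (3 * k) * [:b, a:] ^ (m - k)) e"
      by (simp only: coeff_smult)
    also have "\<dots> = (if 3 * k \<le> e then of_nat ((m choose k) * ((m - k) choose (e - 3 * k))) * a ^ (e - 3 * k)
        * b ^ (m - k - (e - 3 * k)) else 0)"
      by (simp add: coeff_monom_mult coeff_linear_poly_power_all mult.assoc)
    finally show "poly.coeff (of_nat (m choose k) * Polynomial.monom 1 3 ^ k * [:b, a:] ^ (m - k)) e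
      = (if 3 * k \<le> e then of_nat ((m choose k) * ((m - k) choose (e - 3 * k))) * a ^ (e - 3 * k)
        * b ^ (m - k - (e - 3 * k)) else 0)" .
  qed
  finally show ?thesis .
qed

text \<open>The case p = 4n + 1, with m = 2n and exponent 4n. Put k = 2n - i: the monomial is a^(3i
  - 2n) b^(2n - 2i), so a^(2n) makes it a form of degree n in a^3 and b^2. The factor 108 = 4 * 27
  supplies the constants 4 and 27, the surplus staying in the coefficient. The term i = n carries
  the central binomial coefficient.\<close>

lemma hasse_form_even:
  fixes a b :: "'a::comm_ring_1"
  shows "108 ^ n * a ^ (2 * n) * poly.coeff ([:b, a, 0, 1:] ^ (2 * n)) (4 * n)
    = (\<Sum>i\<le>n. of_nat (if 3 * (n - i) \<le> n
         then ((2 * n) choose (2 * n - i)) * (i choose (n - 3 * (n - i))) * 27 ^ i * 4 ^ (n - i) else 0)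
       * (4 * a ^ 3) ^ i * (27 * b ^ 2) ^ (n - i))"
proof -
  let ?t = "\<lambda>k. if 3 * k \<le> 4 * n then of_nat (((2 * n) choose k) * ((2 * n - k) choose (4 * n - 3 * k)))
     * a ^ (4 * n - 3 * k) * b ^ (2 * n - k - (4 * n - 3 * k)) else (0::'a)"
  have "poly.coeff ([:b, a, 0, 1:] ^ (2 * n)) (4 * n) = (\<Sum>k\<le>2 * n. ?t k)"
    by (rule coeff_cubic_power)
  also have "\<dots> = (\<Sum>k\<in>{n..2 * n}. ?t k)"
  proof (intro sum.mono_neutral_right ballI)
    fix k assume "k \<in> {..2 * n} - {n..2 * n}"
    then have "2 * n - k < 4 * n - 3 * k" by auto
    then show "?t k = 0" by (simp add: binomial_eq_0)
  qed auto
  also have "\<dots> = (\<Sum>i\<le>n. ?t (2 * n - i))"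
    by (rule sum.reindex_bij_witness[of _ "\<lambda>i. 2 * n - i" "\<lambda>k. 2 * n - k"]) auto
  finally have "108 ^ n * a ^ (2 * n) * poly.coeff ([:b, a, 0, 1:] ^ (2 * n)) (4 * n)
    = (\<Sum>i\<le>n. 108 ^ n * a ^ (2 * n) * ?t (2 * n - i))"
    by (simp add: sum_distrib_left)
  also have "\<dots> = (\<Sum>i\<le>n. of_nat (if 3 * (n - i) \<le> n
         then ((2 * n) choose (2 * n - i)) * (i choose (n - 3 * (n - i))) * 27 ^ i * 4 ^ (n - i) else 0)
       * (4 * a ^ 3) ^ i * (27 * b ^ 2) ^ (n - i))"
  proof (intro sum.cong refl)
    fix i assume "i \<in> {..n}"
    then obtain l where l: "n = i + l"
      by (auto dest: le_Suc_ex)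
    show "108 ^ n * a ^ (2 * n) * ?t (2 * n - i) = of_nat (if 3 * (n - i) \<le> n
         then ((2 * n) choose (2 * n - i)) * (i choose (n - 3 * (n - i))) * 27 ^ i * 4 ^ (n - i) else 0)
       * (4 * a ^ 3) ^ i * (27 * b ^ 2) ^ (n - i)"
    proof (cases "3 * l \<le> n")
      case True
      then obtain h where h: "i = 2 * l + h"
        using l by (metis le_Suc_ex mult_2 numeral_3_eq_3 add_le_cancel_right mult_Suc add.assoc add.commute)
      have e: "4 * n - 3 * (2 * n - i) = h" "2 * n - (2 * n - i) = i" "i - h = 2 * l" "n - i = l"
        "n - 3 * (n - i) = h" "3 * (2 * n - i) \<le> 4 * n"
        using l h by auto
      let ?N = "((2 * n) choose (2 * n - i)) * (i choose h)"
      have t: "?t (2 * n - i) = of_nat ?N * a ^ h * b ^ (2 * l)"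
        using e by simp
      have c: "(108::'a) ^ n = 4 ^ i * 27 ^ i * (4 ^ l * 27 ^ l)"
        unfolding l power_add by (simp flip: power_mult_distrib)
      have a3: "a ^ (2 * n) * a ^ h = (a ^ 3) ^ i"
        unfolding power_add[symmetric] power_mult[symmetric] using l h by (intro arg_cong[of _ _ "(^) a"]) simp
      have "108 ^ n * a ^ (2 * n) * ?t (2 * n - i) = 108 ^ n * (a ^ (2 * n) * a ^ h) * (of_nat ?N * b ^ (2 * l))"
        unfolding t by (simp only: mult_ac)
      also have "\<dots> = of_nat (?N * 27 ^ i * 4 ^ l) * (4 * a ^ 3) ^ i * (27 * b ^ 2) ^ l"
        unfolding c a3 power_mult[of b] power_mult_distrib by (simp add: mult_ac)
      finally show ?thesis
        using True e by simp
    next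
      case False
      then have "4 * n < 3 * (2 * n - i)" using l by auto
      then show ?thesis
        using False l by simp
    qed
  qed
  finally show ?thesis .
qed

text \<open>The case p = 6n + 1, with m = 3n and exponent 6n. Put k = 2n - i: the monomial is a^(3i)
  b^(n - 2i), so here b^n is the missing factor. The term i = 0 carries the binomial coefficient of
  3n over 2n.\<close>

lemma hasse_form_triple:
  fixes a b :: "'a::comm_ring_1"
  shows "108 ^ n * b ^ n * poly.coeff ([:b, a, 0, 1:] ^ (3 * n)) (6 * n)
    = (\<Sum>i\<le>n. of_nat (if 2 * i \<le> n
         then ((3 * n) choose (2 * n - i)) * ((n + i) choose (3 * i)) * 27 ^ i * 4 ^ (n - i) else 0)
       * (4 * a ^ 3) ^ i * (27 * b ^ 2) ^ (n - i))"
proof -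
  let ?t = "\<lambda>k. if 3 * k \<le> 6 * n then of_nat (((3 * n) choose k) * ((3 * n - k) choose (6 * n - 3 * k)))
     * a ^ (6 * n - 3 * k) * b ^ (3 * n - k - (6 * n - 3 * k)) else (0::'a)"
  have "poly.coeff ([:b, a, 0, 1:] ^ (3 * n)) (6 * n) = (\<Sum>k\<le>3 * n. ?t k)"
    by (rule coeff_cubic_power)
  also have "\<dots> = (\<Sum>k\<in>{n..2 * n}. ?t k)"
  proof (intro sum.mono_neutral_right ballI)
    fix k assume "k \<in> {..3 * n} - {n..2 * n}"
    then have "k < n \<or> 6 * n < 3 * k" by auto
    then show "?t k = 0" by (auto simp: binomial_eq_0)
  qed auto
  also have "\<dots> = (\<Sum>i\<le>n. ?t (2 * n - i))"
    by (rule sum.reindex_bij_witness[of _ "\<lambda>i. 2 * n - i" "\<lambda>k. 2 * n - k"]) auto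
  finally have "108 ^ n * b ^ n * poly.coeff ([:b, a, 0, 1:] ^ (3 * n)) (6 * n)
    = (\<Sum>i\<le>n. 108 ^ n * b ^ n * ?t (2 * n - i))"
    by (simp add: sum_distrib_left)
  also have "\<dots> = (\<Sum>i\<le>n. of_nat (if 2 * i \<le> n
         then ((3 * n) choose (2 * n - i)) * ((n + i) choose (3 * i)) * 27 ^ i * 4 ^ (n - i) else 0)
       * (4 * a ^ 3) ^ i * (27 * b ^ 2) ^ (n - i))"
  proof (intro sum.cong refl)
    fix i assume "i \<in> {..n}"
    then obtain l where l: "n = i + l"
      by (auto dest: le_Suc_ex)
    have e: "6 * n - 3 * (2 * n - i) = 3 * i" "3 * n - (2 * n - i) = n + i" "n - i = l"
      "3 * (2 * n - i) \<le> 6 * n"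
      using l by auto
    show "108 ^ n * b ^ n * ?t (2 * n - i) = of_nat (if 2 * i \<le> n
         then ((3 * n) choose (2 * n - i)) * ((n + i) choose (3 * i)) * 27 ^ i * 4 ^ (n - i) else 0)
       * (4 * a ^ 3) ^ i * (27 * b ^ 2) ^ (n - i)"
    proof (cases "2 * i \<le> n")
      case True
      then obtain h where h: "l = i + h"
        using l by (metis add_le_cancel_left le_Suc_ex mult_2)
      have e': "n + i - 3 * i = h"
        using l h by auto
      let ?N = "((3 * n) choose (2 * n - i)) * ((n + i) choose (3 * i))"
      have t: "?t (2 * n - i) = of_nat ?N * a ^ (3 * i) * b ^ h"
        using e e' by simp
      have c: "(108::'a) ^ n = 4 ^ i * 27 ^ i * (4 ^ l * 27 ^ l)"
        unfolding l power_add by (simp flip: power_mult_distrib)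
      have b2: "b ^ n * b ^ h = (b ^ 2) ^ l"
        unfolding power_add[symmetric] power_mult[symmetric] using l h by (intro arg_cong[of _ _ "(^) b"]) simp
      have "108 ^ n * b ^ n * ?t (2 * n - i) = 108 ^ n * (b ^ n * b ^ h) * (of_nat ?N * a ^ (3 * i))"
        unfolding t by (simp only: mult_ac)
      also have "\<dots> = of_nat (?N * 27 ^ i * 4 ^ l) * (4 * a ^ 3) ^ i * (27 * b ^ 2) ^ l"
        unfolding c b2 power_mult[of a] power_mult_distrib by (simp add: mult_ac)
      finally show ?thesis
        using True e by simp
    next
      case False
      then have "n + i < 3 * i" by auto
      then show ?thesis
        using False e(4) unfolding e by (simp add: binomial_eq_0)
    qed
  qed
  finally show ?thesis .
qed

text \<open>The binomial coefficient divides n!, which is prime to p for n < p.\<close>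

lemma prime_not_dvd_binomial:
  assumes "Factorial_Ring.prime p" "n < p" "k \<le> n"
  shows "\<not> p dvd (n choose k)"
proof
  assume "p dvd (n choose k)"
  then have "p dvd fact n"
    using binomial_fact_lemma[OF assms(3)] by (metis dvd_mult)
  then show False
    using assms(1,2) prime_dvd_fact_iff by (metis linorder_not_le)
qed

text \<open>For a prime above 3, being 11 modulo 12 is the same as being 3 modulo 4 and 2 modulo 3,
  so one of the two shapes of p applies. The coefficients c depend on p alone and not on a and b;
  hence one polynomial governs all curves.\<close>

lemma hasse_form:
  assumes p: "Factorial_Ring.prime p" "p \<ge> 5" "\<not> [p = 11] (mod 12)"
  shows "\<exists>n c. (\<not> p dvd c 0 \<or> \<not> p dvd c n) \<and>
    (\<forall>a b::'a::comm_ring_1. \<exists>w. w * poly.coeff ([:b, a, 0, 1:] ^ ((p - 1) div 2)) (p - 1)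
      = (\<Sum>i\<le>n. of_nat (c i) * (4 * a ^ 3) ^ i * (27 * b ^ 2) ^ (n - i)))"
proof -
  have small: "\<not> p dvd q" if "0 < q" "q < 5" for q
    using that p(2) by (auto dest: dvd_imp_le)
  have "\<not> p dvd 27" "\<not> p dvd 4"
    using small[of 3] small[of 4] prime_dvd_power[OF p(1), of 3 3] by auto
  then have pow: "\<not> p dvd 27 ^ k" "\<not> p dvd 4 ^ k" for k
    using prime_dvd_power[OF p(1)] by blast+
  have "p mod 4 = 1 \<or> p mod 3 = 1"
  proof -
    have "odd p"
      using p prime_odd_nat by auto
    have "\<not> 3 dvd p"
      using p(1,2) primes_dvd_imp_eq[of 3 p] by auto
    then show ?thesis
      using \<open>odd p\<close> p(3) unfolding cong_def by presburger
  qed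
  then show ?thesis
  proof
    assume "p mod 4 = 1"
    define n where "n = p div 4"
    have n: "p = 4 * n + 1"
      using \<open>p mod 4 = 1\<close> unfolding n_def by (metis mult_div_mod_eq)
    define c where "c i = (if 3 * (n - i) \<le> n
      then ((2 * n) choose (2 * n - i)) * (i choose (n - 3 * (n - i))) * 27 ^ i * 4 ^ (n - i) else 0)" for i
    have "c n = ((2 * n) choose n) * 27 ^ n"
      unfolding c_def by simp
    then have "\<not> p dvd c n"
      using prime_not_dvd_binomial[OF p(1), of "2 * n" n] pow n prime_dvd_mult_iff[OF p(1)] by simp
    moreover have "(p - 1) div 2 = 2 * n" "p - 1 = 4 * n"
      using n by simp_all
    moreover have "\<exists>w. w * poly.coeff ([:b, a, 0, 1:] ^ (2 * n)) (4 * n)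
      = (\<Sum>i\<le>n. of_nat (c i) * (4 * a ^ 3) ^ i * (27 * b ^ 2) ^ (n - i))" for a b :: 'a
      using hasse_form_even[of n a b] unfolding c_def by blast
    ultimately show ?thesis
      by (intro exI[of _ n] exI[of _ c]) simp
  next
    assume "p mod 3 = 1"
    moreover have "odd p"
      using p prime_odd_nat by auto
    ultimately have "p mod 6 = 1"
      by presburger
    define n where "n = p div 6"
    have n: "p = 6 * n + 1"
      using \<open>p mod 6 = 1\<close> unfolding n_def by (metis mult_div_mod_eq)
    define c where "c i = (if 2 * i \<le> n
      then ((3 * n) choose (2 * n - i)) * ((n + i) choose (3 * i)) * 27 ^ i * 4 ^ (n - i) else 0)" for i
    have "c 0 = ((3 * n) choose (2 * n)) * 4 ^ n"
      unfolding c_def by simp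
    then have "\<not> p dvd c 0"
      using prime_not_dvd_binomial[OF p(1), of "3 * n" "2 * n"] pow n prime_dvd_mult_iff[OF p(1)] by simp
    moreover have "(p - 1) div 2 = 3 * n" "p - 1 = 6 * n"
      using n by simp_all
    moreover have "\<exists>w. w * poly.coeff ([:b, a, 0, 1:] ^ (3 * n)) (6 * n)
      = (\<Sum>i\<le>n. of_nat (c i) * (4 * a ^ 3) ^ i * (27 * b ^ 2) ^ (n - i))" for a b :: 'a
      using hasse_form_triple[of n b a] unfolding c_def by blast
    ultimately show ?thesis
      by (intro exI[of _ n] exI[of _ c]) simp
  qed
qed

section \<open>Finitely many exceptional invariants\<close>

context padic
begin

text \<open>Polynomials as lists over a ring record start with the leading coefficient, whereas
  \<open>Poly\<close> starts with the constant one; hence the reversal.\<close>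

lemma eval_rev_coeffs:
  "ring.eval (Q n) (rev (map (q n) cs)) (q n t) = q n (poly (Poly cs) t)"
proof (induction cs)
  case (Cons c cs)
  have "set (rev (map (q n) cs)) \<subseteq> carrier (Q n)"
    by auto
  then have "ring.eval (Q n) (rev (map (q n) cs) @ [q n c]) (q n t)
    = ring.eval (Q n) (rev (map (q n) cs)) (q n t) \<otimes>\<^bsub>Q n\<^esub> q n t \<oplus>\<^bsub>Q n\<^esub> q n c"
    by (intro Q.eval_append_aux) simp_all
  also have "\<dots> = q n (poly (Poly cs) t * t + c)"
    unfolding Cons q_add q_mult ..
  also have "poly (Poly cs) t * t + c = poly (Poly (c # cs)) t"
    by (simp add: algebra_simps)
  finally show ?case
    by simp
qed (simp add: q_zero)

text \<open>Leading coefficients may vanish on reduction, so the coefficient list is normalised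
  first. A single nonzero value shows that the reduced polynomial is not zero, and over a domain it
  then has finitely many roots.\<close>

lemma finite_roots_level_one:
  assumes "domain (Q 1)" and nz: "q 1 (poly P e) \<noteq> \<zero>\<^bsub>Q 1\<^esub>"
  shows "finite {q 1 t | t. q 1 (poly P t) = \<zero>\<^bsub>Q 1\<^esub>}"
proof -
  interpret k: domain "Q 1" by fact
  define L where "L = rev (map (q 1) (coeffs P))"
  have L: "set L \<subseteq> carrier (Q 1)"
    unfolding L_def by auto
  have ev: "ring.eval (Q 1) (ring.normalize (Q 1) L) (q 1 t) = q 1 (poly P t)" for t
  proof -
    have "ring.eval (Q 1) (ring.normalize (Q 1) L) (q 1 t) = ring.eval (Q 1) L (q 1 t)"
      by (rule Q.eval_normalize[OF L q_closed])
    also have "\<dots> = q 1 (poly (Poly (coeffs P)) t)"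
      unfolding L_def by (rule eval_rev_coeffs)
    finally show ?thesis
      unfolding Poly_coeffs .
  qed
  have "ring.normalize (Q 1) L \<in> carrier (poly_ring (Q 1))"
    unfolding univ_poly_def partial_object.select_convs mem_Collect_eq
    by (rule Q.normalize_gives_polynomial[OF L])
  then have "finite {x. ring.is_root (Q 1) (ring.normalize (Q 1) L) x}"
    by (rule k.finite_number_of_roots)
  moreover have "ring.normalize (Q 1) L \<noteq> []"
  proof
    assume "ring.normalize (Q 1) L = []"
    then have "ring.eval (Q 1) [] (q 1 e) = q 1 (poly P e)"
      using ev[of e] by (simp only:)
    then show False
      using nz by (simp only: Q.eval.simps)
  qed
  then have "{q 1 t | t. q 1 (poly P t) = \<zero>\<^bsub>Q 1\<^esub>} \<subseteq> {x. ring.is_root (Q 1) (ring.normalize (Q 1) L) x}"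
    unfolding Q.is_root_def using ev q_closed by blast
  ultimately show ?thesis
    using finite_subset by blast
qed

end

section \<open>Roots and units over the residue field, and reduction of the Hasse form\<close>

lemma (in algebraically_closed) pth_root:
  assumes c: "c \<in> carrier L" and n: "0 < (n::nat)"
  shows "\<exists>r\<in>carrier L. r [^] n = c"
proof -
  \<comment> \<open>The polynomial X^n - c, leading coefficient first, with n - 1 zeros in
    between.\<close>
  let ?P = "\<one> # (replicate (n - 1) \<zero> @ [\<ominus> c])"
  have "set (replicate (n - 1) \<zero> @ [\<ominus> c]) \<subseteq> carrier L"
    using c by auto
  then have P: "?P \<in> carrier (poly_ring L)"
    unfolding univ_poly_def polynomial_def by simp
  have "size (roots ?P) = n"
    using roots_over_carrier[OF P] n unfolding splitted_def by simp
  then obtain r where "r \<in># roots ?P"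
    using n by (metis multiset_nonemptyE size_empty less_numeral_extra(3))
  then have r: "r \<in> carrier L" "eval ?P r = \<zero>"
    using roots_mem_iff_is_root[OF P] unfolding is_root_def by auto
  have "eval (replicate (n - 1) \<zero> @ [\<ominus> c]) r = eval [\<ominus> c] r"
    using c r by (intro eval_replicate) auto
  then have "r [^] n \<ominus> c = \<zero>"
    using r c n by (simp add: a_minus_def)
  then show ?thesis
    using r c by (intro bexI[of _ r]) simp_all
qed

text \<open>A nonzero nonunit has an irreducible divisor, which generates a maximal ideal of the
  principal domain; by uniqueness that ideal is M, so x would lie in M.\<close>

lemma dvr_unit:
  assumes R: "discrete_valuation_ring R" and M: "maximalideal M R"
    and x: "x \<in> carrier R" "x \<notin> M"
  shows "x \<in> Units R"
proof (rule ccontr)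
  interpret principal_domain R
    using R unfolding discrete_valuation_ring_def by blast
  interpret M: maximalideal M R by fact
  assume "x \<notin> Units R"
  moreover have "x \<noteq> \<zero>\<^bsub>R\<^esub>"
    using x(2) M.zero_closed by blast
  ultimately obtain b where b: "b \<in> carrier R" "ring_irreducible\<^bsub>R\<^esub> b" "b divides\<^bsub>R\<^esub> x"
    using exists_irreducible_divisor[of x] x(1) by blast
  have "PIdl\<^bsub>R\<^esub> b = M"
    using irreducible_imp_maximalideal[OF b(1,2)] M R unfolding discrete_valuation_ring_def by blast
  moreover have "x \<in> PIdl\<^bsub>R\<^esub> b"
    using b(1,3) x(1) m_comm unfolding factor_def cgenideal_def by blast
  ultimately show False
    using x(2) by blast
qed

context padic
begin

lemma q_sum_cong: "(\<And>i. i \<in> S \<Longrightarrow> q n (g i) = q n (h i)) \<Longrightarrow> q n (sum g S) = q n (sum h S)"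
  by (induction S rule: infinite_finite_induct) (simp_all add: q_add)

lemma q_mult_cong: "q n g = q n g' \<Longrightarrow> q n h = q n h' \<Longrightarrow> q n (g * h) = q n (g' * h')"
  by (simp only: q_mult)

lemma q_power_cong: "q n g = q n g' \<Longrightarrow> q n (g ^ k) = q n (g' ^ k)"
  by (simp only: q_power)

lemma q_diff_cong: "q n g = q n g' \<Longrightarrow> q n h = q n h' \<Longrightarrow> q n (g - h) = q n (g' - h')"
  unfolding diff_conv_add_uminus by (simp only: q_add q_uminus)

lemma q_eq_zero_iff: "q n g = \<zero>\<^bsub>Q n\<^esub> \<longleftrightarrow> pr A g \<in> J n"
proof -
  have "q n g = q n 0 \<longleftrightarrow> pr A g \<ominus> pr A 0 \<in> J n"
    unfolding q_def by (rule J.a_rcos_eq_iff) simp_all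
  then show ?thesis
    unfolding q_zero by (simp add: pr_A_simps(1) a_minus_def)
qed

end

text \<open>Dehomogenised with t and 1 - t, a form takes its extreme coefficients as values at t = 0
  and t = 1, the points belonging to a = 0 and b = 0. The surviving term relies on 0^0 = 1.\<close>

lemma sum_monomials_at_0_1:
  fixes c :: "nat \<Rightarrow> 'a::comm_ring_1"
  shows "(\<Sum>i\<le>n. c i * 0 ^ i * 1 ^ (n - i)) = c 0" "(\<Sum>i\<le>n. c i * 1 ^ i * 0 ^ (n - i)) = c n"
proof -
  have "(\<Sum>i\<le>n. c i * 0 ^ i * 1 ^ (n - i)) = (\<Sum>i\<in>{0}. c i * 0 ^ i * 1 ^ (n - i))"
    by (rule sum.mono_neutral_right) (auto simp: power_0_left)
  then show "(\<Sum>i\<le>n. c i * 0 ^ i * 1 ^ (n - i)) = c 0"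
    by simp
  have "(\<Sum>i\<le>n. c i * 1 ^ i * 0 ^ (n - i)) = (\<Sum>i\<in>{n}. c i * 1 ^ i * 0 ^ (n - i))"
    by (rule sum.mono_neutral_right) (auto simp: power_0_left)
  then show "(\<Sum>i\<le>n. c i * 1 ^ i * 0 ^ (n - i)) = c n"
    by simp
qed

theorem theorem1p2:
  fixes p :: nat and R :: "('r, 'm) ring_scheme" and \<phi>\<^sub>R :: "'r \<Rightarrow> 'r"
  assumes "Factorial_Ring.prime p" and "p \<ge> 13" and "\<not> [p = 11] (mod 12)"
    and "discrete_valuation_ring R"
    and "maximalideal (PIdl\<^bsub>R\<^esub> (nat_elem R p)) R"
    and "padically_complete p R"
    and "algebraically_closed (R Quot (PIdl\<^bsub>R\<^esub> (nat_elem R p)))"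
    and "frobenius_lift p R \<phi>\<^sub>R"
  shows "\<exists>F. F \<subseteq> carrier (R Quot (PIdl\<^bsub>R\<^esub> (nat_elem R p))) \<and> finite F \<and>
    (\<forall>a\<in>carrier R. \<forall>b\<in>carrier R.
      nonsingular R a b \<longrightarrow>
      (PIdl\<^bsub>R\<^esub> (nat_elem R p)) +>\<^bsub>R\<^esub> j_invariant R a b \<notin> F \<longrightarrow>
      (\<exists>\<phi>. curve_frobenius_lift p R \<phi>\<^sub>R a b \<phi> \<and> lie_invariant p R a b \<phi> 2))"
proof -
  interpret R: principal_domain R
    using assms(4) unfolding discrete_valuation_ring_def by blast
  interpret RP: padic R p
    by unfold_locales
  have J1: "PIdl\<^bsub>R\<^esub> (nat_elem R p) = RP.J 1"
    unfolding padic_ideal_def by simp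
  have Q1: "R Quot (PIdl\<^bsub>R\<^esub> (nat_elem R p)) = RP.Q 1"
    unfolding padic_quot_def J1 ..
  interpret k: algebraically_closed "RP.Q 1"
    using assms(7) unfolding Q1 .
  have k_domain: "domain (RP.Q 1)"
    by (rule k.domain_axioms)
  have q1_neq: "RP.q 1 1 \<noteq> \<zero>\<^bsub>RP.Q 1\<^esub>"
    unfolding RP.q_one using k.one_not_zero .
  have unit: "\<exists>y\<in>carrier R. x \<otimes>\<^bsub>R\<^esub> y = \<one>\<^bsub>R\<^esub>" if x: "x \<in> carrier R" "x \<notin> RP.J 1" for x
  proof -
    have "x \<in> Units R"
      using dvr_unit[OF assms(4) assms(5)[unfolded J1] x] .
    then show ?thesis
      unfolding Units_def by blast
  qed
  have nat_nonzero: "RP.q 1 (of_nat n) \<noteq> \<zero>\<^bsub>RP.Q 1\<^esub>" if n: "\<not> p dvd n" for n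
  proof
    assume z: "RP.q 1 (of_nat n) = \<zero>\<^bsub>RP.Q 1\<^esub>"
    \<comment> \<open>For an inverse y of n modulo p, the product n y is 1 modulo p; if n were zero
      in the residue field, 1 would be zero there too.\<close>
    have "coprime n p"
      using n prime_imp_coprime[OF assms(1)] by (simp add: coprime_commute)
    then obtain y where y: "[n * y = Suc 0] (mod p)"
      using cong_solve_coprime_nat by blast
    have "n * y mod p = 1"
      using y assms(2) unfolding cong_def by simp
    then have "n * y = 1 + p * (n * y div p)"
      by (metis add.commute mult_div_mod_eq)
    then have "of_nat (n * y) = (of_nat (1 + p * (n * y div p)) :: ('r, 'm) uring)"
      by (rule arg_cong)
    then have "RP.q 1 (of_nat n * of_nat y) = RP.q 1 1"
      by (intro RP.q_pI[where t = "of_nat (n * y div p)"]) simp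
    then show False
      using q1_neq unfolding RP.q_mult z RP.Q.l_null[OF RP.q_closed] by (simp only:)
  qed
  have units: "\<exists>r\<in>carrier R. nat_elem R n \<otimes>\<^bsub>R\<^esub> r = \<one>\<^bsub>R\<^esub>" if "\<not> p dvd n" for n
  proof (rule unit)
    show "nat_elem R n \<notin> RP.J 1"
      using nat_nonzero[OF that] unfolding RP.q_eq_zero_iff RP.pr_A_simps(9) .
  qed simp
  have roots: "\<exists>r\<in>carrier R. \<exists>t\<in>carrier R. c = r [^]\<^bsub>R\<^esub> p \<oplus>\<^bsub>R\<^esub> nat_elem R p \<otimes>\<^bsub>R\<^esub> t"
    if c: "c \<in> carrier R" for c
  proof -
    obtain g where g: "pr R g = c"
      using pr_surj[OF R.is_cring c] by blast
    obtain \<rho> where \<rho>: "\<rho> \<in> carrier (RP.Q 1)" "\<rho> [^]\<^bsub>RP.Q 1\<^esub> p = RP.q 1 g"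
      using k.pth_root[OF RP.q_closed, of p g] assms(2) by auto
    obtain h where h: "\<rho> = RP.q 1 h"
      using RP.q_surj[OF \<rho>(1)] by blast
    have "RP.q 1 g = RP.q 1 (h ^ p)"
      using \<rho>(2) unfolding h RP.q_power by simp
    then obtain t where "pr R (g - h ^ p - of_nat p ^ 1 * t) = \<zero>\<^bsub>R\<^esub>"
      unfolding RP.q_eq_iff by blast
    then have "pr R (g - (h ^ p + of_nat p * t)) = \<zero>\<^bsub>R\<^esub>"
      by (simp add: diff_diff_eq)
    then have "pr R g = pr R (h ^ p + of_nat p * t)"
      unfolding RP.pr_A_simps(6) using R.r_right_minus_eq[OF RP.pr_A_closed RP.pr_A_closed] by simp
    then have "c = pr R h [^]\<^bsub>R\<^esub> p \<oplus>\<^bsub>R\<^esub> nat_elem R p \<otimes>\<^bsub>R\<^esub> pr R t"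
      unfolding g RP.pr_A_simps(3,4,7,9) .
    then show ?thesis
      using RP.pr_A_closed by blast
  qed

  have p5: "p \<ge> 5" using assms(2) by simp
  obtain n c where nc: "\<not> p dvd c 0 \<or> \<not> p dvd c n"
    and hasse: "\<And>a b::('r, 'm) uring. \<exists>w. w * poly.coeff ([:b, a, 0, 1:] ^ ((p - 1) div 2)) (p - 1)
      = (\<Sum>i\<le>n. of_nat (c i) * (4 * a ^ 3) ^ i * (27 * b ^ 2) ^ (n - i))"
    using hasse_form[OF assms(1) p5 assms(3), where 'a = "('r, 'm) uring"] by blast
  \<comment> \<open>With E = 4a^3 + 27b^2 and t = 4a^3/E one has 27b^2/E = 1 - t, so P(t) is the
    Hasse form divided by E^n.\<close>
  define P :: "('r, 'm) uring poly" where "P = (\<Sum>i\<le>n. of_nat (c i) * [:0, 1:] ^ i * [:1, -1:] ^ (n - i))"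
  have poly_P: "poly P t = (\<Sum>i\<le>n. of_nat (c i) * t ^ i * (1 - t) ^ (n - i))" for t
    unfolding P_def by (simp add: poly_sum)
  obtain e where "RP.q 1 (poly P e) \<noteq> \<zero>\<^bsub>RP.Q 1\<^esub>"
  proof -
    have "poly P 0 = of_nat (c 0)" "poly P 1 = of_nat (c n)"
      unfolding poly_P using sum_monomials_at_0_1[of "\<lambda>i. of_nat (c i)" n] by simp_all
    then show thesis
      using nc nat_nonzero that by metis
  qed
  then have fin: "finite {RP.q 1 t | t. RP.q 1 (poly P t) = \<zero>\<^bsub>RP.Q 1\<^esub>}"
    by (rule RP.finite_roots_level_one[OF k_domain])
  \<comment> \<open>The exceptional set is found in terms of t; as j = 1728 t, its image under
    multiplication by 1728 is the set of exceptional j.\<close>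
  define F where "F = (\<lambda>s. add_pow (RP.Q 1) (1728::nat) s) ` {RP.q 1 t | t. RP.q 1 (poly P t) = \<zero>\<^bsub>RP.Q 1\<^esub>}"
  have "F \<subseteq> carrier (RP.Q 1)"
    unfolding F_def by auto
  moreover have "finite F"
    unfolding F_def using fin by simp
  moreover have "\<exists>\<phi>. curve_frobenius_lift p R \<phi>\<^sub>R a b \<phi> \<and> lie_invariant p R a b \<phi> 2"
    if a: "a \<in> carrier R" and b: "b \<in> carrier R" and ns: "nonsingular R a b"
      and j: "RP.J 1 +>\<^bsub>R\<^esub> j_invariant R a b \<notin> F" for a b
  proof -
    interpret c: curve R a b
      by unfold_locales (fact a b)+
    obtain a0 where a0: "pr R a0 = a"
      using pr_surj[OF R.is_cring a] by blast
    obtain b0 where b0: "pr R b0 = b"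
      using pr_surj[OF R.is_cring b] by blast
    let ?E = "4 * a0 ^ 3 + 27 * b0 ^ 2"
    have prE: "pr R ?E = disc R a b"
      unfolding disc_def RP.pr_A_simps(3) pr_numeral_mult[OF R.is_cring] RP.pr_A_simps(7) a0 b0 ..
    have E_unit: "disc R a b \<in> Units R"
      using ns unfolding nonsingular_def .
    obtain E' where E': "pr R E' = inv\<^bsub>R\<^esub> (disc R a b)"
      using pr_surj[OF R.is_cring R.Units_inv_closed[OF E_unit]] by blast
    have EE': "RP.q 1 (E' * ?E) = RP.q 1 1"
    proof (rule RP.q_cong_pr)
      show "pr R (E' * ?E) = pr R 1"
        unfolding RP.pr_A_simps(4) prE E' RP.pr_A_simps(2) using E_unit by simp
    qed
    define t where "t = 4 * a0 ^ 3 * E'"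
    have "j_invariant R a b = pr R (of_nat 1728 * t)"
      unfolding j_invariant_def t_def RP.pr_A_simps(8) RP.pr_A_simps(4)[of "4 * a0 ^ 3" E']
        pr_numeral_mult[OF R.is_cring] RP.pr_A_simps(7) a0 E' ..
    then have jq: "RP.J 1 +>\<^bsub>R\<^esub> j_invariant R a b = add_pow (RP.Q 1) (1728::nat) (RP.q 1 t)"
      unfolding RP.q_of_nat_mult[symmetric] unfolding RP.q_def by (simp only:)
    have Pt: "RP.q 1 (poly P t) \<noteq> \<zero>\<^bsub>RP.Q 1\<^esub>"
      using j unfolding jq F_def by blast
    let ?H = "poly.coeff ([:b0, a0, 0, 1:] ^ ((p - 1) div 2)) (p - 1)"
    \<comment> \<open>A multiple of the Hasse invariant equals E^n P(t) in the residue field, and E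
      is a unit. So its vanishing would make t a root of P, contrary to the choice of F.\<close>
    have "RP.q 1 ?H \<noteq> \<zero>\<^bsub>RP.Q 1\<^esub>"
    proof
      assume H0: "RP.q 1 ?H = \<zero>\<^bsub>RP.Q 1\<^esub>"
      obtain w where w: "w * ?H = (\<Sum>i\<le>n. of_nat (c i) * (4 * a0 ^ 3) ^ i * (27 * b0 ^ 2) ^ (n - i))"
        using hasse by blast
      have tE: "RP.q 1 (4 * a0 ^ 3) = RP.q 1 (t * ?E)"
      proof -
        have "RP.q 1 (t * ?E) = RP.q 1 (4 * a0 ^ 3 * (E' * ?E))"
          unfolding t_def by (simp only: mult.assoc)
        also have "\<dots> = RP.q 1 (4 * a0 ^ 3 * 1)"
          by (rule RP.q_mult_cong[OF refl EE'])
        finally show ?thesis by simp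
      qed
      have tE': "RP.q 1 (27 * b0 ^ 2) = RP.q 1 ((1 - t) * ?E)"
      proof -
        have "RP.q 1 (?E - 4 * a0 ^ 3) = RP.q 1 (?E - t * ?E)"
          by (rule RP.q_diff_cong[OF refl tE])
        moreover have "?E - 4 * a0 ^ 3 = 27 * b0 ^ 2" "?E - t * ?E = (1 - t) * ?E"
          by (simp_all add: algebra_simps)
        ultimately show ?thesis by (simp only:)
      qed
      have "RP.q 1 (w * ?H) = RP.q 1 (\<Sum>i\<le>n. of_nat (c i) * (t * ?E) ^ i * ((1 - t) * ?E) ^ (n - i))"
        unfolding w by (intro RP.q_sum_cong RP.q_mult_cong RP.q_power_cong refl tE tE')
      also have "(\<Sum>i\<le>n. of_nat (c i) * (t * ?E) ^ i * ((1 - t) * ?E) ^ (n - i)) = ?E ^ n * poly P t"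
        unfolding poly_P sum_distrib_left
      proof (intro sum.cong refl)
        fix i assume "i \<in> {..n}"
        then have "?E ^ n = ?E ^ i * ?E ^ (n - i)"
          by (simp flip: power_add)
        then show "of_nat (c i) * (t * ?E) ^ i * ((1 - t) * ?E) ^ (n - i)
          = ?E ^ n * (of_nat (c i) * t ^ i * (1 - t) ^ (n - i))"
          by (simp only: power_mult_distrib mult_ac)
      qed
      finally have "RP.q 1 (?E ^ n * poly P t) = \<zero>\<^bsub>RP.Q 1\<^esub>"
        unfolding RP.q_mult[of 1 w] H0 by simp
      then have "RP.q 1 (E' ^ n * (?E ^ n * poly P t)) = \<zero>\<^bsub>RP.Q 1\<^esub>"
        unfolding RP.q_mult[of 1 "E' ^ n"] by simp
      moreover have "RP.q 1 (E' ^ n * (?E ^ n * poly P t)) = RP.q 1 (1 ^ n * poly P t)"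
        unfolding mult.assoc[symmetric] power_mult_distrib[symmetric]
        by (intro RP.q_mult_cong RP.q_power_cong EE' refl)
      ultimately show False
        using Pt by simp
    qed
    then obtain l where "l \<in> carrier R" "pr R ?H \<otimes>\<^bsub>R\<^esub> l = \<one>\<^bsub>R\<^esub>"
      using unit[OF RP.pr_A_closed] unfolding RP.q_eq_zero_iff by blast
    then have l: "l \<in> carrier R" "l \<otimes>\<^bsub>R\<^esub> pr R ?H = \<one>\<^bsub>R\<^esub>"
      using R.m_comm[OF RP.pr_A_closed] by simp_all
    show ?thesis
      by (rule c.ordinary_lie_invariant[OF assms(1) p5 assms(8) units roots a0 b0 l])
  qed
  ultimately show ?thesis
    unfolding Q1 unfolding J1 by blast
qed

end
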